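(* Let $(\phi_t)$ be a one-parameter semigroup in $\mathbb D$ with infinitesimal generator $G$ and Kœnigs function $h$, and let $x\in\partial\mathbb D$. Suppose there is a Jordan domain $\Omega_0\subset h(\mathbb D)$ with $w_0:=h(x)\in\partial\Omega_0$ such that $h(\{sx:r\le s<1\})\subset\Omega_0$ for some $r\in(0,1)$ and $\partial\Omega_0$ has a Dini-smooth corner of opening $2\pi$ at $w_0$. Then $x$ is a regular pole of $G$.
   Context: One-parameter semigroup $(\phi_t)$ in $\mathbb D$: continuous homomorphism from $([0,\infty),+)$ to holomorphic self-maps of $\mathbb D$ under composition, none an automorphism for $t>0$; generator $G$ with $\partial_t\phi_t=G\circ\phi_t$; Denjoy–Wolff point $\tau=\lim_{t\to\infty}\phi_t$. Kœnigs function: the univalent $h$ with $h(\tau)=0,h'(\tau)=1,h\circ\phi_t=e^{G'(\tau)t}h$ if $\tau\in\mathbb D$, and $h(0)=0$, $h\circ\phi_t=h+t$ if $\tau\in\partial\mathbb D$; $h(x)$ is the angular limit at $x$. A point $x\in\partial\mathbb D$ is a regular pole of $G$ if $\angle\liminf_{z\to x}|G(z)(x-z)|\in(0,+\infty)$. A Jordan curve $\Gamma$ has a Dini-smooth corner of opening $\theta$ at $w_0\in\Gamma$ if: for small $\rho>0$, $\Gamma$ meets $\{|w-w_0|=\rho\}$ in exactly two points $\gamma^\pm(\rho)$ depending continuously on $\rho$; $\rho\mapsto\arg(\gamma^\pm(\rho)-w_0)$ extend continuously to $\rho=0$ with a modulus of continuity $\omega$ satisfying $\int_0^\epsilon\omega(t)/t\,dt<\infty$;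 and the interior angle between the one-sided tangents at $w_0$ (w.r.t. the Jordan domain bounded by $\Gamma$) equals $\theta$. *)

theory Defs
  imports "HOL-Analysis.Analysis"
begin

text \<open>One-parameter semigroup of holomorphic self-maps of the unit disc (no automorphisms for t > 0).
  Continuity of the homomorphism is expressed as joint continuity of (t,z) to phi t z.\<close>
definition one_param_semigroup :: "(real \<Rightarrow> complex \<Rightarrow> complex) \<Rightarrow> bool" where
  "one_param_semigroup \<phi> \<longleftrightarrow>
     (\<forall>t\<ge>0. \<phi> t holomorphic_on ball 0 1 \<and> \<phi> t ` ball 0 1 \<subseteq> ball 0 1) \<and>
     (\<forall>z\<in>ball 0 1. \<phi> 0 z = z) \<and>
     (\<forall>s\<ge>0. \<forall>t\<ge>0. \<forall>z\<in>ball 0 1. \<phi> (s + t) z = \<phi> s (\<phi> t z)) \<and>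
     continuous_on ({0..} \<times> ball 0 1) (\<lambda>(t, z). \<phi> t z) \<and>
     (\<forall>t>0. \<not> bij_betw (\<phi> t) (ball 0 1) (ball 0 1))"

definition is_generator :: "(real \<Rightarrow> complex \<Rightarrow> complex) \<Rightarrow> (complex \<Rightarrow> complex) \<Rightarrow> bool" where
  "is_generator \<phi> G \<longleftrightarrow> G holomorphic_on ball 0 1 \<and>
     (\<forall>z\<in>ball 0 1. \<forall>t\<ge>0. ((\<lambda>s. \<phi> s z) has_vector_derivative G (\<phi> t z)) (at t within {0..}))"

definition denjoy_wolff_point :: "(real \<Rightarrow> complex \<Rightarrow> complex) \<Rightarrow> complex \<Rightarrow> bool" where
  "denjoy_wolff_point \<phi> \<tau> \<longleftrightarrow> cmod \<tau> \<le> 1 \<and> (\<forall>z\<in>ball 0 1. ((\<lambda>t. \<phi> t z) \<longlongrightarrow> \<tau>) at_top)"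

definition koenigs_function ::
  "(real \<Rightarrow> complex \<Rightarrow> complex) \<Rightarrow> (complex \<Rightarrow> complex) \<Rightarrow> complex \<Rightarrow> (complex \<Rightarrow> complex) \<Rightarrow> bool" where
  "koenigs_function \<phi> G \<tau> h \<longleftrightarrow> h holomorphic_on ball 0 1 \<and> inj_on h (ball 0 1) \<and>
     (if \<tau> \<in> ball 0 1 then
        h \<tau> = 0 \<and> deriv h \<tau> = 1 \<and>
        (\<forall>t\<ge>0. \<forall>z\<in>ball 0 1. h (\<phi> t z) = exp (deriv G \<tau> * of_real t) * h z)
      else
        h 0 = 0 \<and> (\<forall>t\<ge>0. \<forall>z\<in>ball 0 1. h (\<phi> t z) = h z + of_real t))"

definition stolz :: "complex \<Rightarrow> real \<Rightarrow> complex set" where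
  "stolz x R = {z \<in> ball 0 1. cmod (x - z) < R * (1 - cmod z)}"

definition nontangential :: "complex \<Rightarrow> complex filter" where
  "nontangential x = (SUP R\<in>{1<..}. at x within stolz x R)"

definition angular_limit :: "(complex \<Rightarrow> complex) \<Rightarrow> complex \<Rightarrow> complex \<Rightarrow> bool" where
  "angular_limit f x L \<longleftrightarrow> filterlim f (nhds L) (nontangential x)"

definition regular_pole :: "(complex \<Rightarrow> complex) \<Rightarrow> complex \<Rightarrow> bool" where
  "regular_pole G x \<longleftrightarrow>
     (let l = Liminf (nontangential x) (\<lambda>z. ereal (cmod (G z * (x - z)))) in 0 < l \<and> l < \<infinity>)"

definition jordan_domain :: "complex set \<Rightarrow> bool" where
  "jordan_domain \<Omega> \<longleftrightarrow>
     (\<exists>g. simple_path g \<and> pathfinish g = pathstart g \<and> \<Omega> = inside (path_image g))"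

text \<open>Dini-smooth corner of opening theta at w0 of the boundary of a Jordan domain Omega.
  ap, am are continuous branches of arg(gamma^{+-}(rho) - w0), extended continuously to rho = 0,
  with a common Dini modulus of continuity omega; the open arc of the circle from angle am rho to
  angle ap rho (counterclockwise) is the one lying in Omega, so the interior angle between the
  one-sided tangents is ap 0 - am 0.\<close>
definition dini_corner :: "complex set \<Rightarrow> complex \<Rightarrow> real \<Rightarrow> bool" where
  "dini_corner \<Omega> w0 \<theta> \<longleftrightarrow>
     (\<exists>\<epsilon>>0. \<exists>ap am :: real \<Rightarrow> real. \<exists>\<omega> :: real \<Rightarrow> real.
        continuous_on {0..\<epsilon>} ap \<and> continuous_on {0..\<epsilon>} am \<and>
        (\<forall>\<rho>\<in>{0<..\<epsilon>}.
           frontier \<Omega> \<inter> sphere w0 \<rho> = {w0 + of_real \<rho> * cis (ap \<rho>), w0 + of_real \<rho> * cis (am \<rho>)} \<and>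
           0 < ap \<rho> - am \<rho> \<and> ap \<rho> - am \<rho> < 2 * pi \<and>
           (\<forall>s. am \<rho> < s \<and> s < ap \<rho> \<longrightarrow> w0 + of_real \<rho> * cis s \<in> \<Omega>)) \<and>
        (\<forall>t\<ge>0. 0 \<le> \<omega> t) \<and> mono_on {0..} \<omega> \<and> (\<omega> \<longlongrightarrow> 0) (at_right 0) \<and>
        (\<forall>s\<in>{0..\<epsilon>}. \<forall>t\<in>{0..\<epsilon>}. \<bar>ap s - ap t\<bar> \<le> \<omega> \<bar>s - t\<bar> \<and> \<bar>am s - am t\<bar> \<le> \<omega> \<bar>s - t\<bar>) \<and>
        (\<lambda>t. \<omega> t / t) integrable_on {0..\<epsilon>} \<and>
        \<theta> = ap 0 - am 0)"

end

theory Submission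
  imports Defs "HOL-Complex_Analysis.Complex_Analysis"
begin

text \<open>
  Since \<open>w0\<close> is the radial limit of the univalent map \<open>h\<close> at \<open>x\<close>, it is not a value of \<open>h\<close>, and the
  functional equation then excludes a whole slit starting at \<open>w0\<close>: the half-line \<open>w0 - t\<close>, or the
  spiral \<open>w0 exp (-\<lambda> t)\<close> with \<open>\<lambda> = G' \<tau>\<close>.  In the coordinate \<open>F = h - w0\<close>, respectively
  \<open>F = log (h / w0) / \<lambda>\<close>, the slit is the negative real axis, \<open>F' G = 1\<close>, and \<open>sqrt F\<close> maps into the
  right half-plane.  By the Julia-Caratheodory theorem the claim reduces to Julia's condition, that is,
  to a sequence \<open>z n \<longlonglongrightarrow> x\<close> along which \<open>sqrt |h (z n) - w0|\<close> is at most a constant times \<open>1 - |z n|\<close>;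
  it even yields that \<open>|G z (x - z)|\<close> has a positive finite angular limit.

  The inner domain supplies this sequence.  In the coordinate \<open>y = sqrt (h - w0)\<close> it contains a
  half-disc up to a Dini-small tangential part, and a harmonic barrier on that region gives
  \<open>1 - |h\<^sup>-\<^sup>1| \<ge> c |y|\<close> in a fixed sector around the axis.  Points of the sector that tend to \<open>x\<close> are
  found by a two-constants estimate for \<open>h\<^sup>-\<^sup>1 - x\<close>, which is small along the image of the radius.
\<close>


section \<open>The Julia-Caratheodory theorem in the half-plane\<close>

text \<open>The two halves of the claim have different sources. Move \<open>x\<close> to infinity by
  a half-plane chart and put \<open>p = 1 / csqrt (F - b)\<close>. The slit gives
  \<open>Re p > 0\<close>, which makes the angular derivative \<open>C\<close> of \<open>p\<close>
  at infinity finite; that \<open>C\<close> is positive is what the corner has to supply, because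
  Julia's condition says that \<open>Re p\<close> dominates a multiple of \<open>Re w\<close>. Since
  \<open>F - b\<close> is the inverse square of \<open>p\<close>, the relation
  \<open>F' G = chart'\<close> turns \<open>C\<close> into the limit \<open>2 * C^2\<close> of the
  modulus of \<open>G z (x - z)\<close>. The opening \<open>2 * pi\<close> is the one that a square
  root flattens to a half-plane, where decay at the boundary is linear. Two obstacles shape the
  proof. The image of the radius may run to \<open>w0\<close> tangentially to the sides of the
  corner, outside every sector with a good bound, and sector points near \<open>w0\<close> need not
  have preimages near \<open>x\<close>; hence the transfer from the curve to the sector. With an
  interior Denjoy-Wolff point, \<open>F\<close> involves a logarithm, the candidates for
  \<open>b\<close> form a lattice, and the right one could change along the sequence; hence Julia's
  argument is run over a discrete set of candidates.\<close>

definition halfplane :: "complex set" where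
  "halfplane = {z. Re z > 0}"

lemma halfplane_iff [simp]: "z \<in> halfplane \<longleftrightarrow> Re z > 0"
  by (simp add: halfplane_def)

lemma open_halfplane [simp, intro]: "open halfplane"
  by (simp add: halfplane_def open_halfspace_Re_gt)

lemma convex_halfplane: "convex halfplane"
  by (simp add: halfplane_def convex_halfspace_Re_gt)

text \<open>The identity behind all Cayley estimates below: it shows that
  \<open>(w - b) / (w + cnj b)\<close> has modulus less than 1, and it trades differences for real
  parts in Schwarz-Pick.\<close>

lemma cmod_cnj_add_diff: "cmod (w + cnj b)^2 - cmod (w - b)^2 = 4 * Re w * Re b"
  unfolding cmod_power2 by (simp add: power2_eq_square algebra_simps)

lemma add_cnj_nonzero: "Re w > 0 \<Longrightarrow> Re b > 0 \<Longrightarrow> w + cnj b \<noteq> 0"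
  by (auto simp: complex_eq_iff)

lemma schwarz_pick_halfplane:
  assumes f: "f holomorphic_on halfplane" "\<And>z. Re z > 0 \<Longrightarrow> Re (f z) > 0"
    and a: "Re a > 0" and z: "Re z > 0"
  shows "cmod (f z - f a) * cmod (z + cnj a) \<le> cmod (f z + cnj (f a)) * cmod (z - a)"
proof -
  \<comment> \<open>\<open>S\<close> is the Riemann map of the disc onto the half-plane with
    \<open>S 0 = a\<close>, and \<open>T\<close> a Cayley map that sends \<open>f a\<close> to 0, so
    the Schwarz lemma applies to \<open>T\<close> after \<open>f\<close> after
    \<open>S\<close>.\<close>
  define S where "S u = \<i> * of_real (Im a) + of_real (Re a) * ((1 + u) / (1 - u))" for u :: complex
  define T where "T w = (w - f a) / (w + cnj (f a))" for w
  have ReS: "Re (S u) > 0" if "cmod u < 1" for u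
  proof -
    have "Re ((1 + u) / (1 - u)) = (1 - cmod u ^ 2) / (cmod (1 - u))^2"
      unfolding Re_divide cmod_power2 by (simp add: power2_eq_square algebra_simps)
    moreover have "cmod u ^ 2 < 1" "1 - u \<noteq> 0" using that by (auto simp: abs_square_less_1)
    ultimately have "Re ((1 + u) / (1 - u)) > 0" by simp
    moreover have "Re (S u) = Re a * Re ((1 + u) / (1 - u))"
      unfolding S_def by (simp del: times_divide_eq_right)
    ultimately show ?thesis using a by simp
  qed
  have holS: "S holomorphic_on ball 0 1"
    unfolding S_def by (intro holomorphic_intros) auto
  have "(f \<circ> S) holomorphic_on ball 0 1"
    by (rule holomorphic_on_compose_gen[OF holS f(1)]) (use ReS in auto)
  then have hol: "(\<lambda>u. T (f (S u))) holomorphic_on ball 0 1"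
    unfolding T_def o_def
    by (intro holomorphic_intros) (use add_cnj_nonzero[OF f(2)[OF ReS] f(2)[OF a]] in auto)
  have S0: "S 0 = a" by (simp add: S_def complex_eq_iff)
  have lt: "cmod (T (f (S u))) < 1" if "cmod u < 1" for u
  proof -
    have "cmod (f (S u) - f a)^2 < cmod (f (S u) + cnj (f a))^2"
      using cmod_cnj_add_diff[of "f (S u)" "f a"] f(2)[OF ReS[OF that]] f(2)[OF a]
      by (smt (verit) mult_pos_pos)
    then have "cmod (f (S u) - f a) < cmod (f (S u) + cnj (f a))"
      by (rule power2_less_imp_less) auto
    then show ?thesis by (simp add: T_def norm_divide divide_simps)
  qed
  define u where "u = (z - a) / (z + cnj a)"
  have nz: "z + cnj a \<noteq> 0" using add_cnj_nonzero[OF z a] .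
  have "cmod (z - a)^2 < cmod (z + cnj a)^2"
    using cmod_cnj_add_diff[of z a] z a by (smt (verit) mult_pos_pos)
  then have "cmod (z - a) < cmod (z + cnj a)"
    by (rule power2_less_imp_less) auto
  then have u1: "cmod u < 1" by (simp add: u_def norm_divide divide_simps)
  have Su: "S u = z"
  proof -
    have e1: "1 + u = (2 * z + cnj a - a) / (z + cnj a)" and e2: "1 - u = (a + cnj a) / (z + cnj a)"
      using nz by (simp_all add: u_def field_simps)
    have e3: "a + cnj a = of_real (2 * Re a)" "cnj a - a = - 2 * \<i> * of_real (Im a)"
      by (simp_all add: complex_eq_iff)
    have "(1 + u) / (1 - u) = (2 * z + (cnj a - a)) / (a + cnj a)"
      unfolding e1 e2 using nz by (simp add: add_diff_eq)
    also have "\<dots> = (z - \<i> * of_real (Im a)) / of_real (Re a)"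
      unfolding e3 using a by (simp add: field_simps)
    finally show ?thesis using a by (simp add: S_def)
  qed
  have "cmod (T (f (S u))) \<le> cmod u"
    by (rule Schwarz_Lemma(1)[OF hol _ lt u1]) (simp_all add: S0 T_def)
  then have "cmod (f z - f a) / cmod (f z + cnj (f a)) \<le> cmod (z - a) / cmod (z + cnj a)"
    by (simp add: Su T_def norm_divide, simp add: u_def norm_divide)
  then show ?thesis
    using nz add_cnj_nonzero[OF f(2)[OF z] f(2)[OF a]] by (simp add: divide_simps mult.commute)
qed

text \<open>Square Schwarz-Pick and rewrite both squared differences by
  \<open>cmod_cnj_add_diff\<close>; the product \<open>P * Q\<close> cancels. This form keeps its
  content when one of the two points goes to infinity.\<close>

lemma schwarz_pick_halfplane_Re:
  assumes f: "f holomorphic_on halfplane" "\<And>z. Re z > 0 \<Longrightarrow> Re (f z) > 0"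
    and a: "Re a > 0" and z: "Re z > 0"
  shows "Re z * Re a * cmod (f z + cnj (f a))^2 \<le> Re (f z) * Re (f a) * cmod (z + cnj a)^2"
proof -
  define P Q A B where "P = cmod (f z + cnj (f a))^2" and "Q = cmod (z + cnj a)^2"
    and "A = cmod (f z - f a)^2" and "B = cmod (z - a)^2"
  have "A * Q \<le> P * B"
    using power_mono[OF schwarz_pick_halfplane[OF assms], of 2]
    by (simp add: P_def Q_def A_def B_def power_mult_distrib)
  moreover have "A = P - 4 * Re (f z) * Re (f a)" "B = Q - 4 * Re z * Re a"
    using cmod_cnj_add_diff[of "f z" "f a"] cmod_cnj_add_diff[of z a]
    by (simp_all add: P_def Q_def A_def B_def)
  ultimately show ?thesis
    unfolding P_def[symmetric] Q_def[symmetric] by (simp add: algebra_simps)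
qed

text \<open>Divide Schwarz-Pick by \<open>cmod (z - a)\<close> and let \<open>z\<close> tend to
  \<open>a\<close>.\<close>

lemma deriv_bound_halfplane:
  assumes f: "f holomorphic_on halfplane" "\<And>z. Re z > 0 \<Longrightarrow> Re (f z) > 0"
    and a: "Re a > 0"
  shows "cmod (deriv f a) * Re a \<le> Re (f a)"
proof -
  have df: "(f has_field_derivative deriv f a) (at a)"
    using f(1) a by (intro holomorphic_derivI[of f halfplane]) auto
  have l1: "((\<lambda>z. cmod ((f z - f a) / (z - a)) * cmod (z + cnj a)) \<longlongrightarrow> cmod (deriv f a) * cmod (a + cnj a)) (at a)"
    using df unfolding has_field_derivative_iff by (intro tendsto_intros)
  have "isCont f a" using df DERIV_isCont by blast
  then have l2: "((\<lambda>z. cmod (f z + cnj (f a))) \<longlongrightarrow> cmod (f a + cnj (f a))) (at a)"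
    by (intro tendsto_intros) (simp add: isCont_def)
  have "\<forall>\<^sub>F z in at a. z \<in> halfplane - {a}"
    using a by (intro eventually_at_in_open) auto
  then have "\<forall>\<^sub>F z in at a. cmod ((f z - f a) / (z - a)) * cmod (z + cnj a) \<le> cmod (f z + cnj (f a))"
  proof eventually_elim
    case (elim z)
    then show ?case
      using schwarz_pick_halfplane[OF f a, of z] by (simp add: norm_divide divide_simps)
  qed
  then have "cmod (deriv f a) * cmod (a + cnj a) \<le> cmod (f a + cnj (f a))"
    by (rule tendsto_le[OF _ l2 l1, rotated]) simp
  moreover have "cmod (w + cnj w) = 2 * Re w" if "Re w > 0" for w
    using that by (simp add: complex_add_cnj)
  ultimately show ?thesis using a f(2)[OF a] by simp
qed

text \<open>Only the limits at infinity inside the angles are needed, so they are stated with explicit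
  bounds.  The function \<^term>\<open>p\<close> minus its largest admissible linear part has a ratio of real
  parts that comes arbitrarily close to zero, and the Schwarz-Pick inequality with respect to a point
  where it is small controls it throughout each angle.\<close>

lemma julia_caratheodory:
  assumes p: "p holomorphic_on halfplane" and c: "c > 0"
    and pc: "\<And>z. Re z > 0 \<Longrightarrow> c * Re z \<le> Re (p z)"
  obtains C where "C > 0"
    "\<And>M e. e > 0 \<Longrightarrow> \<exists>B. \<forall>z. Re z > 0 \<and> cmod z \<le> M * Re z \<and> B \<le> cmod z \<longrightarrow>
        cmod (p z / z - of_real C) \<le> e \<and> cmod (deriv p z - of_real C) \<le> e"
proof -
  \<comment> \<open>The infimum \<open>C\<close> of \<open>R\<close> is the largest constant with
    \<open>C * Re z \<le> Re (p z)\<close> throughout, and \<open>C \<ge> c\<close> gives its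
    positivity.\<close>
  define R where "R = (\<lambda>z. Re (p z) / Re z) ` halfplane"
  have Rc: "c \<le> r" if "r \<in> R" for r
    using that pc by (auto simp: R_def pos_le_divide_eq)
  have Rne: "R \<noteq> {}" unfolding R_def using halfplane_iff[of 1] by force
  have bdd: "bdd_below R" using Rc by (meson bdd_belowI)
  define C where "C = Inf R"
  have "C \<ge> c" unfolding C_def by (rule cInf_greatest[OF Rne Rc])
  have C0: "C > 0" using \<open>C \<ge> c\<close> c by simp
  have CRe: "C * Re z \<le> Re (p z)" if "Re z > 0" for z
  proof -
    have "C \<le> Re (p z) / Re z" unfolding C_def
      by (rule cInf_lower[OF _ bdd]) (use that in \<open>auto simp: R_def\<close>)
    then show ?thesis using that by (simp add: pos_le_divide_eq)
  qed
  have small: "\<exists>B. \<forall>z. Re z > 0 \<and> cmod z \<le> M * Re z \<and> B \<le> cmod z \<longrightarrow>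
        cmod (p z / z - of_real C) \<le> 33 * d * M \<and> cmod (deriv p z - of_real C) \<le> 32 * d * M\<^sup>2"
    if d: "d > 0" and M: "M > 0" for M d
  proof -
    obtain z0 where z0: "Re z0 > 0" "Re (p z0) / Re z0 < C + d"
      using cInf_lessD[OF Rne, of "C + d"] d by (auto simp: R_def C_def)
    \<comment> \<open>Adding \<open>t\<close> makes \<open>Re (g z)\<close> strictly positive
      everywhere; its size is matched to the excess at \<open>z0\<close>, which it at most doubles
      to \<open>2 * d * Re z0\<close>.\<close>
    define t where "t = d * Re z0"
    have t: "t > 0" using d z0 by (simp add: t_def)
    define g where "g z = p z - of_real C * z + of_real t" for z
    have g: "g holomorphic_on halfplane" unfolding g_def by (intro holomorphic_intros p)
    have gpos: "Re (g z) > 0" if "Re z > 0" for z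
      using CRe[OF that] t by (simp add: g_def)
    have "Re (p z0) < (C + d) * Re z0" using z0 by (simp add: pos_divide_less_eq)
    then have g0: "Re (g z0) \<le> 2 * d * Re z0"
      by (simp add: g_def t_def algebra_simps)
    \<comment> \<open>Beyond \<open>K\<close> the case \<open>cmod (g z) < 2 * cmod (g z0)\<close>
      satisfies the target trivially. In the other case \<open>g z + cnj (g z0)\<close> has modulus
      at least \<open>cmod (g z) / 2\<close>, and one factor \<open>cmod (g z)\<close> cancels from
      Schwarz-Pick.\<close>
    define K where "K = 2 * cmod (g z0) / (32 * d * M)"
    have main: "cmod (g z) \<le> 32 * d * M * cmod z"
      if z: "Re z > 0" "cmod z \<le> M * Re z" "cmod z0 \<le> cmod z" "K \<le> cmod z" for z
    proof (cases "cmod (g z) < 2 * cmod (g z0)")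
      case True
      then show ?thesis using z(4) d M unfolding K_def by (simp add: field_simps)
    next
      case False
      then have "cmod (g z) / 2 \<le> cmod (g z) - cmod (cnj (g z0))" by simp
      also have "\<dots> \<le> cmod (g z + cnj (g z0))" using norm_diff_ineq by blast
      finally have "(cmod (g z) / 2)^2 \<le> cmod (g z + cnj (g z0))^2" by (rule power_mono) simp
      then have "Re z * Re z0 * (cmod (g z) / 2)^2 \<le> Re z * Re z0 * cmod (g z + cnj (g z0))^2"
        using z z0 by (intro mult_left_mono) auto
      also have "\<dots> \<le> Re (g z) * Re (g z0) * cmod (z + cnj z0)^2"
        by (rule schwarz_pick_halfplane_Re[OF g gpos z0(1) z(1)])
      also have "\<dots> \<le> cmod (g z) * (2 * d * Re z0) * (2 * cmod z)^2"
      proof (intro mult_mono power_mono)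
        show "cmod (z + cnj z0) \<le> 2 * cmod z"
          using norm_triangle_ineq[of z "cnj z0"] z(3) by simp
      qed (use g0 gpos[OF z(1)] gpos[OF z0(1)] d z0 complex_Re_le_cmod in auto)
      finally have "Re z0 * cmod (g z) * (Re z * cmod (g z)) \<le> Re z0 * cmod (g z) * (32 * d * cmod z ^ 2)"
        by (simp add: power2_eq_square algebra_simps)
      moreover have "cmod (g z) > 0" using gpos[OF z(1)] by auto
      ultimately have "Re z * cmod (g z) \<le> 32 * d * cmod z ^ 2" using z0 by simp
      moreover have "cmod z * cmod (g z) \<le> (M * Re z) * cmod (g z)"
        using z by (intro mult_right_mono) auto
      ultimately have "cmod z * cmod (g z) \<le> M * (32 * d * cmod z ^ 2)"
        using M by (smt (verit) mult.assoc mult_left_mono)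
      then have "cmod z * cmod (g z) \<le> cmod z * (32 * d * M * cmod z)"
        by (simp add: power2_eq_square algebra_simps)
      moreover have "cmod z > 0" using z by auto
      ultimately show ?thesis by simp
    qed
    show ?thesis
    proof (intro exI allI impI)
      fix z assume "Re z > 0 \<and> cmod z \<le> M * Re z \<and> Max {cmod z0, K, t / (d * M)} \<le> cmod z"
      then have z: "Re z > 0" "cmod z \<le> M * Re z" "cmod z0 \<le> cmod z" "K \<le> cmod z" "t / (d * M) \<le> cmod z"
        by auto
      have cz: "cmod z > 0" using z by auto
      have gz: "cmod (g z) \<le> 32 * d * M * cmod z" by (rule main) (use z in auto)
      have "cmod (p z - of_real C * z) \<le> cmod (g z) + t"
        using norm_triangle_ineq4[of "g z" "of_real t"] t by (simp add: g_def)
      also have "t \<le> d * M * cmod z" using z(5) d M by (simp add: field_simps)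
      finally have "cmod (p z - of_real C * z) \<le> 33 * d * M * cmod z" using gz by simp
      moreover have "p z / z - of_real C = (p z - of_real C * z) / z" using cz by (simp add: field_simps)
      ultimately have 1: "cmod (p z / z - of_real C) \<le> 33 * d * M"
        using cz by (simp add: norm_divide pos_divide_le_eq)
      have dp: "(p has_field_derivative deriv p z) (at z)"
        using p z(1) by (intro holomorphic_derivI[of p halfplane]) auto
      \<comment> \<open>The derivative bound is applied to \<open>g\<close>, whose real part is
        already small against \<open>cmod z\<close>; passing from \<open>cmod z\<close> to
        \<open>Re z\<close> costs the second factor \<open>M\<close>.\<close>
      have "deriv g z = deriv p z - of_real C"
        unfolding g_def by (rule DERIV_imp_deriv) (auto intro!: derivative_eq_intros dp)
      then have "cmod (deriv p z - of_real C) * Re z \<le> Re (g z)"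
        using deriv_bound_halfplane[OF g gpos z(1)] by simp
      also have "\<dots> \<le> 32 * d * M * cmod z" using gz complex_Re_le_cmod order_trans by blast
      also have "\<dots> \<le> 32 * d * M * (M * Re z)" using z(2) d M by (intro mult_left_mono) auto
      finally have "cmod (deriv p z - of_real C) * Re z \<le> 32 * d * M^2 * Re z"
        by (simp add: power2_eq_square algebra_simps)
      then have 2: "cmod (deriv p z - of_real C) \<le> 32 * d * M^2" using z(1) by simp
      show "cmod (p z / z - of_real C) \<le> 33 * d * M \<and> cmod (deriv p z - of_real C) \<le> 32 * d * M\<^sup>2"
        using 1 2 by simp
    qed
  qed
  show thesis
  proof (rule that[OF C0])
    fix M e :: real assume e: "e > 0"
    \<comment> \<open>\<open>N \<ge> 1\<close> gives \<open>N \<le> N^2\<close>, so a single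
      \<open>d\<close> serves both bounds.\<close>
    define N d where "N = max M 1" and "d = e / (33 * N^2)"
    have N: "N \<ge> 1" "M \<le> N" by (auto simp: N_def)
    then have d: "d > 0" using e by (simp add: d_def)
    have "N \<le> N^2" using N by (simp add: power2_eq_square)
    then have le: "33 * d * N \<le> e" "32 * d * N^2 \<le> e" using N e by (simp_all add: d_def field_simps)
    obtain B where B: "\<forall>z. Re z > 0 \<and> cmod z \<le> N * Re z \<and> B \<le> cmod z \<longrightarrow>
        cmod (p z / z - of_real C) \<le> 33 * d * N \<and> cmod (deriv p z - of_real C) \<le> 32 * d * N\<^sup>2"
      using small[OF d, of N] N by auto
    show "\<exists>B. \<forall>z. Re z > 0 \<and> cmod z \<le> M * Re z \<and> B \<le> cmod z \<longrightarrow>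
        cmod (p z / z - of_real C) \<le> e \<and> cmod (deriv p z - of_real C) \<le> e"
    proof (intro exI allI impI)
      fix z assume z: "Re z > 0 \<and> cmod z \<le> M * Re z \<and> B \<le> cmod z"
      then have "M * Re z \<le> N * Re z" using N by (intro mult_right_mono) auto
      then show "cmod (p z / z - of_real C) \<le> e \<and> cmod (deriv p z - of_real C) \<le> e"
        using B z le by (smt (verit))
    qed
  qed
qed

section \<open>Julia's lemma at infinity and the choice of a branch\<close>

text \<open>Julia's inequality before the limit: the assumption on \<open>e\<close> enters
  Schwarz-Pick, \<open>Re (Q e)\<close> is bounded by \<open>cmod (Q e)\<close>, and
  \<open>cmod (Q e)\<close> cancels. The finite version is kept because it is what confines the
  branches.\<close>

lemma julia_step:
  assumes Q: "Q holomorphic_on halfplane" "\<And>z. Re z > 0 \<Longrightarrow> Re (Q z) > 0"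
    and e: "Re e > 0" "c * cmod (Q e) * cmod e ^ 2 \<le> Re e" and c: "c > 0" and z: "Re z > 0"
  shows "c * Re z * cmod (Q z + cnj (Q e))^2 * cmod e ^ 2 \<le> Re (Q z) * cmod (z + cnj e)^2"
proof -
  let ?X = "cmod (Q z + cnj (Q e))^2"
  have w: "cmod (Q e) > 0" using Q(2)[OF e(1)] by auto
  have "Re z * (c * cmod (Q e) * cmod e ^ 2) * ?X \<le> Re z * Re e * ?X"
    using e z by (intro mult_right_mono mult_left_mono) auto
  also have "\<dots> \<le> Re (Q z) * Re (Q e) * cmod (z + cnj e)^2"
    by (rule schwarz_pick_halfplane_Re[OF Q e(1) z])
  also have "\<dots> \<le> Re (Q z) * cmod (Q e) * cmod (z + cnj e)^2"
    using Q(2)[OF z] complex_Re_le_cmod by (intro mult_right_mono mult_left_mono) auto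
  finally have "cmod (Q e) * (c * Re z * ?X * cmod e ^ 2) \<le> cmod (Q e) * (Re (Q z) * cmod (z + cnj e)^2)"
    by (simp add: algebra_simps)
  then show ?thesis using w by simp
qed

text \<open>Divide \<open>julia_step\<close> by \<open>cmod (e n) ^ 2\<close> and let
  \<open>n\<close> grow. The conclusion says that \<open>1 / Q\<close> has real part at least
  \<open>c * Re z\<close>, the hypothesis of \<open>julia_caratheodory\<close>.\<close>

lemma julia_halfplane:
  fixes e :: "nat \<Rightarrow> complex"
  assumes Q: "Q holomorphic_on halfplane" "\<And>z. Re z > 0 \<Longrightarrow> Re (Q z) > 0"
    and e: "\<And>n. Re (e n) > 0" "\<And>n. c * cmod (Q (e n)) * cmod (e n) ^ 2 \<le> Re (e n)"
    and lim: "filterlim (\<lambda>n. cmod (e n)) at_top sequentially" "(\<lambda>n. Q (e n)) \<longlonglongrightarrow> 0"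
    and c: "c > 0" and z: "Re z > 0"
  shows "c * Re z * cmod (Q z) ^ 2 \<le> Re (Q z)"
proof -
  have inv: "(\<lambda>n. inverse (cmod (e n))) \<longlonglongrightarrow> 0"
    using lim(1) by (rule tendsto_inverse_0_at_top)
  have ineq: "c * Re z * cmod (Q z + cnj (Q (e n)))^2 \<le> Re (Q z) * (cmod z * inverse (cmod (e n)) + 1)^2" for n
  proof -
    have pos: "cmod (e n) > 0" using e(1)[of n] by auto
    have "c * Re z * cmod (Q z + cnj (Q (e n)))^2 * cmod (e n) ^ 2 \<le> Re (Q z) * cmod (z + cnj (e n))^2"
      by (rule julia_step[OF Q e c z])
    also have "\<dots> \<le> Re (Q z) * (cmod z + cmod (e n))^2"
      using Q(2)[OF z] norm_triangle_ineq[of z "cnj (e n)"]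
      by (intro mult_left_mono power_mono) auto
    also have "cmod z + cmod (e n) = (cmod z * inverse (cmod (e n)) + 1) * cmod (e n)"
      using pos by (simp add: field_simps)
    finally have "c * Re z * cmod (Q z + cnj (Q (e n)))^2 * cmod (e n)^2
      \<le> Re (Q z) * (cmod z * inverse (cmod (e n)) + 1)^2 * cmod (e n)^2"
      by (simp add: power_mult_distrib mult.assoc)
    then show ?thesis using pos by simp
  qed
  have l1: "(\<lambda>n. c * Re z * cmod (Q z + cnj (Q (e n)))^2) \<longlonglongrightarrow> c * Re z * cmod (Q z + cnj 0)^2"
    using lim(2) by (intro tendsto_intros)
  have l2: "(\<lambda>n. Re (Q z) * (cmod z * inverse (cmod (e n)) + 1)^2) \<longlonglongrightarrow> Re (Q z) * (cmod z * 0 + 1)^2"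
    using inv by (intro tendsto_intros)
  show ?thesis
    using LIMSEQ_le[OF l1 l2] ineq by auto
qed

lemma Re_csqrt_pos: "z \<notin> \<real>\<^sub>\<le>\<^sub>0 \<Longrightarrow> Re (csqrt z) > 0"
  by (metis Re_csqrt complex_nonpos_Reals_iff csqrt_eq_0 less_eq_real_def csqrt.sel(2) csqrt_principal
      complex_eq_iff zero_complex.sel power2_csqrt Re_power2 Im_power2 mult_zero_left mult_zero_right
      diff_0 neg_le_0_iff_le zero_le_power2 zero_power2)

text \<open>The branches \<^term>\<open>a n\<close> cannot escape to infinity, because the estimate of \<open>julia_step\<close>
  at a single point bounds them; so one of them recurs.\<close>

lemma julia_branches:
  fixes e a :: "nat \<Rightarrow> complex"
  assumes F: "F holomorphic_on halfplane"
    and slit: "\<And>b z. b \<in> A \<Longrightarrow> Re z > 0 \<Longrightarrow> F z - b \<notin> \<real>\<^sub>\<le>\<^sub>0"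
    and A: "\<And>B. finite (A \<inter> cball 0 B)" and aA: "\<And>n. a n \<in> A"
    and e: "\<And>n. Re (e n) > 0" "\<And>n. c * sqrt (cmod (F (e n) - a n)) * cmod (e n) ^ 2 \<le> Re (e n)"
    and lim: "filterlim (\<lambda>n. cmod (e n)) at_top sequentially" "(\<lambda>n. F (e n) - a n) \<longlonglongrightarrow> 0"
    and c: "c > 0"
  obtains b where "b \<in> A"
    "\<And>z. Re z > 0 \<Longrightarrow> c * Re z * cmod (csqrt (F z - b)) ^ 2 \<le> Re (csqrt (F z - b))"
proof -
  define Q where "Q b z = csqrt (F z - b)" for b z
  have holQ: "Q b holomorphic_on halfplane" if "b \<in> A" for b
    unfolding Q_def by (intro holomorphic_intros F) (use slit[OF that] in auto)
  have posQ: "Re (Q b z) > 0" if "b \<in> A" "Re z > 0" for b z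
    unfolding Q_def by (rule Re_csqrt_pos[OF slit[OF that]])
  have cmodQ: "cmod (Q b z) = sqrt (cmod (F z - b))" for b z
    unfolding Q_def by (metis norm_power power2_csqrt norm_ge_zero real_sqrt_abs abs_of_nonneg)
  have Qlim: "(\<lambda>n. sqrt (cmod (F (e n) - a n))) \<longlonglongrightarrow> 0"
    using tendsto_real_sqrt[OF tendsto_norm[OF lim(2)]] by simp
  have "\<forall>\<^sub>F n in sequentially. sqrt (cmod (F (e n) - a n)) < 1"
    using Qlim by (rule order_tendstoD) simp
  moreover have "\<forall>\<^sub>F n in sequentially. cmod (e n) \<ge> 1"
    using lim(1) unfolding filterlim_at_top by blast
  ultimately have "\<forall>\<^sub>F n in sequentially. a n \<in> A \<inter> cball 0 (cmod (F 1) + (max 2 (16 / c))^2)"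
  proof eventually_elim
    case (elim n)
    \<comment> \<open>If \<open>?X > 2\<close>, then \<open>cmod (Q (a n) (e n)) < 1\<close> leaves
      at least \<open>?X / 2\<close> of the sum. With
      \<open>cmod (1 + cnj (e n)) \<le> 2 * cmod (e n)\<close>, \<open>julia_step\<close> at the
      point 1 becomes \<open>c * ?X^2 / 4 \<le> 4 * ?X\<close>, that is,
      \<open>c * ?X \<le> 16\<close>.\<close>
    let ?X = "cmod (Q (a n) 1)"
    have "?X \<le> max 2 (16 / c)"
    proof (rule ccontr)
      assume X: "\<not> ?X \<le> max 2 (16 / c)"
      then have X2: "?X > 2" "?X > 16 / c" by auto
      have "cmod (Q (a n) (e n)) < 1" using elim by (simp add: cmodQ)
      then have "?X / 2 \<le> ?X - cmod (cnj (Q (a n) (e n)))" using X2 unfolding complex_mod_cnj by linarith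
      also have "\<dots> \<le> cmod (Q (a n) 1 + cnj (Q (a n) (e n)))" using norm_diff_ineq by blast
      finally have "(?X / 2)^2 \<le> cmod (Q (a n) 1 + cnj (Q (a n) (e n)))^2" by (rule power_mono) simp
      then have "c * Re 1 * (?X / 2)^2 * cmod (e n)^2 \<le> c * Re 1 * cmod (Q (a n) 1 + cnj (Q (a n) (e n)))^2 * cmod (e n)^2"
        using c by (intro mult_right_mono mult_left_mono) auto
      also have "\<dots> \<le> Re (Q (a n) 1) * cmod (1 + cnj (e n))^2"
        by (rule julia_step[OF holQ[OF aA] posQ[OF aA] e(1) _ c]) (use e(2)[of n] in \<open>auto simp: cmodQ\<close>)
      also have "\<dots> \<le> ?X * (2 * cmod (e n))^2"
      proof (intro mult_mono power_mono)
        show "cmod (1 + cnj (e n)) \<le> 2 * cmod (e n)"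
          using norm_triangle_ineq[of 1 "cnj (e n)"] elim by simp
      qed (use complex_Re_le_cmod in auto)
      finally have "(?X * cmod (e n)^2) * (c * ?X) \<le> (?X * cmod (e n)^2) * 16"
        by (simp add: power2_eq_square algebra_simps)
      moreover have "?X * cmod (e n)^2 > 0" using X2 elim by (intro mult_pos_pos) auto
      ultimately have "c * ?X \<le> 16" using mult_le_cancel_left_pos by blast
      with X2(2) c show False by (simp add: field_simps)
    qed
    then have "?X^2 \<le> (max 2 (16 / c))^2" by (intro power_mono) auto
    then have "cmod (F 1 - a n) \<le> (max 2 (16 / c))^2" by (simp add: cmodQ)
    moreover have "cmod (a n) \<le> cmod (F 1) + cmod (F 1 - a n)"
      by (metis norm_triangle_sub norm_minus_commute)
    ultimately show ?case using aA by auto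
  qed
  then obtain m where m: "\<And>n. n \<ge> m \<Longrightarrow> a n \<in> A \<inter> cball 0 (cmod (F 1) + (max 2 (16 / c))^2)"
    unfolding eventually_sequentially by blast
  have "finite (a ` {m..})"
    by (rule finite_subset[OF _ A[of "cmod (F 1) + (max 2 (16 / c))^2"]]) (use m in blast)
  then obtain k where k: "k \<in> {m..}" "infinite {n \<in> {m..}. a n = a k}"
    using pigeonhole_infinite[of "{m..}" a] infinite_Ici by blast
  define s where "s = enumerate {n \<in> {m..}. a n = a k}"
  have s: "strict_mono s" "\<And>n. a (s n) = a k"
    using k(2) enumerate_in_set[OF k(2)] by (auto simp: s_def strict_mono_enumerate)
  have "c * Re z * cmod (Q (a k) z) ^ 2 \<le> Re (Q (a k) z)" if z: "Re z > 0" for z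
  proof (rule julia_halfplane[where e = "e \<circ> s", OF holQ[OF aA] posQ[OF aA] _ _ _ _ c z])
    show "c * cmod (Q (a k) ((e \<circ> s) n)) * (cmod ((e \<circ> s) n))\<^sup>2 \<le> Re ((e \<circ> s) n)" for n
      using e(2)[of "s n"] s(2)[of n] by (simp add: cmodQ)
    show "filterlim (\<lambda>n. cmod ((e \<circ> s) n)) at_top sequentially"
      using filterlim_compose[OF lim(1) filterlim_subseq[OF s(1)]] by simp
    have "(\<lambda>n. sqrt (cmod (F (e (s n)) - a (s n)))) \<longlonglongrightarrow> 0"
      using filterlim_compose[OF Qlim filterlim_subseq[OF s(1)]] by simp
    then show "(\<lambda>n. Q (a k) ((e \<circ> s) n)) \<longlonglongrightarrow> 0"
      by (subst tendsto_norm_zero_iff[symmetric]) (simp add: cmodQ s(2))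
  qed (use e in auto)
  then show thesis using that[OF aA] unfolding Q_def by blast
qed

section \<open>Boundary decay in a region tangential to the half-plane\<close>

lemma dyadic_interval:
  fixes r :: real
  assumes "m < N" "(1/2)^N \<le> r" "r \<le> (1/2)^m"
  obtains n where "m \<le> n" "n < N" "(1/2)^(Suc n) \<le> r" "r \<le> (1/2)^n"
proof -
  have "\<exists>n. m \<le> n \<and> n < N \<and> (1/2)^(Suc n) \<le> r \<and> r \<le> (1/2)^n"
    using assms
  proof (induction N)
    case (Suc N)
    show ?case
    proof (cases "m < N \<and> (1/2)^N \<le> r")
      case True
      then show ?thesis using Suc.IH Suc.prems less_SucI by blast
    next
      case False
      then have "m = N \<or> r \<le> (1/2)^N" using Suc.prems(1) by linarith
      then show ?thesis using Suc.prems less_Suc_eq_le by blast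
    qed
  qed simp
  then show thesis using that by blast
qed

text \<open>For nonzero \<open>y\<close> the quotient is \<open>1 / (1 / y + 1 / r)\<close>, which
  explains the sign. In the third bound \<open>cmod y ^ 2\<close> in the numerator helps even on the
  imaginary axis, where \<open>Re y\<close> vanishes; the computation yields \<open>1/8\<close>, and
  \<open>1/16\<close> leaves room.\<close>

lemma Re_quotient_bounds:
  assumes y: "Re y \<ge> 0" and r: "r > 0"
  shows "0 \<le> Re (y * of_real r / (y + of_real r))"
    and "Re (y * of_real r / (y + of_real r)) \<le> cmod y"
    and "r / 2 \<le> cmod y \<Longrightarrow> cmod y \<le> r \<Longrightarrow> cmod y / 16 \<le> Re (y * of_real r / (y + of_real r))"
proof -
  let ?q = "y * of_real r / (y + of_real r)"
  let ?d = "cmod (y + of_real r)"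
  have "Re (y + of_real r) \<ge> r" using y by simp
  then have d: "?d \<ge> r" using complex_Re_le_cmod order_trans by blast
  have eq: "Re ?q = r * (cmod y ^ 2 + r * Re y) / ?d ^ 2"
    unfolding Re_divide cmod_power2 by (simp add: power2_eq_square algebra_simps)
  show "0 \<le> Re ?q" unfolding eq using y r by (intro divide_nonneg_nonneg mult_nonneg_nonneg) auto
  have "cmod ?q \<le> cmod y"
  proof -
    have "0 < ?d" using d r by linarith
    then show ?thesis
      using mult_left_mono[OF d, of "cmod y"] r by (simp add: norm_mult norm_divide pos_divide_le_eq)
  qed
  then show "Re ?q \<le> cmod y" using complex_Re_le_cmod order_trans by blast
  assume a: "r / 2 \<le> cmod y" "cmod y \<le> r"
  have "?d \<le> cmod y + r" using norm_triangle_ineq[of y "of_real r"] r by simp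
  then have "?d ^ 2 \<le> (2 * r) ^ 2" using a by (intro power_mono) auto
  moreover have "?d ^ 2 > 0" using d r by (intro zero_less_power) linarith
  moreover have "r * (cmod y * (r / 2)) \<le> r * (cmod y ^ 2 + r * Re y)"
  proof (intro mult_left_mono)
    have "cmod y * (r / 2) \<le> cmod y * cmod y" using a(1) by (intro mult_left_mono) auto
    then show "cmod y * (r / 2) \<le> cmod y ^ 2 + r * Re y"
      using y r by (simp add: power2_eq_square add_increasing2)
  qed (use r in simp)
  ultimately have "r * (cmod y * (r / 2)) / (2 * r)^2 \<le> Re ?q"
    unfolding eq using r y by (intro frac_le mult_nonneg_nonneg add_nonneg_nonneg) auto
  moreover have "r * (cmod y * (r / 2)) / (2 * r)^2 = cmod y / 8"
    using r by (simp add: power2_eq_square field_simps)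
  ultimately show "cmod y / 16 \<le> Re ?q" using norm_ge_zero[of y] by linarith
qed

text \<open>On \<open>Re y \<ge> 0\<close> each summand \<open>Re (y r / (y + r))\<close>, with \<open>r = 2\<^sup>-\<^sup>n\<close>, is nonnegative and comparable
  to \<open>|y|\<close> at the scale \<open>|y| \<approx> r\<close>.  Subtracting suitable multiples from \<open>Re y\<close> leaves a harmonic
  function which is positive only inside the cusp-shaped region \<open>U\<close>, and summability of the apertures
  keeps it comparable to \<open>|y|\<close> near the axis.  The maximum principle is applied to the exponential of
  its holomorphic completion times \<open>\<kappa>\<close>; finite partial sums suffice, as only scales above
  \<open>|y|\<close> matter.\<close>

lemma tangential_region_bound:
  fixes \<kappa> :: "complex \<Rightarrow> complex" and \<mu> :: "nat \<Rightarrow> real"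
  assumes U: "open U" and hol: "\<kappa> holomorphic_on U" and disc: "\<And>y. y \<in> U \<Longrightarrow> cmod (\<kappa> y) < 1"
    and mu: "\<And>n. \<mu> n \<ge> 0" "summable \<mu>"
    and sector: "\<And>n y. m \<le> n \<Longrightarrow> (1/2)^(Suc n) \<le> cmod y \<Longrightarrow> cmod y \<le> (1/2)^n \<Longrightarrow>
        \<mu> n * cmod y < Re y \<Longrightarrow> y \<in> U"
  obtains c \<epsilon> where "c > 0" "\<epsilon> > 0"
    "\<And>y. y \<noteq> 0 \<Longrightarrow> cmod y \<le> \<epsilon> \<Longrightarrow> 9/10 * cmod y \<le> Re y \<Longrightarrow> y \<in> U \<and> c * cmod y \<le> 1 - cmod (\<kappa> y)"
proof -
  define r where "r n = (1/2::real)^n" for n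
  \<comment> \<open>The 16 cancels the \<open>1/16\<close> of \<open>Re_quotient_bounds\<close>. The
    extra \<open>r n\<close>, itself summable, provides the strict inequality that
    \<open>sector\<close> demands.\<close>
  define c where "c n = 16 * (\<mu> n + r n)" for n
  have r0: "r n > 0" for n by (simp add: r_def)
  have c0: "c n \<ge> 0" for n using mu(1)[of n] r0[of n] by (simp add: c_def)
  have "summable c" unfolding c_def r_def by (intro summable_mult summable_add mu(2) summable_geometric) simp
  \<comment> \<open>A tail of total weight at most \<open>1/2\<close> costs at most
    \<open>cmod y / 2\<close>, which leaves \<open>F N\<close> positive where
    \<open>Re y \<ge> 9/10 * cmod y\<close>.\<close>
  then obtain n1 where n1: "\<And>j k. j \<ge> n1 \<Longrightarrow> norm (sum c {j..<k}) < 1/2"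
    unfolding summable_Cauchy by (meson half_gt_zero zero_less_one)
  define n0 where "n0 = max m n1"
  have csum: "sum c {n0..<N} \<le> 1/2" for N
    using n1[of n0 N] by (simp add: n0_def abs_less_iff)
  define e where "e = r n0"
  have e0: "e > 0" by (simp add: e_def r0)
  define F where "F N y = y - (\<Sum>n\<in>{n0..<N}. of_real (c n) * (y * of_real (r n) / (y + of_real (r n))))" for N and y :: complex
  have nz: "y + of_real (r n) \<noteq> 0" if "Re y \<ge> 0" for y :: complex and n
  proof
    assume "y + of_real (r n) = 0"
    then have "Re (y + of_real (r n)) = 0" by simp
    then show False using that r0[of n] by simp
  qed
  have holF: "F N holomorphic_on {y. Re y \<ge> 0}" for N
    unfolding F_def by (intro holomorphic_intros) (use nz in auto)
  have ReF: "Re (F N y) = Re y - (\<Sum>n\<in>{n0..<N}. c n * Re (y * of_real (r n) / (y + of_real (r n))))" for N y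
    unfolding F_def by (simp del: times_divide_eq_right)
  have upper: "Re (F N y) \<le> Re y" if "Re y \<ge> 0" for N y
    unfolding ReF using Re_quotient_bounds(1)[OF that r0] c0 by (simp add: sum_nonneg)
  have lower: "Re (F N y) \<ge> Re y - cmod y / 2" if "Re y \<ge> 0" for N y
  proof -
    have "(\<Sum>n\<in>{n0..<N}. c n * Re (y * of_real (r n) / (y + of_real (r n)))) \<le> (\<Sum>n\<in>{n0..<N}. c n * cmod y)"
      using Re_quotient_bounds(2)[OF that r0] c0 by (intro sum_mono mult_left_mono) auto
    also have "\<dots> \<le> 1/2 * cmod y"
      unfolding sum_distrib_right[symmetric] using csum[of N] by (rule mult_right_mono) simp
    finally show ?thesis unfolding ReF by simp
  qed
  have wide: "(\<mu> n + r n) * cmod y \<le> Re y"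
    if "Re (F N y) \<ge> 0" "Re y \<ge> 0" "n0 \<le> n" "n < N" "r (Suc n) \<le> cmod y" "cmod y \<le> r n" for N n y
  proof -
    have "c n * (cmod y / 16) \<le> c n * Re (y * of_real (r n) / (y + of_real (r n)))"
      using Re_quotient_bounds(3)[OF that(2) r0, of n] that c0 by (intro mult_left_mono) (auto simp: r_def)
    also have "\<dots> \<le> (\<Sum>n\<in>{n0..<N}. c n * Re (y * of_real (r n) / (y + of_real (r n))))"
      using Re_quotient_bounds(1)[OF that(2) r0] c0 that by (intro member_le_sum mult_nonneg_nonneg) auto
    also have "\<dots> \<le> Re y" using that(1) unfolding ReF by simp
    finally show ?thesis by (simp add: c_def algebra_simps)
  qed
  have inU: "y \<in> U" if "Re (F N y) \<ge> 0" "Re y \<ge> 0" "n0 < N" "r N \<le> cmod y" "cmod y \<le> e" for N y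
  proof -
    note y = that
    obtain n where n: "n0 \<le> n" "n < N" "r (Suc n) \<le> cmod y" "cmod y \<le> r n"
      by (rule dyadic_interval[of n0 N "cmod y"]) (use y in \<open>auto simp: r_def e_def\<close>)
    have "cmod y > 0" using that(4) r0[of N] by linarith
    then have "\<mu> n * cmod y < (\<mu> n + r n) * cmod y" using r0[of n] by simp
    also have "\<dots> \<le> Re y" by (rule wide) (use that n in auto)
    finally show ?thesis using sector[of n y] n unfolding r_def n0_def by simp
  qed
  \<comment> \<open>\<open>K\<close> is the part of the outer circle on which
    \<open>Re (F N y)\<close> can be nonnegative, for any \<open>N > n0\<close>. It is a compact
    subset of \<open>U\<close>, so \<open>cmod (\<kappa> y)\<close> is bounded there by some
    \<open>k < 1\<close>.\<close>
  define K where "K = {y. cmod y = e \<and> (\<mu> n0 + e) * e \<le> Re y}"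
  have "K = sphere 0 e \<inter> {y. (\<mu> n0 + e) * e \<le> Re y}" by (auto simp: K_def)
  then have cK: "compact K" by (simp add: compact_Int_closed closed_halfspace_Re_ge)
  have KU: "K \<subseteq> U"
  proof
    fix y assume y: "y \<in> K"
    then have "\<mu> n0 * cmod y < Re y" using e0 unfolding K_def
      by (smt (verit) mem_Collect_eq mult_pos_pos ring_class.ring_distribs(2))
    then show "y \<in> U" using sector[of n0 y] y by (simp add: n0_def K_def e_def r_def)
  qed
  obtain k where k: "0 < k" "k < 1" "\<And>y. y \<in> K \<Longrightarrow> cmod (\<kappa> y) \<le> k"
  proof (cases "K = {}")
    case False
    have "continuous_on K (\<lambda>y. cmod (\<kappa> y))"
      using hol KU by (intro continuous_intros) (meson continuous_on_subset holomorphic_on_imp_continuous_on)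
    then obtain z where z: "z \<in> K" "\<forall>y\<in>K. cmod (\<kappa> y) \<le> cmod (\<kappa> z)"
      using continuous_attains_sup[OF cK False] by blast
    then have "cmod (\<kappa> z) < 1" using disc KU by blast
    then show thesis using z by (intro that[of "max (1/2) (cmod (\<kappa> z))"]) (auto intro: max.coboundedI2)
  qed (use that[of "1/2"] in auto)
  \<comment> \<open>The exponential factor may grow to \<open>exp (d * e)\<close> on
    \<open>K\<close>, and \<open>d\<close> is the rate at which the bound \<open>k\<close> exactly
    compensates this.\<close>
  define d where "d = - ln k / e"
  have d0: "d > 0" using k(1,2) e0 by (simp add: d_def divide_neg_pos)
  have "d * e = - ln k" using e0 by (simp add: d_def)
  then have kd: "k * exp (d * e) = 1" using k(1) by (simp add: exp_minus)
  define t where "t = d / 5"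
  have main: "y \<in> U \<and> cmod (\<kappa> y) \<le> exp (- (t * cmod y))"
    if y: "y \<noteq> 0" "cmod y < e" "9/10 * cmod y \<le> Re y" for y
  proof -
    \<comment> \<open>Cutting at the level \<open>h\<close> keeps the region away from 0, so the
      finitely many scales down to \<open>r N < h\<close> suffice. The fifths come from
      \<open>9/10 - 1/2 = 2/5\<close>: one fifth is spent on \<open>h\<close>, and the other is the
      rate in \<open>t = d / 5\<close>.\<close>
    define h where "h = cmod y / 5"
    have h0: "h > 0" using y by (simp add: h_def)
    obtain N0 where N0: "r N0 < h"
      using real_arch_pow_inv[of h "1/2"] h0 unfolding r_def by auto
    define N where "N = max N0 (Suc n0)"
    have "r N \<le> r N0" unfolding r_def N_def by (intro power_decreasing) auto
    then have N: "r N < h" "n0 < N" using N0 by (auto simp: N_def)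
    define S where "S = {y. Re y > 0 \<and> cmod y < e \<and> Re (F N y) > h}"
    define T where "T = {y. Re y \<ge> 0 \<and> cmod y \<le> e \<and> Re (F N y) \<ge> h}"
    have contF: "continuous_on {y. Re y \<ge> 0} (\<lambda>y. Re (F N y))"
      by (intro continuous_intros holomorphic_on_imp_continuous_on holF)
    have "open ({y. Re y > 0 \<and> cmod y < e} \<inter> (\<lambda>y. Re (F N y)) -` {h<..})"
    proof (rule continuous_open_preimage)
      show "continuous_on {y. Re y > 0 \<and> cmod y < e} (\<lambda>y. Re (F N y))"
        by (rule continuous_on_subset[OF contF]) auto
      show "open {y. Re y > 0 \<and> cmod y < e}"
        by (intro open_Collect_conj open_halfspace_Re_gt open_Collect_less continuous_intros)
    qed simp
    also have "{y. Re y > 0 \<and> cmod y < e} \<inter> (\<lambda>y. Re (F N y)) -` {h<..} = S" by (auto simp: S_def)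
    finally have oS: "open S" .
    have "closed ({y. Re y \<ge> 0 \<and> cmod y \<le> e} \<inter> (\<lambda>y. Re (F N y)) -` {h..})"
    proof (rule continuous_closed_preimage)
      show "continuous_on {y. Re y \<ge> 0 \<and> cmod y \<le> e} (\<lambda>y. Re (F N y))"
        by (rule continuous_on_subset[OF contF]) auto
      show "closed {y. Re y \<ge> 0 \<and> cmod y \<le> e}"
        by (intro closed_Collect_conj closed_halfspace_Re_ge closed_Collect_le continuous_intros)
    qed simp
    also have "{y. Re y \<ge> 0 \<and> cmod y \<le> e} \<inter> (\<lambda>y. Re (F N y)) -` {h..} = T" by (auto simp: T_def)
    finally have cT: "closed T" .
    have clS: "closure S \<subseteq> T" by (rule closure_minimal[OF _ cT]) (auto simp: S_def T_def)
    have Tpos: "Re z > 0" "h \<le> cmod z" if "z \<in> T" for z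
      using upper[of z N] that h0 complex_Re_le_cmod[of z] unfolding T_def by auto
    have TU: "T \<subseteq> U"
    proof
      fix z assume z: "z \<in> T"
      have "r N \<le> cmod z" using Tpos(2)[OF z] N by linarith
      then show "z \<in> U" by (intro inU[of N z]) (use z N h0 in \<open>auto simp: T_def\<close>)
    qed
    define f where "f z = \<kappa> z * exp (of_real d * (F N z - of_real h))" for z
    have cf: "cmod (f z) = cmod (\<kappa> z) * exp (d * (Re (F N z) - h))" for z
      by (simp add: f_def norm_mult norm_exp_eq_Re)
    have holf: "f holomorphic_on T"
      unfolding f_def by (intro holomorphic_intros holomorphic_on_subset[OF hol TU] holomorphic_on_subset[OF holF])
        (auto simp: T_def)
    have "cmod (f y) \<le> 1"
    proof (rule maximum_modulus_frontier[where S = S and f = f])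
      show "f holomorphic_on interior S"
        using holf by (rule holomorphic_on_subset) (use clS interior_subset closure_subset in blast)
      show "continuous_on (closure S) f"
        using holf clS by (meson continuous_on_subset holomorphic_on_imp_continuous_on)
      show "bounded S" by (rule bounded_subset[OF bounded_ball[of 0 e]]) (auto simp: S_def)
      have "Re (F N y) > h" using lower[of y N] y h0 norm_ge_zero[of y] unfolding h_def by linarith
      moreover have "Re y > 0" using y(1,3) zero_less_norm_iff[of y] by linarith
      ultimately show "y \<in> S" using y unfolding S_def by simp
      \<comment> \<open>Either \<open>Re (F N z) = h\<close>, where the exponential has modulus 1,
        or \<open>z\<close> is on the outer circle, where \<open>wide\<close> places it in
        \<open>K\<close>.\<close>
      fix z assume "z \<in> frontier S"
      then have z: "z \<in> T" "z \<notin> S" using clS oS by (auto simp: frontier_def interior_open)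
      have zU: "cmod (\<kappa> z) \<le> 1" using disc[of z] z TU by force
      show "cmod (f z) \<le> 1"
      proof (cases "Re (F N z) = h")
        case True
        then show ?thesis using zU by (simp add: cf)
      next
        case False
        then have ze: "cmod z = e" using z Tpos(1)[OF z(1)] by (auto simp: S_def T_def)
        have "(\<mu> n0 + r n0) * cmod z \<le> Re z"
          by (rule wide[of N]) (use z(1) N h0 in \<open>auto simp: T_def ze, auto simp: e_def r_def\<close>)
        then have "z \<in> K" by (simp add: K_def ze e_def[symmetric])
        then have "cmod (\<kappa> z) \<le> k" by (rule k(3))
        moreover have "Re (F N z) - h \<le> e"
          using upper[of z N] Tpos[OF z(1)] complex_Re_le_cmod[of z] ze h0 by linarith
        then have "exp (d * (Re (F N z) - h)) \<le> exp (d * e)" using d0 by simp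
        ultimately have "cmod (f z) \<le> k * exp (d * e)"
          unfolding cf using k(1) by (intro mult_mono) auto
        then show ?thesis by (simp add: kd)
      qed
    qed
    then have *: "cmod (\<kappa> y) * exp (d * (Re (F N y) - h)) \<le> 1" by (simp add: cf)
    have "cmod y / 5 \<le> Re (F N y) - h" using lower[of y N] y norm_ge_zero[of y] unfolding h_def by linarith
    then have "t * cmod y \<le> d * (Re (F N y) - h)" using d0 unfolding t_def by (simp add: mult_left_mono)
    then have "cmod (\<kappa> y) * exp (t * cmod y) \<le> 1"
      by (intro order_trans[OF _ *] mult_left_mono) auto
    then have "cmod (\<kappa> y) \<le> exp (- (t * cmod y))" by (simp add: exp_minus field_simps)
    moreover have "y \<in> U"
    proof (rule inU[of N y])
      show "Re (F N y) \<ge> 0" using lower[of y N] y norm_ge_zero[of y] by linarith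
      show "Re y \<ge> 0" using y(3) norm_ge_zero[of y] by linarith
      show "r N \<le> cmod y" using N h0 norm_ge_zero[of y] unfolding h_def by linarith
    qed (use N y in auto)
    ultimately show ?thesis by simp
  qed
  have t0: "t > 0" using d0 by (simp add: t_def)
  show thesis
  proof (rule that[of "t / (1 + t * e)" "e / 2"])
    show "t / (1 + t * e) > 0" using t0 e0 by (simp add: add_pos_pos)
    fix y :: complex assume y: "y \<noteq> 0" "cmod y \<le> e / 2" "9/10 * cmod y \<le> Re y"
    then have y': "y \<in> U" "cmod (\<kappa> y) \<le> exp (- (t * cmod y))" using main[of y] e0 by auto
    let ?s = "t * cmod y"
    have s: "0 \<le> ?s" "?s \<le> t * e" using t0 y(2) e0 by (auto intro!: mult_left_mono)
    have "exp (- ?s) \<le> 1 / (1 + ?s)"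
      using exp_ge_add_one_self[of ?s] s by (simp add: exp_minus divide_simps)
    then have "cmod (\<kappa> y) \<le> 1 / (1 + ?s)" using y'(2) by linarith
    moreover have "?s / (1 + ?s) = 1 - 1 / (1 + ?s)" using s by (simp add: field_simps)
    ultimately have "1 - cmod (\<kappa> y) \<ge> ?s / (1 + ?s)" by linarith
    moreover have "?s / (1 + ?s) \<ge> ?s / (1 + t * e)" using s by (intro divide_left_mono) auto
    ultimately show "y \<in> U \<and> t / (1 + t * e) * cmod y \<le> 1 - cmod (\<kappa> y)" using y'(1) by simp
  qed (use e0 in auto)
qed

section \<open>Two constants and crossing curves\<close>

lemma fashoda_complex:
  fixes f g :: "real \<Rightarrow> complex"
  assumes "path f" "path g"
    and f: "\<And>z. z \<in> path_image f \<Longrightarrow> a \<le> Re z \<and> Re z \<le> b \<and> c \<le> Im z \<and> Im z \<le> d"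
    and g: "\<And>z. z \<in> path_image g \<Longrightarrow> a \<le> Re z \<and> Re z \<le> b \<and> c \<le> Im z \<and> Im z \<le> d"
    and ends: "Re (pathstart f) = a" "Re (pathfinish f) = b" "Im (pathstart g) = c" "Im (pathfinish g) = d"
  obtains z where "z \<in> path_image f" "z \<in> path_image g"
proof -
  define V :: "complex \<Rightarrow> real^2" where "V z = vector [Re z, Im z]" for z
  have V: "V z $ 1 = Re z" "V z $ 2 = Im z" for z by (simp_all add: V_def)
  have contV: "continuous_on A V" for A
    by (subst continuous_on_componentwise) (auto simp: Basis_vec_def inner_axis axis_eq_axis V forall_2
        intro!: continuous_intros)
  obtain w where w: "w \<in> path_image (V \<circ> f)" "w \<in> path_image (V \<circ> g)"
  proof (rule fashoda[of "V \<circ> f" "V \<circ> g" "vector [a, c]" "vector [b, d]"])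
    show "path (V \<circ> f)" "path (V \<circ> g)"
      using assms(1,2) by (auto intro!: path_continuous_image contV)
    show "path_image (V \<circ> f) \<subseteq> cbox (vector [a, c]) (vector [b, d])"
      using f by (auto simp: path_image_compose mem_box_cart forall_2 V)
    show "path_image (V \<circ> g) \<subseteq> cbox (vector [a, c]) (vector [b, d])"
      using g by (auto simp: path_image_compose mem_box_cart forall_2 V)
  qed (use ends in \<open>auto simp: pathstart_def pathfinish_def V\<close>)
  then obtain z z' where "z \<in> path_image f" "z' \<in> path_image g" "V z = V z'"
    by (auto simp: path_image_compose)
  moreover from this have "z = z'" using V by (metis complex_eq_iff)
  ultimately show thesis using that by blast
qed

text \<open>By the Fashoda theorem, the component of the rectangle cut along the
  crossing curve that contains the low point cannot reach the part of the rectangle above the region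
  where \<open>g\<close> is defined, so the maximum principle applies to it; the harmonic function
  \<open>sin (Re z - s) sinh (Im z) / sinh 4\<close> is at most 1 on the curve and vanishes on the rest of the
  boundary.\<close>

lemma two_constants_crossing:
  fixes g :: "complex \<Rightarrow> complex" and \<gamma> :: "real \<Rightarrow> complex"
  assumes T: "open T" and hol: "g holomorphic_on T" and g1: "\<And>z. z \<in> T \<Longrightarrow> cmod (g z) \<le> 1"
    and region: "\<And>z. s \<le> Re z \<Longrightarrow> Re z \<le> s + pi \<Longrightarrow> 0 \<le> Im z \<Longrightarrow> Im z < u (Re z) \<Longrightarrow> z \<in> T"
    and u: "\<And>t. s \<le> t \<Longrightarrow> t \<le> s + pi \<Longrightarrow> pi / 4 < u t \<and> u t \<le> 4"
    and path: "path \<gamma>" "Re (pathstart \<gamma>) = s" "Re (pathfinish \<gamma>) = s + pi"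
    and gam: "\<And>z. z \<in> path_image \<gamma> \<Longrightarrow> s \<le> Re z \<and> Re z \<le> s + pi \<and> 0 \<le> Im z \<and> Im z < u (Re z)"
    and small: "\<And>z. z \<in> path_image \<gamma> \<Longrightarrow> cmod (g z) \<le> e" and e: "0 < e" "e \<le> 1"
  obtains t where "0 \<le> t" "t \<le> pi / 4"
    "cmod (g (Complex (s + pi / 2) t)) \<le> e powr (sinh (pi / 4) / sinh 4)"
proof -
  define G where "G = path_image \<gamma>"
  \<comment> \<open>The value at the point \<open>p\<close> below of the harmonic function on the
    rectangle of width \<open>pi\<close> and height 4; the sine factor is 1 at the middle
    abscissa.\<close>
  define b where "b = sinh (pi / 4) / sinh (4::real)"
  have sinh4: "sinh (4::real) > 0" by simp
  have "sinh (pi / 4) \<le> sinh (4::real)" using pi_less_4 by simp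
  then have b: "0 \<le> b" "b \<le> 1" using sinh4 by (simp_all add: b_def)
  define V where "V = closed_segment (Complex (s + pi / 2) 0) (Complex (s + pi / 2) (pi / 4))"
  have V: "z \<in> V \<Longrightarrow> Re z = s + pi / 2 \<and> 0 \<le> Im z \<and> Im z \<le> pi / 4" for z
    by (auto simp: V_def closed_segment_same_Re closed_segment_eq_real_ivl)
  show thesis
  \<comment> \<open>If the curve meets the vertical segment \<open>V\<close>, the meeting point
    already has the bound \<open>e \<le> e powr b\<close>.\<close>
  proof (cases "V \<inter> G = {}")
    case False
    then obtain z where z: "z \<in> V" "z \<in> G" by blast
    have "cmod (g z) \<le> e" using small z by (simp add: G_def)
    also have "e \<le> e powr b" using e b powr_mono_both'[of b 1 e e] by simp
    finally have "cmod (g z) \<le> e powr b" .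
    moreover have "z = Complex (s + pi / 2) (Im z)" using V[OF z(1)] by (simp add: complex_eq_iff)
    ultimately show thesis using V[OF z(1)] that[of "Im z"] by (simp add: b_def)
  next
    case VG: True
    define R where "R = {z. s < Re z \<and> Re z < s + pi \<and> 0 < Im z \<and> Im z < 4}"
    define R' where "R' = {z. s \<le> Re z \<and> Re z \<le> s + pi \<and> 0 \<le> Im z \<and> Im z \<le> 4}"
    have "compact G" unfolding G_def using path(1) by (rule compact_path_image)
    then have cG: "closed G" by (rule compact_imp_closed)
    have "R = box (Complex s 0) (Complex (s + pi) 4)" by (auto simp: R_def in_box_complex_iff)
    then have oR: "open R" by (metis open_box)
    have R'box: "R' = cbox (Complex s 0) (Complex (s + pi) 4)" by (auto simp: R'_def in_cbox_complex_iff)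
    then have cR': "closed R'" "convex R'" by (metis closed_cbox, metis convex_box(1))
    define p where "p = Complex (s + pi / 2) (pi / 4)"
    define N where "N = connected_component_set (R - G) p"
    have oRG: "open (R - G)" using oR cG by blast
    have pV: "p \<in> V" by (simp add: p_def V_def)
    have "p \<in> R" using pi_less_4 pi_gt_zero by (simp add: p_def R_def)
    then have pRG: "p \<in> R - G" using pV VG by blast
    have OR: "N \<subseteq> R - G" unfolding N_def by (rule connected_component_subset)
    have oO: "open N" unfolding N_def by (rule open_connected_component[OF oRG])
    have pO: "p \<in> N" using pRG unfolding N_def by simp
    have "R \<subseteq> R'" by (auto simp: R_def R'_def)
    then have clO: "closure N \<subseteq> R'" using OR by (intro closure_minimal cR') auto
    \<comment> \<open>A violation would give a path from the bottom edge to the top edge avoiding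
      \<open>G\<close>: up \<open>V\<close> to \<open>p\<close>, inside \<open>N\<close> to a point
      near \<open>z\<close>, then to \<open>z\<close> and vertically upwards, where the curve never
      goes. This contradicts \<open>fashoda_complex\<close>.\<close>
    have below: "Im z < u (Re z)" if z: "z \<in> closure N" for z
    proof (rule ccontr)
      assume high: "\<not> Im z < u (Re z)"
      have zR': "z \<in> R'" using z clO by blast
      define W where "W = closed_segment z (Complex (Re z) 4)"
      have W: "w \<in> W \<Longrightarrow> Re w = Re z \<and> Im z \<le> Im w \<and> Im w \<le> 4" for w
        using zR' unfolding R'_def
        by (auto simp: W_def closed_segment_same_Re closed_segment_eq_real_ivl split: if_splits)
      have WG: "W \<inter> G = {}" using W gam high unfolding G_def by fastforce
      have WR: "W \<subseteq> R'" using W zR' unfolding R'_def by fastforce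
      have "z \<notin> G" using gam high unfolding G_def by blast
      then obtain \<delta> where \<delta>: "\<delta> > 0" "ball z \<delta> \<inter> G = {}"
        using cG by (metis Compl_iff open_Compl open_contains_ball subset_Compl_self_eq
            disjoint_eq_subset_Compl)
      obtain q where q: "q \<in> N" "dist q z < \<delta>" using z \<delta>(1) by (meson closure_approachable)
      have qR: "q \<in> R'" using q(1) OR \<open>R \<subseteq> R'\<close> by blast
      have seg: "closed_segment q z \<subseteq> R' \<inter> ball z \<delta>"
      proof -
        have "q \<in> R' \<inter> ball z \<delta>" "z \<in> R' \<inter> ball z \<delta>" using q qR zR' \<delta> by (auto simp: dist_commute)
        then show ?thesis using closed_segment_subset[of q "R' \<inter> ball z \<delta>" z] cR'(2) convex_ball convex_Int
          by blast
      qed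
      have "path_connected N" unfolding N_def
        using oRG by (simp add: connected_open_path_connected open_connected_component)
      then obtain k where k: "path k" "path_image k \<subseteq> N" "pathstart k = p" "pathfinish k = q"
        using pO q(1) unfolding path_connected_def by blast
      define j where "j = linepath (Complex (s + pi / 2) 0) p +++ k +++ linepath q z +++ linepath z (Complex (Re z) 4)"
      have j: "path j" "pathstart j = Complex (s + pi / 2) 0" "pathfinish j = Complex (Re z) 4"
        using k by (auto simp: j_def)
      have jim: "path_image j \<subseteq> V \<union> N \<union> closed_segment q z \<union> W"
        using k by (auto simp: j_def path_image_join V_def W_def p_def)
      have "V \<subseteq> R'" using V pi_less_4 pi_gt_zero unfolding R'_def by force
      then have jR: "path_image j \<subseteq> R'" using jim OR \<open>R \<subseteq> R'\<close> seg WR by blast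
      have jG: "path_image j \<inter> G = {}" using jim OR VG WG seg \<delta>(2) by blast
      obtain w where "w \<in> path_image \<gamma>" "w \<in> path_image j"
      proof (rule fashoda_complex[OF path(1) j(1)])
        show "s \<le> Re w \<and> Re w \<le> s + pi \<and> 0 \<le> Im w \<and> Im w \<le> 4" if "w \<in> path_image \<gamma>" for w
          using gam[OF that] u[of "Re w"] by auto
        show "s \<le> Re w \<and> Re w \<le> s + pi \<and> 0 \<le> Im w \<and> Im w \<le> 4" if "w \<in> path_image j" for w
          using that jR unfolding R'_def by blast
      qed (use path j in auto)
      then show False using jG unfolding G_def by blast
    qed
    have clT: "closure N \<subseteq> T" using below clO region unfolding R'_def by blast
    \<comment> \<open>A holomorphic completion of the barrier: the real part of
      \<open>\<i> * cos (z - s)\<close> is \<open>sin (Re z - s) * sinh (Im z)\<close>.\<close>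
    define B where "B z = \<i> * cos (z - of_real s) / of_real (sinh 4)" for z
    have ReB: "Re (B z) = sin (Re z - s) * sinh (Im z) / sinh 4" for z
      unfolding B_def Re_divide_of_real
      by (simp add: Im_cos exp_minus sinh_field_def algebra_simps diff_divide_distrib)
    define f where "f z = g z * exp (of_real (- ln e) * B z)" for z
    have cf: "cmod (f z) = cmod (g z) * exp (- ln e * Re (B z))" for z
      by (simp add: f_def norm_mult norm_exp_eq_Re)
    have le: "- ln e \<ge> 0" using e by simp
    have "f holomorphic_on T"
      unfolding f_def B_def by (intro holomorphic_intros hol) (use sinh4 in auto)
    then have holf: "f holomorphic_on closure N" using clT by (rule holomorphic_on_subset)
    have "cmod (f p) \<le> 1"
    proof (rule maximum_modulus_frontier[where S = N and f = f])
      show "f holomorphic_on interior N"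
        using holf by (rule holomorphic_on_subset) (use interior_subset closure_subset in blast)
      show "continuous_on (closure N) f" using holf holomorphic_on_imp_continuous_on by blast
      show "bounded N" using clO R'box bounded_cbox closure_subset by (metis bounded_subset)
      fix z assume z: "z \<in> frontier N"
      \<comment> \<open>A frontier point of a component of an open set is outside that set, so it is
        on the curve or on an edge of the rectangle; the top edge is excluded by
        \<open>below\<close> and \<open>u \<le> 4\<close>.\<close>
      have "N \<in> components (R - G)" unfolding N_def components_def using pRG by blast
      then have "z \<in> frontier (R - G)" using z frontier_of_components_subset by blast
      then have zn: "z \<notin> R - G" using oRG by (simp add: frontier_def interior_open)
      have zc: "z \<in> closure N" using z by (simp add: frontier_def)
      have z4: "s \<le> Re z" "Re z \<le> s + pi" "0 \<le> Im z" "Im z < 4"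
        using zc clO below[OF zc] u[of "Re z"] unfolding R'_def by auto
      have gz: "cmod (g z) \<le> 1" using zc clT g1 by blast
      show "cmod (f z) \<le> 1"
      proof (cases "z \<in> G")
        case True
        have "sin (Re z - s) * sinh (Im z) \<le> 1 * sinh 4"
          using z4 sin_ge_zero[of "Re z - s"] by (intro mult_mono) (auto intro: less_imp_le)
        then have "Re (B z) \<le> 1" unfolding ReB using sinh4 by (simp add: divide_le_eq)
        then have "- ln e * Re (B z) \<le> - ln e * 1" using le by (rule mult_left_mono)
        then have "exp (- ln e * Re (B z)) \<le> 1 / e" using e(1) by (metis exp_le_cancel_iff exp_ln exp_minus inverse_eq_divide mult.right_neutral)
        moreover have "cmod (g z) \<le> e" using small True by (simp add: G_def)
        ultimately have "cmod (f z) \<le> e * (1 / e)" unfolding cf using e by (intro mult_mono) auto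
        then show ?thesis using e by simp
      next
        case False
        then have "z \<notin> R" using zn by blast
        then have "Re z = s \<or> Re z = s + pi \<or> Im z = 0" using z4 by (auto simp: R_def)
        then have "Re (B z) = 0" unfolding ReB by auto
        then show ?thesis using gz by (simp add: cf)
      qed
    qed (rule pO)
    moreover have "Re (B p) = b" unfolding ReB by (simp add: p_def b_def)
    ultimately have "cmod (g p) * exp (- ln e * b) \<le> 1" by (simp add: cf)
    then have "cmod (g p) \<le> exp (ln e * b)" by (simp add: exp_minus field_simps)
    also have "\<dots> = e powr b" using e by (simp add: powr_def mult.commute)
    finally show thesis unfolding p_def b_def by (intro that[of "pi / 4"]) (use pi_gt_zero in auto)
  qed
qed

section \<open>Dini-smooth corners of Jordan domains\<close>

text \<open>An integral test: on \<open>{q / 4..q}\<close> the integrand is at least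
  \<open>\<omega> (q / 4) / q\<close>, which contributes \<open>3/4 * \<omega> (q / 4)\<close>. The
  ratio is \<open>1/4\<close> because the dyadic scales \<open>(1/2)^n\<close> in the square-root
  coordinate are the radii \<open>(1/4)^n\<close> at the corner.\<close>

lemma dini_imp_summable:
  fixes \<omega> :: "real \<Rightarrow> real"
  assumes pos: "\<And>t. t \<ge> 0 \<Longrightarrow> 0 \<le> \<omega> t" and mono: "mono_on {0..} \<omega>"
    and int: "(\<lambda>t. \<omega> t / t) integrable_on {0..\<epsilon>}" and e: "\<epsilon> > 0"
  shows "summable (\<lambda>n. \<omega> ((1/4)^n))"
proof -
  obtain m where m: "(1/4::real)^m < \<epsilon>" using real_arch_pow_inv[OF e, of "1/4"] by auto
  define q where "q n = (1/4::real)^(n + m)" for n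
  have q: "0 < q n" "q (Suc n) = q n / 4" for n by (simp_all add: q_def)
  have qe: "q n \<le> \<epsilon>" for n
  proof -
    have "q n \<le> (1/4)^m" unfolding q_def by (intro power_decreasing) auto
    then show ?thesis using m by simp
  qed
  have intq: "(\<lambda>t. \<omega> t / t) integrable_on {a..b}" if "0 \<le> a" "b \<le> \<epsilon>" for a b
    by (rule integrable_on_subinterval[OF int]) (use that in auto)
  have nonneg: "0 \<le> \<omega> t / t" if "t \<ge> 0" for t using that pos by simp
  have step: "\<omega> (q (Suc n)) \<le> 2 * integral {q (Suc n)..q n} (\<lambda>t. \<omega> t / t)" for n
  proof -
    have "integral {q (Suc n)..q n} (\<lambda>t. \<omega> (q (Suc n)) / q n) \<le> integral {q (Suc n)..q n} (\<lambda>t. \<omega> t / t)"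
    proof (rule integral_le)
      fix t assume t: "t \<in> {q (Suc n)..q n}"
      then have "0 < t" using q(1)[of "Suc n"] by simp
      moreover have "\<omega> (q (Suc n)) \<le> \<omega> t" using t q(1)[of "Suc n"] by (intro mono_onD[OF mono]) auto
      ultimately show "\<omega> (q (Suc n)) / q n \<le> \<omega> t / t"
        using t pos q(1)[of "Suc n"] by (intro frac_le) auto
    qed (use q(1)[of "Suc n"] qe in \<open>auto intro!: intq intro: less_imp_le\<close>)
    also have "integral {q (Suc n)..q n} (\<lambda>t. \<omega> (q (Suc n)) / q n) = 3/4 * \<omega> (q (Suc n))"
      using q[of n] by (simp add: field_simps)
    finally show ?thesis using pos[of "q (Suc n)"] q(1)[of "Suc n"] by simp
  qed
  have partial: "(\<Sum>n<N. integral {q (Suc n)..q n} (\<lambda>t. \<omega> t / t)) = integral {q N..q 0} (\<lambda>t. \<omega> t / t)" for N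
  proof (induction N)
    case (Suc N)
    have "q N \<le> q 0" unfolding q_def by (intro power_decreasing) auto
    moreover have "q (Suc N) \<le> q N" using q[of N] by simp
    ultimately have "integral {q (Suc N)..q N} (\<lambda>t. \<omega> t / t) + integral {q N..q 0} (\<lambda>t. \<omega> t / t)
        = integral {q (Suc N)..q 0} (\<lambda>t. \<omega> t / t)"
      using qe q(1) by (intro Henstock_Kurzweil_Integration.integral_combine intq) (auto intro: less_imp_le)
    then show ?case using Suc by simp
  qed simp
  have "summable (\<lambda>n. \<omega> (q (Suc n)))"
  proof (rule bounded_imp_summable)
    fix N
    have "(\<Sum>n<Suc N. \<omega> (q (Suc n))) \<le> (\<Sum>n<Suc N. 2 * integral {q (Suc n)..q n} (\<lambda>t. \<omega> t / t))"
      by (intro sum_mono step)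
    also have "\<dots> = 2 * integral {q (Suc N)..q 0} (\<lambda>t. \<omega> t / t)"
      unfolding sum_distrib_left[symmetric] partial ..
    also have "\<dots> \<le> 2 * integral {0..\<epsilon>} (\<lambda>t. \<omega> t / t)"
      using q(1) qe nonneg by (intro mult_left_mono integral_subset_le intq) (auto intro: less_imp_le order_trans)
    finally show "(\<Sum>n\<le>N. \<omega> (q (Suc n))) \<le> 2 * integral {0..\<epsilon>} (\<lambda>t. \<omega> t / t)"
      by (simp only: lessThan_Suc_atMost)
  qed (use pos q(1) in \<open>auto intro: less_imp_le\<close>)
  then have "summable (\<lambda>n. \<omega> ((1/4)^(n + Suc m)))" by (simp add: q_def)
  then show ?thesis by (rule summable_iff_shift[THEN iffD1])
qed

lemma polar_angle:
  obtains s where "a \<le> s" "s < a + 2 * pi" "z = of_real (cmod z) * cis s"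
proof
  let ?s = "a + Arg2pi (z * cis (- a))"
  show "a \<le> ?s" "?s < a + 2 * pi" using Arg2pi[of "z * cis (- a)"] by auto
  have "z * cis (- a) = of_real (cmod z) * cis (Arg2pi (z * cis (- a)))"
    using Arg2pi_eq[of "z * cis (- a)"] by (simp add: norm_mult cis_conv_exp)
  then have "z * cis (- a) * cis a = of_real (cmod z) * (cis a * cis (Arg2pi (z * cis (- a))))" by simp
  then show "z = of_real (cmod z) * cis ?s" by (simp add: cis_mult mult.assoc)
qed

lemma cis_neq_between: "a < s \<Longrightarrow> s < a + 2 * pi \<Longrightarrow> cis s \<noteq> cis a"
proof
  assume s: "a < s" "s < a + 2 * pi" and "cis s = cis a"
  then have "cis (s - a) = 1" by (simp flip: cis_divide)
  then have "cos (s - a) = 1" by (simp add: complex_eq_iff)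
  then obtain n :: int where n: "s - a = of_int n * 2 * pi" using cos_one_2pi_int by auto
  then have n: "0 < of_int n * (2 * pi)" "of_int n * (2 * pi) < 1 * (2 * pi)"
    using s unfolding mult.assoc mult_1 by linarith+
  have "0 < (of_int n :: real)" using n(1) pi_gt_zero by (simp only: zero_less_mult_iff) auto
  moreover have "(of_int n :: real) < 1" using n(2) pi_gt_zero by (simp only: mult_less_cancel_right)
  ultimately show False by simp
qed

text \<open>The definition of a corner only places one of the two arcs of each small circle inside the
  domain; that the other one lies outside uses that the boundary is a Jordan curve.\<close>

lemma jordan_corner_complement:
  fixes ap am :: "real \<Rightarrow> real"
  assumes J: "jordan_domain \<Omega>"
    and cont: "continuous_on {0..\<epsilon>} ap" "continuous_on {0..\<epsilon>} am"
    and corner: "\<And>\<rho>. \<rho> \<in> {0<..\<epsilon>} \<Longrightarrow>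
           frontier \<Omega> \<inter> sphere w0 \<rho> = {w0 + of_real \<rho> * cis (ap \<rho>), w0 + of_real \<rho> * cis (am \<rho>)} \<and>
           0 < ap \<rho> - am \<rho> \<and> ap \<rho> - am \<rho> < 2 * pi \<and>
           (\<forall>s. am \<rho> < s \<and> s < ap \<rho> \<longrightarrow> w0 + of_real \<rho> * cis s \<in> \<Omega>)"
    and \<rho>: "0 < \<rho>" "\<rho> < \<epsilon>" and s: "ap \<rho> \<le> s" "s \<le> am \<rho> + 2 * pi"
  shows "w0 + of_real \<rho> * cis s \<notin> \<Omega>"
proof -
  obtain g where g: "simple_path g" "pathfinish g = pathstart g" "\<Omega> = inside (path_image g)"
    using J unfolding jordan_domain_def by blast
  define P Q where "P = path_image g" and "Q = outside (path_image g)"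
  note JC = Jordan_inside_outside[OF g(1,2)]
  have op: "open \<Omega>" and fr: "frontier \<Omega> = P" and frQ: "frontier Q = P"
    and dis: "\<Omega> \<inter> Q = {}" "Q \<inter> P = {}"
    using JC by (auto simp: g(3) P_def Q_def)
  have dis2: "\<Omega> \<inter> P = {}" using op fr by (auto simp: frontier_def interior_open)
  \<comment> \<open>The open complementary arcs of all radii below \<open>\<epsilon>\<close>
    together form one connected set disjoint from the curve, so it either lies in
    \<open>\<Omega>\<close> or misses it.\<close>
  define E where "E = {w0 + of_real r * cis t |r t. 0 < r \<and> r < \<epsilon> \<and> ap r < t \<and> t < am r + 2 * pi}"
  have EP: "E \<inter> P = {}"
  proof -
    have "w0 + of_real r * cis t \<notin> P" if r: "0 < r" "r < \<epsilon>" "ap r < t" "t < am r + 2 * pi" for r t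
    proof
      assume "w0 + of_real r * cis t \<in> P"
      moreover have "w0 + of_real r * cis t \<in> sphere w0 r" using r by (simp add: dist_norm norm_mult)
      ultimately have "w0 + of_real r * cis t \<in> frontier \<Omega> \<inter> sphere w0 r" unfolding fr by blast
      then have "w0 + of_real r * cis t = w0 + of_real r * cis (ap r) \<or>
           w0 + of_real r * cis t = w0 + of_real r * cis (am r)"
        using corner[of r] r by auto
      then have "cis t = cis (ap r) \<or> cis t = cis (am r)" using r by auto
      then show False using cis_neq_between[of "ap r" t] cis_neq_between[of "am r" t] corner[of r] r by auto
    qed
    then show ?thesis unfolding E_def by blast
  qed
  have "E \<inter> \<Omega> = {}"
  proof (rule ccontr)
    assume "E \<inter> \<Omega> \<noteq> {}"
    have cE: "connected E"
    proof -
      define f where "f = (\<lambda>(r, l). w0 + of_real r * cis (ap r + l * (am r + 2 * pi - ap r)))"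
      have sub: "(fst :: real \<times> real \<Rightarrow> real) ` ({0<..<\<epsilon>} \<times> {0<..<1}) \<subseteq> {0..\<epsilon>}" by auto
      have c: "continuous_on ({0<..<\<epsilon>} \<times> {0<..<1}) (\<lambda>p :: real \<times> real. ap (fst p))"
        "continuous_on ({0<..<\<epsilon>} \<times> {0<..<1}) (\<lambda>p :: real \<times> real. am (fst p))"
        using continuous_on_compose2[OF cont(1) continuous_on_fst[OF continuous_on_id] sub]
          continuous_on_compose2[OF cont(2) continuous_on_fst[OF continuous_on_id] sub] by auto
      have "continuous_on ({0<..<\<epsilon>} \<times> {0<..<1}) f"
        unfolding f_def split_def cis_conv_exp by (intro continuous_intros c)
      moreover have "connected ({0<..<\<epsilon>} \<times> {0<..<1::real})" by (intro connected_Times) auto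
      ultimately have "connected (f ` ({0<..<\<epsilon>} \<times> {0<..<1}))" by (rule connected_continuous_image)
      also have "f ` ({0<..<\<epsilon>} \<times> {0<..<1}) = E"
      proof (intro equalityI subsetI)
        fix z assume "z \<in> f ` ({0<..<\<epsilon>} \<times> {0<..<1})"
        then obtain r l where rl: "0 < r" "r < \<epsilon>" "0 < l" "l < 1"
          "z = w0 + of_real r * cis (ap r + l * (am r + 2 * pi - ap r))" by (auto simp: f_def)
        have p: "am r + 2 * pi - ap r > 0" using corner[of r] rl by auto
        then have "0 < l * (am r + 2 * pi - ap r)" "l * (am r + 2 * pi - ap r) < 1 * (am r + 2 * pi - ap r)"
          using rl by (intro mult_pos_pos mult_strict_right_mono; simp)+
        then show "z \<in> E" unfolding E_def rl(5) using rl(1,2) by force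
      next
        fix z assume "z \<in> E"
        then obtain r t where rt: "0 < r" "r < \<epsilon>" "ap r < t" "t < am r + 2 * pi" "z = w0 + of_real r * cis t"
          by (auto simp: E_def)
        let ?l = "(t - ap r) / (am r + 2 * pi - ap r)"
        have "z = f (r, ?l)" using rt by (simp add: f_def)
        moreover have "(r, ?l) \<in> {0<..<\<epsilon>} \<times> {0<..<1}" using rt by (auto simp: divide_simps)
        ultimately show "z \<in> f ` ({0<..<\<epsilon>} \<times> {0<..<1})" by blast
      qed
      finally show ?thesis .
    qed
    have E\<Omega>: "E \<subseteq> \<Omega>"
      using connected_Int_frontier[OF cE \<open>E \<inter> \<Omega> \<noteq> {}\<close>] EP fr by blast
    \<comment> \<open>\<open>w\<close> is a curve point of radius \<open>\<epsilon> / 2\<close>. The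
      curve is also the frontier of the outside, so there are outside points within
      \<open>\<epsilon> / 4\<close> of \<open>w\<close>. Their angles avoid the arc in
      \<open>\<Omega>\<close> and its ends, which puts them in \<open>E\<close>.\<close>
    define w where "w = w0 + of_real (\<epsilon> / 2) * cis (ap (\<epsilon> / 2))"
    have e: "\<epsilon> > 0" using \<rho> by simp
    have "w \<in> P" using corner[of "\<epsilon> / 2"] e unfolding fr[symmetric] w_def by auto
    then have "w \<in> closure Q" using frQ by (auto simp: frontier_def)
    then obtain v where v: "v \<in> Q" "dist v w < \<epsilon> / 4" using e closure_approachable[of w Q]
      by (metis divide_pos_pos zero_less_numeral)
    have wd: "cmod (w - w0) = \<epsilon> / 2" using e by (simp add: w_def norm_mult)
    define r where "r = cmod (v - w0)"
    have "\<bar>r - \<epsilon> / 2\<bar> \<le> cmod (v - w)"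
      using norm_triangle_ineq3[of "v - w0" "w - w0"] by (simp add: r_def wd)
    then have r: "0 < r" "r < \<epsilon>" using v(2) e by (auto simp: dist_norm)
    obtain t where t: "am r \<le> t" "t < am r + 2 * pi" "v - w0 = of_real (cmod (v - w0)) * cis t"
      by (rule polar_angle)
    then have veq: "v = w0 + of_real r * cis t" by (simp add: r_def algebra_simps)
    have "v \<notin> \<Omega>" "v \<notin> P" using v(1) dis by auto
    moreover have "w0 + of_real r * cis (ap r) \<in> P" "w0 + of_real r * cis (am r) \<in> P"
      using corner[of r] r unfolding fr[symmetric] by auto
    ultimately have "t \<noteq> am r" "t \<noteq> ap r" "\<not> (am r < t \<and> t < ap r)"
      using corner[of r] r unfolding veq by auto
    then have "ap r < t" using t(1) by linarith
    then have "v \<in> E" using t(2) r veq unfolding E_def by blast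
    then show False using E\<Omega> \<open>v \<notin> \<Omega>\<close> by blast
  qed
  moreover have "w0 + of_real \<rho> * cis (ap \<rho>) \<in> P" "w0 + of_real \<rho> * cis (am \<rho>) \<in> P"
    using corner[of \<rho>] \<rho> unfolding fr[symmetric] by auto
  moreover have "cis (am \<rho> + 2 * pi) = cis (am \<rho>)" by (simp flip: cis_mult)
  moreover have "w0 + of_real \<rho> * cis s \<in> E" if "s \<noteq> ap \<rho>" "s \<noteq> am \<rho> + 2 * pi"
  proof -
    have "ap \<rho> < s" "s < am \<rho> + 2 * pi" using that s by auto
    then show ?thesis using \<rho> unfolding E_def by blast
  qed
  ultimately show ?thesis using dis2 by (metis disjoint_iff)
qed

section \<open>Points of the sector that approach \<open>x\<close>\<close>

text \<open>Take the first time \<open>b\<close> with value \<open>u\<close>, then the last time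
  \<open>a\<close> before \<open>b\<close> with value \<open>l\<close>; by the intermediate value
  theorem, leaving the band in between would contradict one of these choices.\<close>

lemma crossing_interval:
  fixes f :: "real \<Rightarrow> real"
  assumes cont: "continuous_on {p..q} f" and "p \<le> q" and f: "f p \<le> l" "u \<le> f q" and lu: "l < u"
  obtains a b where "p \<le> a" "a < b" "b \<le> q" "f a = l" "f b = u" "\<And>t. t \<in> {a..b} \<Longrightarrow> l \<le> f t \<and> f t \<le> u"
proof -
  define B where "B = {t \<in> {p..q}. f t = u}"
  have "B = {p..q} \<inter> f -` {u}" by (auto simp: B_def)
  then have "closed B" by (simp only: continuous_closed_preimage[OF cont closed_atLeastAtMost closed_singleton])
  obtain b0 where "b0 \<in> B" using IVT'[of f p u q] f lu cont \<open>p \<le> q\<close> by (auto simp: B_def)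
  define b where "b = Inf B"
  have bB: "b \<in> B" unfolding b_def using \<open>closed B\<close> \<open>b0 \<in> B\<close>
    by (intro closed_contains_Inf) (auto simp: B_def intro!: bdd_belowI[of _ p])
  have bmin: "b \<le> t" if "t \<in> B" for t unfolding b_def
    by (rule cInf_lower[OF that]) (auto simp: B_def intro!: bdd_belowI[of _ p])
  have b: "p \<le> b" "b \<le> q" "f b = u" using bB by (auto simp: B_def)
  have contb: "continuous_on {p..b} f" using cont b(2) by (auto intro: continuous_on_subset)
  have leu: "f t \<le> u" if t: "t \<in> {p..b}" for t
  proof (rule ccontr)
    assume "\<not> f t \<le> u"
    moreover have "continuous_on {p..t} f" using contb t by (auto intro: continuous_on_subset)
    ultimately obtain t' where t': "p \<le> t'" "t' \<le> t" "f t' = u"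
      using IVT'[of f p u t] f(1) lu t by auto
    then have "t' \<in> B" using t b(2) by (auto simp: B_def)
    then have "t' = b" using bmin t' t by fastforce
    then have "t = b" using t' t by simp
    then show False using \<open>\<not> f t \<le> u\<close> b(3) by simp
  qed
  define A where "A = {t \<in> {p..b}. f t = l}"
  have "A = {p..b} \<inter> f -` {l}" by (auto simp: A_def)
  then have "closed A" by (simp only: continuous_closed_preimage[OF contb closed_atLeastAtMost closed_singleton])
  obtain a0 where "a0 \<in> A" using IVT'[of f p l b] f lu contb b by (auto simp: A_def)
  define a where "a = Sup A"
  have aA: "a \<in> A" unfolding a_def using \<open>closed A\<close> \<open>a0 \<in> A\<close>
    by (intro closed_contains_Sup) (auto simp: A_def intro!: bdd_aboveI[of _ b])
  have amax: "t \<le> a" if "t \<in> A" for t unfolding a_def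
    by (rule cSup_upper[OF that]) (auto simp: A_def intro!: bdd_aboveI[of _ b])
  have a: "p \<le> a" "a \<le> b" "f a = l" using aA by (auto simp: A_def)
  have gel: "l \<le> f t" if t: "t \<in> {a..b}" for t
  proof (rule ccontr)
    assume "\<not> l \<le> f t"
    moreover have "continuous_on {t..b} f" using contb t a by (auto intro: continuous_on_subset)
    ultimately obtain t' where t': "t \<le> t'" "t' \<le> b" "f t' = l"
      using IVT'[of f t l b] b(3) lu t by auto
    then have "t' \<in> A" using t a(1) by (auto simp: A_def)
    then have "t' = a" using amax t' t by fastforce
    then have "t = a" using t' t by simp
    then show False using \<open>\<not> l \<le> f t\<close> a(3) by simp
  qed
  have "a \<noteq> b" using a(3) b(3) lu by auto
  then show thesis using that[of a b] a b gel leu by auto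
qed

text \<open>In the coordinate \<open>log (h - w0)\<close> the corner is a half-strip towards minus
  infinity. Along the image \<open>\<gamma>\<close> of the radius, \<open>\<kappa> - x\<close> has
  modulus \<open>1 - t\<close>. A piece of \<open>\<gamma>\<close> that crosses a block of width
  \<open>pi\<close> carries this smallness, with a fixed exponent, to a point of height at most
  \<open>pi / 4\<close>, even if \<open>\<gamma>\<close> stays near the upper side.\<close>

lemma approach_upper:
  fixes \<kappa> :: "complex \<Rightarrow> complex" and \<gamma> :: "real \<Rightarrow> complex"
  assumes T: "open T" "\<kappa> holomorphic_on T" "\<And>S. S \<in> T \<Longrightarrow> cmod (\<kappa> S) < 1"
    and region: "\<And>S. Re S < l \<Longrightarrow> 0 \<le> Im S \<Longrightarrow> Im S < up (Re S) \<Longrightarrow> S \<in> T"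
    and up: "\<And>t. t < l \<Longrightarrow> pi / 4 < up t \<and> up t \<le> 4"
    and r: "r < 1" and cont: "continuous_on {r..<1} \<gamma>"
    and gam: "\<And>t. t \<in> {r..<1} \<Longrightarrow> Re (\<gamma> t) < l \<and> 0 \<le> Im (\<gamma> t) \<and> Im (\<gamma> t) < up (Re (\<gamma> t))"
    and lim: "filterlim (\<lambda>t. Re (\<gamma> t)) at_bot (at_left 1)"
    and \<kappa>\<gamma>: "\<And>t. t \<in> {r..<1} \<Longrightarrow> \<kappa> (\<gamma> t) = of_real t * x" and x: "cmod x = 1"
    and \<delta>: "\<delta> > 0"
  obtains S where "Re S < l" "Re S < B" "0 \<le> Im S" "Im S \<le> pi / 4" "cmod (\<kappa> S - x) < \<delta>"
proof -
  define b where "b = sinh (pi / 4) / sinh (4::real)"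
  have b: "b > 0" by (simp add: b_def)
  \<comment> \<open>Chosen to make \<open>e powr b \<le> \<delta> / 4\<close>; halving
    \<open>\<kappa> - x\<close> normalises it to modulus at most 1, so parameters above
    \<open>1 - 2 * e\<close> have \<open>cmod (g z) \<le> e\<close>.\<close>
  define e where "e = min 1 ((\<delta> / 4) powr (1 / b))"
  have e: "0 < e" "e \<le> 1" using \<delta> by (auto simp: e_def)
  have "e powr b \<le> ((\<delta> / 4) powr (1 / b)) powr b" using b e by (intro powr_mono2) (auto simp: e_def)
  also have "\<dots> = \<delta> / 4" using b \<delta> by (simp add: powr_powr)
  finally have eb: "e powr b \<le> \<delta> / 4" .
  have "\<forall>\<^sub>F t in at_left (1::real). t \<in> {max r (1 - 2 * e)<..<1}"
    using r e by (intro eventually_at_leftI[of "max r (1 - 2 * e)"]) auto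
  moreover have "\<forall>\<^sub>F t in at_left 1. Re (\<gamma> t) < B" using lim by (auto simp: filterlim_at_bot_dense)
  ultimately have "\<forall>\<^sub>F t in at_left (1::real). t \<in> {max r (1 - 2 * e)<..<1} \<and> Re (\<gamma> t) < B"
    by eventually_elim auto
  then obtain p where p: "p \<in> {max r (1 - 2 * e)<..<1}" "Re (\<gamma> p) < B"
    using eventually_happens' trivial_limit_at_left_real by blast
  define s where "s = Re (\<gamma> p) - pi"
  have "\<forall>\<^sub>F t in at_left (1::real). t \<in> {p<..<1}"
    using p by (intro eventually_at_leftI[of p]) auto
  moreover have "\<forall>\<^sub>F t in at_left 1. Re (\<gamma> t) < s" using lim by (auto simp: filterlim_at_bot_dense)
  ultimately have "\<forall>\<^sub>F t in at_left (1::real). t \<in> {p<..<1} \<and> Re (\<gamma> t) < s"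
    by eventually_elim auto
  then obtain q where q: "q \<in> {p<..<1}" "Re (\<gamma> q) < s"
    using eventually_happens' trivial_limit_at_left_real by blast
  have sub: "{p..q} \<subseteq> {r..<1}" using p q by auto
  have contpq: "continuous_on {p..q} \<gamma>" by (rule continuous_on_subset[OF cont sub])
  obtain a d where ad: "p \<le> a" "a < d" "d \<le> q" "- Re (\<gamma> a) = - (s + pi)" "- Re (\<gamma> d) = - s"
      "\<And>t. t \<in> {a..d} \<Longrightarrow> - (s + pi) \<le> - Re (\<gamma> t) \<and> - Re (\<gamma> t) \<le> - s"
  proof (rule crossing_interval[of p q "\<lambda>t. - Re (\<gamma> t)" "- (s + pi)" "- s"])
    show "continuous_on {p..q} (\<lambda>t. - Re (\<gamma> t))" by (intro continuous_intros contpq)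
  qed (use p q in \<open>auto simp: s_def\<close>)
  have sl: "s + pi < l" using gam[of p] p by (auto simp: s_def)
  \<comment> \<open>The curve moves to the left as \<open>t\<close> increases, so it is traversed
    backwards to start on the left edge.\<close>
  define k where "k = \<gamma> \<circ> linepath d a"
  have im: "path_image k = \<gamma> ` {a..d}"
    using ad(2) by (simp add: k_def path_image_compose closed_segment_eq_real_ivl)
  have "path k"
    unfolding k_def using ad(2) continuous_on_subset[OF contpq, of "{a..d}"] ad
    by (intro path_continuous_image) (auto simp: closed_segment_eq_real_ivl)
  define g where "g S = (\<kappa> S - x) / 2" for S
  obtain t where t: "0 \<le> t" "t \<le> pi / 4" "cmod (g (Complex (s + pi / 2) t)) \<le> e powr b"
  proof (rule two_constants_crossing[of T g s up k e, folded b_def])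
    show "g holomorphic_on T" unfolding g_def by (intro holomorphic_intros T) auto
    show "cmod (g z) \<le> 1" if "z \<in> T" for z
      using norm_triangle_ineq4[of "\<kappa> z" x] T(3)[OF that] x by (simp add: g_def norm_divide)
    show "cmod (g z) \<le> e" if "z \<in> path_image k" for z
    proof -
      obtain t where tt: "t \<in> {a..d}" "z = \<gamma> t" using \<open>z \<in> path_image k\<close> im by blast
      then have tr: "t \<in> {r..<1}" "1 - 2 * e < t" using ad p q by auto
      have "\<kappa> z - x = of_real (t - 1) * x" using \<kappa>\<gamma>[OF tr(1)] tt by (simp add: algebra_simps)
      then have "cmod (\<kappa> z - x) = \<bar>t - 1\<bar>" using x by (simp add: norm_mult del: of_real_diff)
      then show ?thesis using tr by (simp add: g_def norm_divide)
    qed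
    show "s \<le> Re z \<and> Re z \<le> s + pi \<and> 0 \<le> Im z \<and> Im z < up (Re z)" if "z \<in> path_image k" for z
    proof -
      obtain t where tt: "t \<in> {a..d}" "z = \<gamma> t" using \<open>z \<in> path_image k\<close> im by blast
      then have "t \<in> {r..<1}" using ad p q by auto
      then show ?thesis using gam[of t] ad(6)[of t] tt by auto
    qed
  qed (use T(1) region up sl e \<open>path k\<close> ad in \<open>auto simp: k_def pathstart_def pathfinish_def linepath_def\<close>)
  show thesis
  proof (rule that[of "Complex (s + pi / 2) t"])
    have "cmod (\<kappa> (Complex (s + pi / 2) t) - x) \<le> 2 * (\<delta> / 4)"
      using order_trans[OF t(3) eb] by (simp add: g_def norm_divide)
    then show "cmod (\<kappa> (Complex (s + pi / 2) t) - x) < \<delta>" using \<delta> by simp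
    show "Re (Complex (s + pi / 2) t) < l" "Re (Complex (s + pi / 2) t) < B"
      using sl p(2) pi_gt_zero unfolding complex.sel s_def by linarith+
  qed (use t in auto)
qed

text \<open>If \<open>\<gamma>\<close> returns to heights at most \<open>pi / 4\<close> arbitrarily
  late, its own points serve. Otherwise its imaginary part eventually has constant sign by
  connectedness, and a negative sign is reduced to \<open>approach_upper\<close> by
  conjugation.\<close>

lemma approach_strip:
  fixes \<kappa> :: "complex \<Rightarrow> complex" and \<gamma> :: "real \<Rightarrow> complex"
  assumes T: "open T" "\<kappa> holomorphic_on T" "\<And>S. S \<in> T \<Longrightarrow> cmod (\<kappa> S) < 1"
    and region: "\<And>S. Re S < l \<Longrightarrow> lo (Re S) < Im S \<Longrightarrow> Im S < up (Re S) \<Longrightarrow> S \<in> T"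
    and up: "\<And>t. t < l \<Longrightarrow> pi / 4 < up t \<and> up t \<le> 4"
    and lo: "\<And>t. t < l \<Longrightarrow> - 4 \<le> lo t \<and> lo t < - (pi / 4)"
    and r: "r < 1" and cont: "continuous_on {r..<1} \<gamma>"
    and gam: "\<And>t. t \<in> {r..<1} \<Longrightarrow> Re (\<gamma> t) < l \<and> lo (Re (\<gamma> t)) < Im (\<gamma> t) \<and> Im (\<gamma> t) < up (Re (\<gamma> t))"
    and lim: "filterlim (\<lambda>t. Re (\<gamma> t)) at_bot (at_left 1)"
    and \<kappa>\<gamma>: "\<And>t. t \<in> {r..<1} \<Longrightarrow> \<kappa> (\<gamma> t) = of_real t * x" and x: "cmod x = 1"
    and \<delta>: "\<delta> > 0"
  obtains S where "Re S < l" "Re S < B" "\<bar>Im S\<bar> \<le> pi / 4" "cmod (\<kappa> S - x) < \<delta>"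
proof (cases "\<exists>t1\<in>{r..<1}. \<forall>t\<in>{t1..<1}. \<bar>Im (\<gamma> t)\<bar> > pi / 4")
  case False
  have "\<forall>\<^sub>F t in at_left (1::real). t \<in> {max r (1 - \<delta>)<..<1}"
    using r \<delta> by (intro eventually_at_leftI[of "max r (1 - \<delta>)"]) auto
  moreover have "\<forall>\<^sub>F t in at_left 1. Re (\<gamma> t) < B" using lim by (auto simp: filterlim_at_bot_dense)
  ultimately have "\<forall>\<^sub>F t in at_left (1::real). t \<in> {max r (1 - \<delta>)<..<1} \<and> Re (\<gamma> t) < B"
    by eventually_elim auto
  then obtain t0 where t0: "t0 < 1" "\<And>t. t0 < t \<Longrightarrow> t < 1 \<Longrightarrow> t \<in> {max r (1 - \<delta>)<..<1} \<and> Re (\<gamma> t) < B"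
    unfolding eventually_at_left_field by blast
  define t1 where "t1 = (max r t0 + 1) / 2"
  have "t1 \<in> {r..<1}" "t0 < t1" using t0(1) r by (auto simp: t1_def)
  then have "\<exists>t\<in>{t1..<1}. \<bar>Im (\<gamma> t)\<bar> \<le> pi / 4" using False by (auto simp only: not_less bex_simps ball_simps)
  then obtain t where t: "t \<in> {t1..<1}" "\<bar>Im (\<gamma> t)\<bar> \<le> pi / 4" by blast
  then have tt: "t \<in> {max r (1 - \<delta>)<..<1}" "Re (\<gamma> t) < B" using t0(2)[of t] \<open>t0 < t1\<close> by auto
  then have tr: "t \<in> {r..<1}" by auto
  have "\<kappa> (\<gamma> t) - x = of_real (t - 1) * x" using \<kappa>\<gamma>[OF tr] by (simp add: algebra_simps)
  then have "cmod (\<kappa> (\<gamma> t) - x) = \<bar>t - 1\<bar>" using x by (simp add: norm_mult del: of_real_diff)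
  then have "cmod (\<kappa> (\<gamma> t) - x) < \<delta>" using tt by auto
  then show thesis using that[of "\<gamma> t"] gam[OF tr] tt t by auto
next
  case True
  then obtain t1 where t1: "t1 \<in> {r..<1}" "\<And>t. t \<in> {t1..<1} \<Longrightarrow> \<bar>Im (\<gamma> t)\<bar> > pi / 4" by blast
  have cont1: "continuous_on {t1..<1} \<gamma>" by (rule continuous_on_subset[OF cont]) (use t1 in auto)
  have "connected ((\<lambda>t. Im (\<gamma> t)) ` {t1..<1})"
    by (intro connected_continuous_image continuous_intros cont1) auto
  moreover have "0 \<notin> (\<lambda>t. Im (\<gamma> t)) ` {t1..<1}" using t1(2) pi_gt_zero by force
  ultimately have "\<not> (Im (\<gamma> a) \<le> 0 \<and> 0 \<le> Im (\<gamma> b))" if "a \<in> {t1..<1}" "b \<in> {t1..<1}" for a b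
    using that unfolding connected_iff_interval by blast
  then have "(\<forall>t\<in>{t1..<1}. 0 \<le> Im (\<gamma> t)) \<or> (\<forall>t\<in>{t1..<1}. Im (\<gamma> t) \<le> 0)"
    by (meson linear)
  then show thesis
  proof
    assume pos: "\<forall>t\<in>{t1..<1}. 0 \<le> Im (\<gamma> t)"
    obtain S where "Re S < l" "Re S < B" "0 \<le> Im S" "Im S \<le> pi / 4" "cmod (\<kappa> S - x) < \<delta>"
    proof (rule approach_upper[OF T _ up _ cont1 _ lim _ x \<delta>])
      show "S \<in> T" if "Re S < l" "0 \<le> Im S" "Im S < up (Re S)" for S
      proof (rule region)
        show "lo (Re S) < Im S" using that lo[of "Re S"] pi_gt_zero by linarith
      qed (use that in auto)
    qed (use t1 pos gam \<kappa>\<gamma> in auto)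
    then show thesis using that[of S] by auto
  next
    assume neg: "\<forall>t\<in>{t1..<1}. Im (\<gamma> t) \<le> 0"
    have oT: "open (cnj ` T)"
      unfolding image_cnj_conv_vimage_cnj using T(1) by (intro open_vimage) auto
    have holc: "(cnj \<circ> \<kappa> \<circ> cnj) holomorphic_on cnj ` T"
      by (rule holomorphic_on_compose_cnj_cnj[OF _ oT]) (use T(2) in \<open>simp add: image_image\<close>)
    obtain S where S: "Re S < l" "Re S < B" "0 \<le> Im S" "Im S \<le> pi / 4" "cmod ((cnj \<circ> \<kappa> \<circ> cnj) S - cnj x) < \<delta>"
    proof (rule approach_upper[OF oT holc, of l "\<lambda>t. - lo t" t1 "cnj \<circ> \<gamma>"])
      show "S \<in> cnj ` T" if "Re S < l" "0 \<le> Im S" "Im S < - lo (Re S)" for S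
      proof -
        have "cnj S \<in> T"
        proof (rule region)
          show "Im (cnj S) < up (Re (cnj S))" using that up[of "Re S"] pi_gt_zero unfolding cnj.sel by linarith
        qed (use that in auto)
        then show ?thesis by (metis complex_cnj_cnj image_eqI)
      qed
      show "continuous_on {t1..<1} (cnj \<circ> \<gamma>)" unfolding o_def by (intro continuous_intros cont1)
      show "pi / 4 < - lo t \<and> - lo t \<le> 4" if "t < l" for t using lo[OF that] by linarith
      show "cmod ((cnj \<circ> \<kappa> \<circ> cnj) S) < 1" if "S \<in> cnj ` T" for S using that T(3) by auto
      fix t assume "t \<in> {t1..<1}"
      then show "Re ((cnj \<circ> \<gamma>) t) < l \<and> 0 \<le> Im ((cnj \<circ> \<gamma>) t) \<and> Im ((cnj \<circ> \<gamma>) t) < - lo (Re ((cnj \<circ> \<gamma>) t))"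
        "(cnj \<circ> \<kappa> \<circ> cnj) ((cnj \<circ> \<gamma>) t) = of_real t * cnj x"
        using gam[of t] neg t1(1) \<kappa>\<gamma>[of t] by auto
    qed (use t1 x lim \<delta> in \<open>auto simp: o_def\<close>)
    have "(cnj \<circ> \<kappa> \<circ> cnj) S - cnj x = cnj (\<kappa> (cnj S) - x)" by simp
    then have "cmod (\<kappa> (cnj S) - x) < \<delta>" using S(5) complex_mod_cnj by metis
    then show thesis using that[of "cnj S"] S by auto
  qed
qed

text \<open>Links the strip of half-height \<open>pi / 4\<close> with the cone of constant
  \<open>9/10\<close> in \<open>tangential_region_bound\<close>: \<open>exp (S / 2)\<close> halves
  the angle.\<close>

lemma cos_ge_nine_tenths: "\<bar>t\<bar> \<le> pi / 8 \<Longrightarrow> 9/10 \<le> cos (t::real)"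
proof -
  assume t: "\<bar>t\<bar> \<le> pi / 8"
  have "\<bar>sin (t / 2)\<bar> \<le> \<bar>t / 2\<bar>" by (rule abs_sin_x_le_abs_x)
  also have "\<dots> \<le> 1/5" using t pi_approx by simp
  finally have "\<bar>sin (t / 2)\<bar>^2 \<le> (1/5)^2" by (intro power_mono) auto
  then have "sin (t / 2) ^ 2 \<le> 1/25" by (simp add: power2_eq_square)
  then show ?thesis using cos_double_sin[of "t / 2"] by simp
qed

text \<open>The substitution \<open>w = w0 + exp (\<i> * \<beta>) * y^2\<close> opens the slit-like
  corner to a half-plane. An angular loss \<open>\<omega> \<rho>\<close> on each side becomes half
  as large in \<open>y\<close>, whence \<open>\<mu>\<close>, and
  \<open>tangential_region_bound\<close> applies.\<close>

lemma corner_sector_bound: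
  fixes ap am \<omega> :: "real \<Rightarrow> real"
  assumes D: "open D" "k holomorphic_on D" "\<And>w. w \<in> D \<Longrightarrow> cmod (k w) < 1" and e: "\<epsilon> > 0"
    and arcs: "\<And>\<rho> s. 0 < \<rho> \<Longrightarrow> \<rho> \<le> \<epsilon> \<Longrightarrow> am \<rho> < s \<Longrightarrow> s < ap \<rho> \<Longrightarrow> w0 + of_real \<rho> * cis s \<in> D"
    and angles: "\<And>\<rho>. 0 < \<rho> \<Longrightarrow> \<rho> \<le> \<epsilon> \<Longrightarrow> am \<rho> \<le> \<beta> - pi + \<omega> \<rho> \<and> \<beta> + pi - \<omega> \<rho> \<le> ap \<rho>"
    and pos: "\<And>t. t \<ge> 0 \<Longrightarrow> 0 \<le> \<omega> t" and mono: "mono_on {0..} \<omega>"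
    and int: "(\<lambda>t. \<omega> t / t) integrable_on {0..\<epsilon>}"
  obtains c B where "c > 0"
    "\<And>S. Re S \<le> B \<Longrightarrow> \<bar>Im S\<bar> \<le> pi / 4 \<Longrightarrow>
       c * sqrt (exp (Re S)) \<le> 1 - cmod (k (w0 + exp (S + \<i> * of_real \<beta>)))"
proof -
  define \<mu> where "\<mu> n = \<omega> ((1/4)^n) / 2" for n
  define f where "f y = w0 + exp (\<i> * of_real \<beta>) * y^2" for y
  define U where "U = f -` D"
  have fcis: "f (of_real q * cis t) = w0 + of_real (q^2) * cis (\<beta> + 2 * t)" for q t
    by (simp add: f_def power_mult_distrib DeMoivre cis_conv_exp exp_add ring_distribs mult.left_commute
        flip: exp_of_nat_mult)
  have holf: "f holomorphic_on A" for A unfolding f_def by (intro holomorphic_intros)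
  obtain m where m: "(1/4::real)^m < \<epsilon>" using real_arch_pow_inv[OF e, of "1/4"] by auto
  obtain c d where cd: "c > 0" "d > 0"
    "\<And>y. y \<noteq> 0 \<Longrightarrow> cmod y \<le> d \<Longrightarrow> 9/10 * cmod y \<le> Re y \<Longrightarrow> y \<in> U \<and> c * cmod y \<le> 1 - cmod ((k \<circ> f) y)"
  proof (rule tangential_region_bound[of U "k \<circ> f" \<mu> m])
    show "open U" unfolding U_def using D(1) holf[of UNIV] holomorphic_on_imp_continuous_on
      by (intro open_vimage) auto
    show "k \<circ> f holomorphic_on U"
      by (rule holomorphic_on_compose_gen[OF holf D(2)]) (auto simp: U_def)
    show "cmod ((k \<circ> f) y) < 1" if "y \<in> U" for y using D(3) that by (simp add: U_def)
    show "\<mu> n \<ge> 0" for n by (simp add: \<mu>_def pos)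
    show "summable \<mu>" unfolding \<mu>_def by (intro summable_divide dini_imp_summable[OF pos mono int e])
    fix n y assume y: "m \<le> n" "(1/2)^(Suc n) \<le> cmod y" "cmod y \<le> (1/2)^n" "\<mu> n * cmod y < Re y"
    have y0: "cmod y > 0" using y(2) by (smt (verit) zero_less_power half_gt_zero)
    define q t where "q = cmod y ^ 2" and "t = Arg y"
    have yt: "y = of_real (cmod y) * cis t" using y0 by (simp add: t_def cis_Arg sgn_eq)
    have "0 \<le> \<mu> n * cmod y" by (simp add: \<mu>_def pos)
    then have "Re y > 0" using y(4) by linarith
    have "Re y = cmod y * cos t" by (subst yt) simp
    then have cos: "\<mu> n < cos t" using y(4) y0 by (simp add: mult.commute)
    have tpi: "\<bar>t\<bar> < pi / 2" using \<open>Re y > 0\<close> Arg_Re_pos[of y] unfolding t_def by blast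
    \<comment> \<open>Converts the condition on \<open>Re y\<close> into one on the angle: by
      \<open>sin u \<le> u\<close>, \<open>\<mu> n < cos t\<close> forces twice the angle to stay
      more than \<open>\<omega>\<close> away from \<open>pi\<close>.\<close>
    have "cos t = sin (pi / 2 - \<bar>t\<bar>)" by (simp add: sin_diff)
    also have "\<dots> \<le> pi / 2 - \<bar>t\<bar>" using tpi by (intro sin_x_le_x) simp
    finally have tm: "\<omega> ((1/4)^n) < pi - 2 * \<bar>t\<bar>" using cos by (simp add: \<mu>_def)
    have "q \<le> ((1/2)^n)^2" unfolding q_def using y(3) by (intro power_mono) auto
    also have "\<dots> = (1/4)^n" by (simp add: power2_eq_square flip: power_mult_distrib)
    finally have q4: "q \<le> (1/4)^n" .
    also have "(1/4::real)^n \<le> (1/4)^m" using y(1) by (intro power_decreasing) auto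
    finally have q: "0 < q" "q \<le> \<epsilon>" using m y0 by (auto simp: q_def)
    have "\<omega> q \<le> \<omega> ((1/4)^n)" using q q4 by (intro mono_onD[OF mono]) auto
    then have "am q < \<beta> + 2 * t" "\<beta> + 2 * t < ap q"
      using angles[OF q] tm by linarith+
    then have "w0 + of_real q * cis (\<beta> + 2 * t) \<in> D" using arcs q by blast
    then show "y \<in> U" unfolding U_def vimage_eq by (subst yt) (simp add: fcis q_def)
  qed blast
  show thesis
  proof (rule that[OF cd(1), of "2 * ln d"])
    fix S :: complex assume S: "Re S \<le> 2 * ln d" "\<bar>Im S\<bar> \<le> pi / 4"
    define y where "y = exp (S / 2)"
    have cy: "cmod y = exp (Re S / 2)" by (simp add: y_def norm_exp_eq_Re)
    have "cmod y \<le> exp (ln d)" unfolding cy exp_le_cancel_iff using S(1) by linarith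
    then have "cmod y \<le> d" using cd(2) by simp
    moreover have "9/10 * cmod y \<le> Re y"
      using cos_ge_nine_tenths[of "Im S / 2"] S(2) by (simp add: cy, simp add: y_def Re_exp)
    ultimately have "c * cmod y \<le> 1 - cmod ((k \<circ> f) y)" using cd(3)[of y] by (simp add: y_def)
    moreover have "f y = w0 + exp (S + \<i> * of_real \<beta>)"
      by (simp add: f_def y_def exp_add mult.commute flip: exp_of_nat_mult)
    moreover have "sqrt (exp (Re S)) = cmod y"
      unfolding cy by (rule real_sqrt_unique) (simp_all flip: exp_of_nat_mult)
    ultimately show "c * sqrt (exp (Re S)) \<le> 1 - cmod (k (w0 + exp (S + \<i> * of_real \<beta>)))" by simp
  qed
qed

text \<open>Since \<open>h\<close> omits \<open>w0\<close>, the disc carries a branch of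
  \<open>log (h - w0)\<close>. Along the radius its imaginary part can be normalised by one fixed
  multiple of \<open>2 * pi\<close>, because the curve never leaves \<open>\<Omega>\<close> to wind
  around the corner.\<close>

lemma corner_log_curve:
  fixes ap am :: "real \<Rightarrow> real" and h :: "complex \<Rightarrow> complex"
  assumes h: "h holomorphic_on ball 0 1" and w0: "w0 \<notin> h ` ball 0 1" and x: "cmod x = 1"
    and lim: "((\<lambda>t. h (of_real t * x)) \<longlongrightarrow> w0) (at_left 1)"
    and r: "0 < r" "r < 1" and rad: "(\<lambda>s. h (of_real s * x)) ` {r..<1} \<subseteq> \<Omega>"
    and cont: "continuous_on {0..\<epsilon>} am" and \<rho>1: "0 < \<rho>1" "\<rho>1 \<le> \<epsilon>"
    and outside: "\<And>\<rho> s. 0 < \<rho> \<Longrightarrow> \<rho> < \<rho>1 \<Longrightarrow> ap \<rho> \<le> s \<Longrightarrow> s \<le> am \<rho> + 2 * pi \<Longrightarrow>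
        w0 + of_real \<rho> * cis s \<notin> \<Omega>"
    and width: "\<And>\<rho>. 0 < \<rho> \<Longrightarrow> \<rho> < \<rho>1 \<Longrightarrow> ap \<rho> \<le> am \<rho> + 2 * pi"
  obtains r0 \<gamma> where "r \<le> r0" "r0 < 1" "continuous_on {r0..<1} \<gamma>"
    "\<And>t. t \<in> {r0..<1} \<Longrightarrow> h (of_real t * x) = w0 + exp (\<gamma> t + \<i> * of_real \<beta>)"
    "\<And>t. t \<in> {r0..<1} \<Longrightarrow> Re (\<gamma> t) < ln \<rho>1 \<and> am (exp (Re (\<gamma> t))) - \<beta> < Im (\<gamma> t) \<and>
        Im (\<gamma> t) < ap (exp (Re (\<gamma> t))) - \<beta>"
    "filterlim (\<lambda>t. Re (\<gamma> t)) at_bot (at_left 1)"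
proof -
  have "(\<lambda>z. h z - w0) holomorphic_on ball 0 1" by (intro holomorphic_intros h)
  moreover have "contractible (ball (0::complex) 1)" by (simp add: convex_imp_contractible)
  ultimately obtain L where L: "L holomorphic_on ball 0 1" "\<And>z. z \<in> ball 0 1 \<Longrightarrow> h z - w0 = exp (L z)"
    using contractible_imp_holomorphic_log[of "\<lambda>z. h z - w0" "ball 0 1"] w0
    by (metis (no_types, lifting) eq_iff_diff_eq_0 image_eqI)
  have tb: "of_real t * x \<in> ball 0 1" if "t \<in> {r..<1}" for t
    using that r x by (simp add: norm_mult)
  have "((\<lambda>t. cmod (h (of_real t * x) - w0)) \<longlongrightarrow> cmod (w0 - w0)) (at_left 1)"
    by (intro tendsto_intros lim)
  then have lim0: "((\<lambda>t. cmod (h (of_real t * x) - w0)) \<longlongrightarrow> 0) (at_left 1)" by simp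
  have "\<forall>\<^sub>F t in at_left 1. cmod (h (of_real t * x) - w0) < \<rho>1"
    using order_tendstoD(2)[OF lim0 \<rho>1(1)] .
  then obtain r1 where r1: "r1 < 1" "\<And>t. r1 < t \<Longrightarrow> t < 1 \<Longrightarrow> cmod (h (of_real t * x) - w0) < \<rho>1"
    unfolding eventually_at_left_field by blast
  define r0 where "r0 = (max r r1 + 1) / 2"
  have r0: "r \<le> r0" "r1 < r0" "r0 < 1" using r r1(1) by (auto simp: r0_def)
  define c where "c t = L (of_real t * x) - \<i> * of_real \<beta>" for t
  have contc: "continuous_on {r0..<1} c"
    unfolding c_def
    by (intro continuous_intros continuous_on_compose2[OF holomorphic_on_imp_continuous_on[OF L(1)]])
      (use tb r0(1) in auto)
  have hc: "h (of_real t * x) = w0 + exp (c t + \<i> * of_real \<beta>)" if "t \<in> {r0..<1}" for t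
    using L(2)[OF tb[of t]] that r0(1) by (simp add: c_def algebra_simps)
  have exc: "exp (Re (c t)) = cmod (h (of_real t * x) - w0)" if "t \<in> {r0..<1}" for t
    using hc[OF that] by (simp add: norm_exp_eq_Re)
  have small: "exp (Re (c t)) < \<rho>1" if "t \<in> {r0..<1}" for t
    using exc[OF that] r1(2)[of t] that r0 by auto
  have polar: "w0 + exp (S + \<i> * of_real \<beta>) = w0 + of_real (exp (Re S)) * cis (Im S + \<beta>)" for S
    by (simp add: exp_eq_polar)
  have in\<Omega>: "h (of_real t * x) \<in> \<Omega>" if "t \<in> {r0..<1}" for t using rad that r0 by auto
  \<comment> \<open>The angle above \<open>am\<close>, measured in full turns. An integer value
    would put the curve at the angle \<open>am + 2 * pi\<close>, which \<open>outside\<close>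
    forbids, so the floor of \<open>\<phi>\<close> is constant.\<close>
  define \<phi> where "\<phi> t = (Im (c t) + \<beta> - am (exp (Re (c t)))) / (2 * pi)" for t
  have cont\<phi>: "continuous_on {r0..<1} \<phi>"
  proof -
    have "continuous_on {r0..<1} (\<lambda>t. am (exp (Re (c t))))"
    proof (rule continuous_on_compose2[OF cont])
      show "(\<lambda>t. exp (Re (c t))) ` {r0..<1} \<subseteq> {0..\<epsilon>}" using small \<rho>1(2) by fastforce
    qed (intro continuous_intros contc)
    then show ?thesis unfolding \<phi>_def by (intro continuous_intros contc) auto
  qed
  have \<phi>int: "\<phi> t \<noteq> of_int n" if t: "t \<in> {r0..<1}" for t n
  proof
    assume "\<phi> t = of_int n"
    then have "Im (c t) + \<beta> = am (exp (Re (c t))) + 2 * pi * of_int n"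
      unfolding \<phi>_def by (simp add: divide_eq_eq algebra_simps)
    then have "h (of_real t * x) = w0 + of_real (exp (Re (c t))) * cis (am (exp (Re (c t))) + 2 * pi)"
      using hc[OF t] unfolding polar by (simp flip: cis_mult)
    then show False
      using in\<Omega>[OF t] outside[of "exp (Re (c t))" "am (exp (Re (c t))) + 2 * pi"] small[OF t]
        width[of "exp (Re (c t))"] by simp
  qed
  define n where "n = \<lfloor>\<phi> r0\<rfloor>"
  have r0in: "r0 \<in> {r0..<1}" using r0 by simp
  have n0: "of_int n < \<phi> r0" "\<phi> r0 < of_int (n + 1)"
    using \<phi>int[OF r0in, of n] of_int_floor_le[of "\<phi> r0"] unfolding n_def by linarith+
  have conn: "connected (\<phi> ` {r0..<1})" by (intro connected_continuous_image cont\<phi>) auto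
  have n1: "of_int n < \<phi> t" "\<phi> t < of_int (n + 1)" if t: "t \<in> {r0..<1}" for t
  proof -
    show "of_int n < \<phi> t"
    proof (rule ccontr)
      assume "\<not> of_int n < \<phi> t"
      then have "of_int n \<in> \<phi> ` {r0..<1}"
        using conn n0(1) t r0in unfolding connected_iff_interval by (meson image_eqI less_imp_le not_less)
      then show False using \<phi>int by (metis imageE)
    qed
    show "\<phi> t < of_int (n + 1)"
    proof (rule ccontr)
      assume "\<not> \<phi> t < of_int (n + 1)"
      then have "of_int (n + 1) \<in> \<phi> ` {r0..<1}"
        using conn n0(2) t r0in unfolding connected_iff_interval by (meson image_eqI less_imp_le not_less)
      then show False using \<phi>int by (metis imageE)
    qed
  qed
  define \<gamma> where "\<gamma> t = c t - 2 * of_int n * of_real pi * \<i>" for t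
  have Re\<gamma>: "Re (\<gamma> t) = Re (c t)" and Im\<gamma>: "Im (\<gamma> t) = Im (c t) - 2 * pi * of_int n" for t
    by (simp_all add: \<gamma>_def)
  have hg: "h (of_real t * x) = w0 + exp (\<gamma> t + \<i> * of_real \<beta>)" if "t \<in> {r0..<1}" for t
  proof -
    have "c t + \<i> * of_real \<beta> = \<gamma> t + \<i> * of_real \<beta> + of_real (of_int (2 * n) * pi) * \<i>"
      by (simp add: \<gamma>_def)
    then have "exp (c t + \<i> * of_real \<beta>) = exp (\<gamma> t + \<i> * of_real \<beta>)"
      unfolding exp_eq by blast
    then show ?thesis using hc[OF that] by simp
  qed
  show thesis
  proof (rule that[OF r0(1) r0(3) _ hg])
    show "continuous_on {r0..<1} \<gamma>" unfolding \<gamma>_def by (intro continuous_intros contc)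
    have "filterlim (\<lambda>t. cmod (h (of_real t * x) - w0)) (at_right 0) (at_left 1)"
      unfolding filterlim_at
    proof (intro conjI lim0)
      have "\<forall>\<^sub>F t in at_left (1::real). t \<in> {r0<..<1}"
        using r0 by (intro eventually_at_leftI[of r0]) auto
      then show "\<forall>\<^sub>F t in at_left (1::real). cmod (h (of_real t * x) - w0) \<in> {0<..} \<and> cmod (h (of_real t * x) - w0) \<noteq> 0"
        by eventually_elim (metis exc exp_gt_zero greaterThan_iff greaterThanLessThan_iff atLeastLessThan_iff less_imp_le less_irrefl)
    qed
    then have "filterlim (\<lambda>t. ln (cmod (h (of_real t * x) - w0))) at_bot (at_left 1)"
      by (rule filterlim_compose[OF ln_at_0])
    then show "filterlim (\<lambda>t. Re (\<gamma> t)) at_bot (at_left 1)"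
    proof (rule filterlim_mono_eventually)
      have "\<forall>\<^sub>F t in at_left (1::real). t \<in> {r0<..<1}"
        using r0 by (intro eventually_at_leftI[of r0]) auto
      then show "\<forall>\<^sub>F t in at_left 1. ln (cmod (h (of_real t * x) - w0)) = Re (\<gamma> t)"
        by eventually_elim (use exc Re\<gamma> in \<open>metis atLeastLessThan_iff greaterThanLessThan_iff less_imp_le ln_exp\<close>)
    qed auto
    fix t assume t: "t \<in> {r0..<1}"
    let ?q = "exp (Re (c t))"
    have "2 * pi * of_int n < Im (c t) + \<beta> - am ?q" "Im (c t) + \<beta> - am ?q < 2 * pi * of_int (n + 1)"
      using n1[OF t] unfolding \<phi>_def by (simp_all add: pos_less_divide_eq pos_divide_less_eq mult.commute)
    then have lo: "am ?q < Im (\<gamma> t) + \<beta>" and hi: "Im (\<gamma> t) + \<beta> < am ?q + 2 * pi"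
      by (simp_all add: Im\<gamma> algebra_simps)
    have "Re (c t) < ln \<rho>1" using small[OF t] \<rho>1(1) by (metis exp_gt_zero ln_exp ln_less_cancel_iff)
    \<comment> \<open>Within the turn above \<open>am\<close>, the angles from \<open>ap\<close> to
      \<open>am + 2 * pi\<close> belong to the complement of \<open>\<Omega>\<close>.\<close>
    moreover have "\<not> ap ?q \<le> Im (\<gamma> t) + \<beta>"
      using outside[of ?q "Im (\<gamma> t) + \<beta>"] small[OF t] hi in\<Omega>[OF t] hg[OF t] unfolding polar Re\<gamma> by auto
    ultimately show "Re (\<gamma> t) < ln \<rho>1 \<and> am (exp (Re (\<gamma> t))) - \<beta> < Im (\<gamma> t) \<and>
        Im (\<gamma> t) < ap (exp (Re (\<gamma> t))) - \<beta>"
      using lo unfolding Re\<gamma> by auto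
  qed
qed

text \<open>\<open>approach_strip\<close>, applied to the inverse of \<open>h\<close> in logarithmic
  coordinates, finds points of the sector with preimages near \<open>x\<close>;
  \<open>corner_sector_bound\<close> gives Julia's estimate at them.\<close>

lemma corner_approach:
  fixes h :: "complex \<Rightarrow> complex"
  assumes h: "h holomorphic_on ball 0 1" "inj_on h (ball 0 1)" and w0: "w0 \<notin> h ` ball 0 1"
    and x: "cmod x = 1" and lim: "((\<lambda>t. h (of_real t * x)) \<longlongrightarrow> w0) (at_left 1)"
    and J: "jordan_domain \<Omega>" and sub: "\<Omega> \<subseteq> h ` ball 0 1"
    and r: "0 < r" "r < 1" and rad: "(\<lambda>s. h (of_real s * x)) ` {r..<1} \<subseteq> \<Omega>"
    and corner: "dini_corner \<Omega> w0 (2 * pi)"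
  obtains c and z :: "nat \<Rightarrow> complex" where "c > 0" "\<And>n. z n \<in> ball 0 1" "z \<longlonglongrightarrow> x"
    "(\<lambda>n. h (z n)) \<longlonglongrightarrow> w0" "\<And>n. c * sqrt (cmod (h (z n) - w0)) \<le> 1 - cmod (z n)"
proof -
  from corner[unfolded dini_corner_def] show thesis
  proof (elim exE conjE)
    fix \<epsilon> :: real and ap am \<omega> :: "real \<Rightarrow> real"
    assume e: "\<epsilon> > 0"
      and cont: "continuous_on {0..\<epsilon>} ap" "continuous_on {0..\<epsilon>} am"
      and cor': "\<forall>\<rho>\<in>{0<..\<epsilon>}.
             frontier \<Omega> \<inter> sphere w0 \<rho> = {w0 + of_real \<rho> * cis (ap \<rho>), w0 + of_real \<rho> * cis (am \<rho>)} \<and>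
             0 < ap \<rho> - am \<rho> \<and> ap \<rho> - am \<rho> < 2 * pi \<and>
             (\<forall>s. am \<rho> < s \<and> s < ap \<rho> \<longrightarrow> w0 + of_real \<rho> * cis s \<in> \<Omega>)"
      and \<omega>': "\<forall>t\<ge>0. 0 \<le> \<omega> t" "mono_on {0..} \<omega>" "(\<omega> \<longlongrightarrow> 0) (at_right 0)"
      and mod: "\<forall>s\<in>{0..\<epsilon>}. \<forall>t\<in>{0..\<epsilon>}. \<bar>ap s - ap t\<bar> \<le> \<omega> \<bar>s - t\<bar> \<and> \<bar>am s - am t\<bar> \<le> \<omega> \<bar>s - t\<bar>"
      and int: "(\<lambda>t. \<omega> t / t) integrable_on {0..\<epsilon>}"
      and width: "2 * pi = ap 0 - am 0"
    note cor = bspec[OF cor'] and \<omega> = \<omega>'(1)[rule_format] \<omega>'(2,3)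
    \<comment> \<open>The direction of the axis; opening \<open>2 * pi\<close> means that both sides
      tend to the opposite direction, at angles \<open>\<beta> - pi\<close> and
      \<open>\<beta> + pi\<close>.\<close>
    define \<beta> where "\<beta> = am 0 + pi"
    have angles: "\<bar>ap \<rho> - (\<beta> + pi)\<bar> \<le> \<omega> \<rho>" "\<bar>am \<rho> - (\<beta> - pi)\<bar> \<le> \<omega> \<rho>" if "0 < \<rho>" "\<rho> \<le> \<epsilon>" for \<rho>
      using mod[rule_format, of \<rho> 0] that width by (simp_all add: \<beta>_def)
    define D where "D = h ` ball 0 1"
    obtain k where k: "k holomorphic_on D" "\<And>z. z \<in> ball 0 1 \<Longrightarrow> k (h z) = z"
      using holomorphic_has_inverse[OF h(1) open_ball h(2)] unfolding D_def by metis
    have oD: "open D" unfolding D_def by (rule open_mapping_thm3[OF h(1) open_ball h(2)])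
    have k1: "k w \<in> ball 0 1" "h (k w) = w" if "w \<in> D" for w
      using that k(2) unfolding D_def by auto
    define E where "E S = w0 + exp (S + \<i> * of_real \<beta>)" for S
    have polar: "E S = w0 + of_real (exp (Re S)) * cis (Im S + \<beta>)" for S
      by (simp add: E_def exp_eq_polar)
    have EB: "cmod (E S - w0) = exp (Re S)" for S by (simp add: E_def norm_exp_eq_Re)
    have holE: "E holomorphic_on A" for A unfolding E_def by (intro holomorphic_intros)
    obtain c B where cB: "c > 0" "\<And>S. Re S \<le> B \<Longrightarrow> \<bar>Im S\<bar> \<le> pi / 4 \<Longrightarrow> 
        c * sqrt (exp (Re S)) \<le> 1 - cmod (k (w0 + exp (S + \<i> * of_real \<beta>)))"
    proof (rule corner_sector_bound[OF oD k(1) _ e, where am = am and ap = ap and \<beta> = \<beta> and \<omega> = \<omega> and ?w0.0 = w0])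
      show "cmod (k w) < 1" if "w \<in> D" for w using k1(1)[OF that] by simp
      show "w0 + of_real \<rho> * cis s \<in> D" if "0 < \<rho>" "\<rho> \<le> \<epsilon>" "am \<rho> < s" "s < ap \<rho>" for \<rho> s
        using cor[of \<rho>] that sub unfolding D_def by auto
      show "am \<rho> \<le> \<beta> - pi + \<omega> \<rho> \<and> \<beta> + pi - \<omega> \<rho> \<le> ap \<rho>" if "0 < \<rho>" "\<rho> \<le> \<epsilon>" for \<rho>
        using angles[OF that] by linarith
    qed (use \<omega> int in blast)+
    \<comment> \<open>With error below \<open>1/2\<close> the sides of the strip have modulus
      between \<open>5/2\<close> and 4, as \<open>approach_strip\<close> requires.\<close>
    have "\<forall>\<^sub>F t in at_right 0. \<omega> t < 1/2" using order_tendstoD(2)[OF \<omega>(3), of "1/2"] by simp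
    then obtain d where d: "d > 0" "\<And>t. 0 < t \<Longrightarrow> t < d \<Longrightarrow> \<omega> t < 1/2"
      unfolding eventually_at_right_field by blast
    define \<rho>1 where "\<rho>1 = min d \<epsilon>"
    have \<rho>1: "0 < \<rho>1" "\<rho>1 \<le> \<epsilon>" using d e by (auto simp: \<rho>1_def)
    obtain r0 \<gamma> where g: "r \<le> r0" "r0 < 1" "continuous_on {r0..<1} \<gamma>"
      "\<And>t. t \<in> {r0..<1} \<Longrightarrow> h (of_real t * x) = E (\<gamma> t)"
      "\<And>t. t \<in> {r0..<1} \<Longrightarrow> Re (\<gamma> t) < ln \<rho>1 \<and> am (exp (Re (\<gamma> t))) - \<beta> < Im (\<gamma> t) \<and>
          Im (\<gamma> t) < ap (exp (Re (\<gamma> t))) - \<beta>"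
      "filterlim (\<lambda>t. Re (\<gamma> t)) at_bot (at_left 1)"
    proof (rule corner_log_curve[OF h(1) w0 x lim r rad cont(2) \<rho>1, where ap = ap and \<beta> = \<beta>])
      show "w0 + of_real \<rho> * cis s \<notin> \<Omega>" if "0 < \<rho>" "\<rho> < \<rho>1" "ap \<rho> \<le> s" "s \<le> am \<rho> + 2 * pi" for \<rho> s
        by (rule jordan_corner_complement[OF J cont cor]) (use that \<rho>1 in auto)
      show "ap \<rho> \<le> am \<rho> + 2 * pi" if "0 < \<rho>" "\<rho> < \<rho>1" for \<rho>
        using cor[of \<rho>] that \<rho>1(2) by auto
    qed (auto simp: E_def)
    define up lo where "up t = ap (exp t) - \<beta>" and "lo t = am (exp t) - \<beta>" for t
    have expl: "0 < exp t \<and> exp t < d \<and> exp t < \<epsilon>" if "t < ln \<rho>1" for t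
    proof -
      have "exp t < \<rho>1" using that \<rho>1(1) by (metis exp_less_cancel_iff exp_ln)
      then show ?thesis by (simp add: \<rho>1_def)
    qed
    have near: "\<bar>up t - pi\<bar> < 1/2" "\<bar>lo t + pi\<bar> < 1/2" if "t < ln \<rho>1" for t
    proof -
      have "\<omega> (exp t) < 1/2" using d(2) expl[OF that] by blast
      moreover have "exp t > 0" "exp t \<le> \<epsilon>" using expl[OF that] by simp_all
      note angles[OF this]
      ultimately show "\<bar>up t - pi\<bar> < 1/2" "\<bar>lo t + pi\<bar> < 1/2"
        unfolding up_def lo_def abs_le_iff abs_less_iff by linarith+
    qed
    have pi3: "3 < pi" "pi < 32/10" using pi_approx by simp_all
    define A where "A = {S. Re S < ln \<rho>1}"
    define T where "T = A \<inter> ((\<lambda>S. min (up (Re S) - Im S) (Im S - lo (Re S))) -` {0<..})"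
    have "open A" unfolding A_def by (rule open_halfspace_Re_lt)
    have contul: "continuous_on A (\<lambda>S. up (Re S))" "continuous_on A (\<lambda>S. lo (Re S))"
    proof -
      have *: "continuous_on A (\<lambda>S. f (exp (Re S)))" if "continuous_on {0..\<epsilon>} f" for f :: "real \<Rightarrow> real"
      proof (rule continuous_on_compose2[OF that])
        show "(\<lambda>S. exp (Re S)) ` A \<subseteq> {0..\<epsilon>}"
          using expl unfolding A_def by (fastforce intro: less_imp_le)
      qed (intro continuous_intros)
      show "continuous_on A (\<lambda>S. up (Re S))" "continuous_on A (\<lambda>S. lo (Re S))"
        unfolding up_def lo_def by (intro continuous_on_diff continuous_on_const * cont)+
    qed
    have oT: "open T"
      unfolding T_def
      by (intro continuous_open_preimage continuous_intros contul \<open>open A\<close> open_greaterThan)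
    have Tiff: "S \<in> T \<longleftrightarrow> Re S < ln \<rho>1 \<and> lo (Re S) < Im S \<and> Im S < up (Re S)" for S
      by (auto simp: T_def A_def)
    have TD: "E S \<in> D" if "S \<in> T" for S
    proof -
      have "exp (Re S) \<in> {0<..\<epsilon>}" using that expl[of "Re S"] by (auto simp: Tiff)
      moreover have "am (exp (Re S)) < Im S + \<beta>" "Im S + \<beta> < ap (exp (Re S))"
        using that by (auto simp: Tiff up_def lo_def)
      ultimately have "E S \<in> \<Omega>" unfolding polar using cor[of "exp (Re S)"] by blast
      then show ?thesis using sub by (auto simp: D_def)
    qed
    \<comment> \<open>The bound \<open>B\<close> makes the sector estimate available, and
      \<open>- real n\<close> forces \<open>h (z n)\<close> to \<open>w0\<close>.\<close>
    have "\<exists>S. S \<in> T \<and> Re S < min B (- real n) \<and> \<bar>Im S\<bar> \<le> pi / 4 \<and> cmod (k (E S) - x) < inverse (real (Suc n))" for n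
    proof -
      obtain S where "Re S < ln \<rho>1" "Re S < min B (- real n)" "\<bar>Im S\<bar> \<le> pi / 4"
        "cmod ((k \<circ> E) S - x) < inverse (real (Suc n))"
      proof (rule approach_strip[OF oT, of "k \<circ> E" "ln \<rho>1" lo up r0 \<gamma> x "inverse (real (Suc n))" "min B (- real n)"])
        show "k \<circ> E holomorphic_on T"
          by (rule holomorphic_on_compose_gen[OF holE k(1)]) (use TD in blast)
        show "cmod ((k \<circ> E) S) < 1" if "S \<in> T" for S using k1(1)[OF TD[OF that]] by simp
        show "pi / 4 < up t \<and> up t \<le> 4" if "t < ln \<rho>1" for t
          using near[OF that] pi3 unfolding abs_less_iff by linarith
        show "- 4 \<le> lo t \<and> lo t < - (pi / 4)" if "t < ln \<rho>1" for t
          using near[OF that] pi3 unfolding abs_less_iff by linarith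
        show "(k \<circ> E) (\<gamma> t) = of_real t * x" if "t \<in> {r0..<1}" for t
        proof -
          have "of_real t * x \<in> ball 0 1" using that r(1) g(1) x by (simp add: norm_mult)
          then show ?thesis using k(2) g(4)[OF that] by (metis comp_apply)
        qed
      qed (use g x in \<open>auto simp: Tiff up_def lo_def\<close>)
      then have "S \<in> T" using near[of "Re S"] pi3 unfolding Tiff abs_less_iff abs_le_iff by linarith
      then show ?thesis using \<open>Re S < min B (- real n)\<close> \<open>\<bar>Im S\<bar> \<le> pi / 4\<close>
        \<open>cmod ((k \<circ> E) S - x) < inverse (real (Suc n))\<close> by auto
    qed
    then obtain S where S: "\<And>n. S n \<in> T" "\<And>n. Re (S n) < min B (- real n)" "\<And>n. \<bar>Im (S n)\<bar> \<le> pi / 4"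
      "\<And>n. cmod (k (E (S n)) - x) < inverse (real (Suc n))" by metis
    define z where "z n = k (E (S n))" for n
    have hz: "h (z n) = E (S n)" for n unfolding z_def by (rule k1(2)[OF TD[OF S(1)]])
    show thesis
    proof (rule that[of c z])
      show "z n \<in> ball 0 1" for n unfolding z_def by (rule k1(1)[OF TD[OF S(1)]])
      have "(\<lambda>n. z n - x) \<longlonglongrightarrow> 0"
      proof (rule Lim_null_comparison[OF _ LIMSEQ_inverse_real_of_nat])
        show "\<forall>\<^sub>F n in sequentially. cmod (z n - x) \<le> inverse (real (Suc n))"
          using S(4) by (intro always_eventually) (auto simp: z_def intro: less_imp_le)
      qed
      then show "z \<longlonglongrightarrow> x" by (rule LIM_zero_cancel)
      have "(\<lambda>n. h (z n) - w0) \<longlonglongrightarrow> 0"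
      proof (rule Lim_null_comparison)
        show "\<forall>\<^sub>F n in sequentially. cmod (h (z n) - w0) \<le> exp (- real n)"
          using S(2) by (intro always_eventually) (auto simp: hz EB intro: less_imp_le)
        show "(\<lambda>n. exp (- real n)) \<longlonglongrightarrow> 0"
          by (intro filterlim_compose[OF exp_at_bot] filterlim_compose[OF filterlim_uminus_at_bot_at_top] filterlim_real_sequentially)
      qed
      then show "(\<lambda>n. h (z n)) \<longlonglongrightarrow> w0" by (rule LIM_zero_cancel)
      show "c * sqrt (cmod (h (z n) - w0)) \<le> 1 - cmod (z n)" for n
        using cB(2)[of "S n"] S(2)[of n] S(3)[of n] unfolding hz EB unfolding z_def E_def by simp
    qed (rule cB(1))
  qed
qed

section \<open>Charts of the disc near a boundary point\<close>

text \<open>Inverse of \<open>\<zeta> - R\<^sup>2 / \<zeta>\<close>, which maps the part of the half-plane outside the disc of radius \<open>R\<close> onto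
  the half-plane.  Composed with a Cayley transform it parametrises a neighbourhood of \<open>x\<close> in the
  unit disc that avoids a given interior point.\<close>

definition jinv :: "real \<Rightarrow> complex \<Rightarrow> complex" where
  "jinv R w = (w + csqrt (w\<^sup>2 + 4 * of_real R ^ 2)) / 2"

definition chart :: "real \<Rightarrow> complex \<Rightarrow> complex \<Rightarrow> complex" where
  "chart R x w = x * (jinv R w - 1) / (jinv R w + 1)"

lemma square_not_nonpos: "Re w > 0 \<Longrightarrow> w\<^sup>2 + 4 * of_real R ^ 2 \<notin> \<real>\<^sub>\<le>\<^sub>0"
proof
  assume w: "Re w > 0" and n: "w\<^sup>2 + 4 * of_real R ^ 2 \<in> \<real>\<^sub>\<le>\<^sub>0"
  have e: "of_real R ^ 2 = (of_real (R^2) :: complex)" by simp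
  have "Re w * Im w + Im w * Re w = 0" "(Re w)^2 - (Im w)^2 + 4 * R^2 \<le> 0"
    using n unfolding complex_nonpos_Reals_iff e by (auto simp: power2_eq_square)
  then have "Im w = 0" "(Re w)^2 + 4 * R^2 \<le> 0" using w by auto
  then show False using w by (smt (verit) zero_less_power2 zero_le_power2)
qed

lemma jinv_holomorphic: "jinv R holomorphic_on halfplane"
  unfolding jinv_def by (intro holomorphic_intros) (use square_not_nonpos in auto)

text \<open>\<open>jinv R w\<close> is a root \<open>z\<close> of
  \<open>z^2 - w * z - R^2 = 0\<close>. As \<open>Re w\<close> equals
  \<open>Re z * (1 - R^2 / cmod z ^ 2)\<close>, its positivity forces
  \<open>cmod z > \<bar>R\<bar>\<close>.\<close>

lemma jinv:
  assumes "Re w > 0"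
  shows Re_jinv: "Re (jinv R w) > 0" and jinv_eq: "jinv R w - of_real (R^2) / jinv R w = w"
    and cmod_jinv: "\<bar>R\<bar> < cmod (jinv R w)"
proof -
  let ?z = "jinv R w"
  have "Re (csqrt (w\<^sup>2 + 4 * of_real R ^ 2)) > 0" using Re_csqrt_pos[OF square_not_nonpos[OF assms]] .
  then show r: "Re ?z > 0" using assms by (simp add: jinv_def del: csqrt.sel)
  then have nz: "?z \<noteq> 0" by auto
  have "2 * ?z - w = csqrt (w\<^sup>2 + 4 * of_real R ^ 2)" by (simp add: jinv_def field_simps)
  then have "(2 * ?z - w)^2 = w^2 + 4 * of_real R ^ 2" by simp
  then have "4 * (?z^2 - w * ?z - of_real (R^2)) = 0" by (simp add: power2_eq_square algebra_simps)
  then have q: "?z^2 - w * ?z - of_real (R^2) = 0" by (metis mult_eq_0_iff zero_neq_numeral)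
  then show e: "?z - of_real (R^2) / ?z = w" using nz by (simp add: field_simps power2_eq_square)
  have "Re (of_real (R^2) / ?z) = R^2 * (Re ?z / cmod ?z ^ 2)" by (simp add: Re_divide cmod_power2)
  then have "Re ?z - R^2 * (Re ?z / cmod ?z ^ 2) > 0" using e assms by (metis minus_complex.sel(1))
  then have "Re ?z * R^2 < Re ?z * cmod ?z ^ 2" using nz by (simp add: field_simps)
  then have "R^2 < cmod ?z ^ 2" using r by simp
  then show "\<bar>R\<bar> < cmod ?z" by (metis abs_norm_cancel abs_square_less_1 power2_less_imp_less norm_ge_zero power2_abs)
qed

lemma jinv_inverse:
  assumes "Re z > 0" "\<bar>R\<bar> < cmod z"
  shows "Re (z - of_real (R^2) / z) = Re z * (1 - R^2 / cmod z ^ 2)"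
    and "Re (z - of_real (R^2) / z) > 0" and "jinv R (z - of_real (R^2) / z) = z"
proof -
  let ?w = "z - of_real (R^2) / z"
  have nz: "z \<noteq> 0" using assms by auto
  have "Re (of_real (R^2) / z) = R^2 * (Re z / cmod z ^ 2)" by (simp add: Re_divide cmod_power2)
  then show 1: "Re ?w = Re z * (1 - R^2 / cmod z ^ 2)" by (simp add: algebra_simps)
  have "\<bar>R\<bar>^2 < cmod z ^ 2" using assms(2) by (intro power_strict_mono) auto
  then have "R^2 / cmod z ^ 2 < 1" using nz by simp
  then show w: "Re ?w > 0" unfolding 1 using assms(1) by simp
  define y where "y = jinv R ?w"
  have y: "Re y > 0" "y - of_real (R^2) / y = ?w" unfolding y_def using Re_jinv[OF w] jinv_eq[OF w] .
  then have ny: "y \<noteq> 0" by auto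
  have "(y - z) * (1 + of_real (R^2) / (y * z)) = (y - of_real (R^2) / y) - ?w"
    using nz ny by (simp add: field_simps)
  then have "y - z = 0 \<or> 1 + of_real (R^2) / (y * z) = 0" using y(2) by simp
  \<comment> \<open>This excludes the other root \<open>- R^2 / z\<close> of the quadratic equation,
    whose real part is not positive.\<close>
  moreover have "1 + of_real (R^2) / (y * z) \<noteq> 0"
  proof
    assume "1 + of_real (R^2) / (y * z) = 0"
    then have "y = - of_real (R^2) / z" using nz ny by (simp add: field_simps add_eq_0_iff)
    then have "Re y = - (R^2 * (Re z / cmod z ^ 2))" by (simp add: Re_divide cmod_power2)
    then show False using y(1) assms(1) by (smt (verit) divide_nonneg_nonneg mult_nonneg_nonneg zero_le_power2)
  qed
  ultimately show "jinv R ?w = z" unfolding y_def by simp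
qed

lemma jinv_deriv:
  assumes w: "Re w > 0"
  shows "deriv (jinv R) w * (1 + of_real (R^2) / jinv R w ^ 2) = 1"
proof -
  have nz: "jinv R w \<noteq> 0" using Re_jinv[OF w, of R] by auto
  have d: "(jinv R has_field_derivative deriv (jinv R) w) (at w)"
    using jinv_holomorphic w by (intro holomorphic_derivI[of _ halfplane]) auto
  have "((\<lambda>w. jinv R w - of_real (R^2) / jinv R w) has_field_derivative
      deriv (jinv R) w * (1 + of_real (R^2) / jinv R w ^ 2)) (at w)"
    by (rule derivative_eq_intros d refl nz | simp add: power2_eq_square field_simps nz)+
  moreover have "((\<lambda>w. jinv R w - of_real (R^2) / jinv R w) has_field_derivative 1) (at w)"
  proof (rule has_field_derivative_transform_within_open[OF DERIV_ident open_halfplane])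
    show "x = jinv R x - of_real (R^2) / jinv R x" if "x \<in> halfplane" for x
      using jinv_eq[of x R] that by simp
  qed (use w in simp)
  ultimately show ?thesis by (rule DERIV_unique)
qed

lemma jinv_plus_one: "Re w > 0 \<Longrightarrow> jinv R w + 1 \<noteq> 0"
  using Re_jinv[of w R] by (auto simp: complex_eq_iff)

lemma chart_holomorphic: "chart R x holomorphic_on halfplane"
  unfolding chart_def by (intro holomorphic_intros jinv_holomorphic) (use jinv_plus_one in auto)

lemma chart_in_ball: "cmod x = 1 \<Longrightarrow> Re w > 0 \<Longrightarrow> chart R x w \<in> ball 0 1"
proof -
  assume x: "cmod x = 1" and w: "Re w > 0"
  have "cmod (jinv R w - 1)^2 < cmod (jinv R w + 1)^2"
    using cmod_cnj_add_diff[of "jinv R w" 1] Re_jinv[OF w, of R] by simp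
  then have "cmod (jinv R w - 1) < cmod (jinv R w + 1)" by (rule power2_less_imp_less) simp
  then show ?thesis using x by (simp add: chart_def norm_mult norm_divide divide_less_eq)
qed

lemma chart_deriv:
  assumes w: "Re w > 0"
  shows "deriv (chart R x) w = 2 * x * deriv (jinv R) w / (jinv R w + 1)^2"
proof -
  have d: "(jinv R has_field_derivative deriv (jinv R) w) (at w)"
    using jinv_holomorphic w by (intro holomorphic_derivI[of _ halfplane]) auto
  show ?thesis
    unfolding chart_def[abs_def]
    by (rule DERIV_imp_deriv)
      (rule derivative_eq_intros d refl jinv_plus_one[OF w] | simp add: power2_eq_square field_simps jinv_plus_one[OF w])+
qed

lemma chart_diff: "Re w > 0 \<Longrightarrow> x - chart R x w = 2 * x / (jinv R w + 1)"
  using jinv_plus_one[of w R] by (simp add: chart_def field_simps)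

lemma cayley_Re:
  assumes "cmod x = 1" "x \<noteq> z"
  shows "Re ((x + z) / (x - z)) = (1 - cmod z ^ 2) / cmod (x - z) ^ 2"
proof -
  have "(Re x)^2 + (Im x)^2 = 1" using assms(1) by (metis cmod_power2 one_power2)
  then show ?thesis unfolding Re_divide cmod_power2 by (simp add: power2_eq_square algebra_simps)
qed

text \<open>\<^term>\<open>jmap R x\<close> is the inverse of \<^term>\<open>chart R x\<close>.\<close>

definition jmap :: "real \<Rightarrow> complex \<Rightarrow> complex \<Rightarrow> complex" where
  "jmap R x z = (x + z) / (x - z) - of_real (R^2) / ((x + z) / (x - z))"

text \<open>The Cayley image \<open>\<zeta>\<close> has modulus about
  \<open>2 / cmod (x - z)\<close>. The threshold \<open>2 * R + 4\<close> makes
  \<open>cmod \<zeta> \<ge> 2 * R + 3\<close>, so the correction \<open>R^2 / \<zeta>\<close> is at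
  most \<open>R\<close> in modulus and removes at most half of \<open>Re \<zeta>\<close>.\<close>

lemma jmap_bounds:
  assumes x: "cmod x = 1" and z: "cmod z < 1" and R: "R \<ge> 0"
    and near: "cmod (x - z) * (2 * R + 4) \<le> 1"
  shows "Re (jmap R x z) > 0" and "chart R x (jmap R x z) = z"
    and "cmod (jmap R x z) \<le> 3 / cmod (x - z)"
    and "1 / (2 * cmod (x - z)) \<le> cmod (jmap R x z)"
    and "(1 - cmod z) / (2 * cmod (x - z) ^ 2) \<le> Re (jmap R x z)"
proof -
  define \<zeta> where "\<zeta> = (x + z) / (x - z)"
  define d where "d = cmod (x - z)"
  have xz: "x \<noteq> z" using x z by auto
  then have d: "d > 0" by (simp add: d_def)
  have "d * 4 \<le> d * (2 * R + 4)" using d R by (intro mult_left_mono) auto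
  then have d4: "d \<le> 1/4" using near by (simp add: d_def)
  have z2: "cmod z ^ 2 \<le> cmod z" using z by (simp add: power2_eq_square mult_le_one mult_left_le)
  have Re\<zeta>: "Re \<zeta> = (1 - cmod z ^ 2) / d^2" unfolding \<zeta>_def d_def by (rule cayley_Re[OF x xz])
  have z1: "cmod z ^ 2 < 1" using z by (simp add: abs_square_less_1)
  have pos: "Re \<zeta> > 0" unfolding Re\<zeta> using z1 d by simp
  have \<zeta>1: "\<zeta> + 1 = 2 * x / (x - z)" unfolding \<zeta>_def using xz by (simp add: field_simps)
  then have c1: "cmod (\<zeta> + 1) = 2 / d" using x by (simp add: norm_divide norm_mult d_def)
  have up: "cmod \<zeta> \<le> 2 / d + 1" and lo: "2 / d - 1 \<le> cmod \<zeta>"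
    using norm_triangle_ineq4[of "\<zeta> + 1" 1] norm_triangle_ineq[of \<zeta> 1] c1 by auto
  have "2 * R + 4 \<le> 1 / d" using near d by (simp add: d_def field_simps)
  moreover have "2 / d = 2 * (1 / d)" by simp
  ultimately have big: "2 * R + 3 \<le> cmod \<zeta>" and bigd: "2 * R + 4 \<le> 1 / d" using lo R by linarith+
  have j: "jmap R x z = \<zeta> - of_real (R^2) / \<zeta>" by (simp add: jmap_def \<zeta>_def)
  have R\<zeta>: "\<bar>R\<bar> < cmod \<zeta>" using big R by simp
  show "Re (jmap R x z) > 0" unfolding j by (rule jinv_inverse(2)[OF pos R\<zeta>])
  have "\<zeta> + 1 \<noteq> 0" using c1 d by auto
  have "x * (\<zeta> - 1) = z * (\<zeta> + 1)" unfolding \<zeta>_def using xz by (simp add: field_simps)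
  then show "chart R x (jmap R x z) = z"
    unfolding chart_def j jinv_inverse(3)[OF pos R\<zeta>] using \<open>\<zeta> + 1 \<noteq> 0\<close> by (simp add: field_simps)
  have R2: "R^2 / cmod \<zeta> \<le> R"
  proof -
    have "R * R \<le> R * cmod \<zeta>" using R\<zeta> R by (intro mult_left_mono) auto
    then show ?thesis using R\<zeta> R by (simp add: power2_eq_square divide_le_eq)
  qed
  have cq: "cmod (of_real (R^2) / \<zeta>) = R^2 / cmod \<zeta>" by (simp add: norm_divide norm_power)
  have "cmod (jmap R x z) \<le> cmod \<zeta> + R"
    unfolding j using norm_triangle_ineq4[of \<zeta> "of_real (R^2) / \<zeta>"] R2 unfolding cq by linarith
  also have "\<dots> \<le> 3 / d" using up bigd R by (simp add: add_divide_distrib[symmetric]) 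
  finally show "cmod (jmap R x z) \<le> 3 / cmod (x - z)" by (simp add: d_def)
  have "cmod \<zeta> - R \<le> cmod (jmap R x z)"
    unfolding j using norm_triangle_ineq2[of \<zeta> "of_real (R^2) / \<zeta>"] R2 unfolding cq by linarith
  moreover have "1 / (2 * d) = (1 / d) / 2" by simp
  moreover have "2 / d = 2 * (1 / d)" by simp
  ultimately show "1 / (2 * cmod (x - z)) \<le> cmod (jmap R x z)"
    using lo bigd R unfolding d_def[symmetric] by linarith
  have "2 * R^2 \<le> (2 * R + 3)^2" using R by (simp add: power2_eq_square algebra_simps)
  also have "\<dots> \<le> cmod \<zeta> ^ 2" using big R by (intro power_mono) auto
  finally have "R^2 / cmod \<zeta>^2 \<le> 1/2" using R\<zeta> R by (simp add: divide_le_eq)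
  then have "Re \<zeta> * (1/2) \<le> Re \<zeta> * (1 - R^2 / cmod \<zeta>^2)" using pos by (intro mult_left_mono) auto
  then have "Re \<zeta> / 2 \<le> Re (jmap R x z)" unfolding j jinv_inverse(1)[OF pos R\<zeta>] by simp
  moreover have "(1 - cmod z) / (2 * d^2) \<le> Re \<zeta> / 2"
  proof -
    have "(1 - cmod z) / (2 * d^2) \<le> (1 - cmod z ^ 2) / (2 * d^2)"
      using z2 d by (intro divide_right_mono) auto
    then show ?thesis unfolding Re\<zeta> by simp
  qed
  ultimately show "(1 - cmod z) / (2 * cmod (x - z) ^ 2) \<le> Re (jmap R x z)" unfolding d_def by linarith
qed

section \<open>Angular limits as limits at infinity in a sector\<close>

lemma nontangential_tendsto:
  assumes "\<And>K. K > 1 \<Longrightarrow> (f \<longlongrightarrow> l) (at x within stolz x K)"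
  shows "(f \<longlongrightarrow> l) (nontangential x)"
  using assms unfolding filterlim_def nontangential_def filtermap_SUP by (intro SUP_least) auto

lemma radius_nontangential:
  assumes x: "cmod x = 1"
  shows "filterlim (\<lambda>t. of_real t * x) (nontangential x) (at_left 1)"
proof -
  have "filterlim (\<lambda>t. of_real t * x) (at x within stolz x 2) (at_left 1)"
    unfolding filterlim_at
  proof
    have "\<forall>\<^sub>F t in at_left (1::real). t \<in> {0<..<1}"
      by (intro eventually_at_leftI[of 0]) auto
    then show "\<forall>\<^sub>F t in at_left 1. of_real t * x \<in> stolz x 2 \<and> of_real t * x \<noteq> x"
    proof eventually_elim
      case (elim t)
      have "x - of_real t * x = of_real (1 - t) * x" by (simp add: algebra_simps)
      then have "cmod (x - of_real t * x) = 1 - t" using elim x by (simp add: norm_mult del: of_real_diff)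
      moreover have "cmod (of_real t * x) = t" using elim x by (simp add: norm_mult)
      ultimately show ?case using elim unfolding stolz_def by auto
    qed
    have "((\<lambda>t. of_real t * x) \<longlongrightarrow> of_real 1 * x) (at_left 1)" by (intro tendsto_intros)
    then show "((\<lambda>t. of_real t * x) \<longlongrightarrow> x) (at_left 1)" by simp
  qed
  moreover have "at x within stolz x 2 \<le> nontangential x"
    unfolding nontangential_def by (rule SUP_upper) simp
  ultimately show ?thesis by (rule filterlim_mono) simp
qed

text \<open>Needed to identify a \<open>Liminf\<close> with a limit, which fails along the trivial
  filter.\<close>

lemma nontangential_neq_bot: "cmod x = 1 \<Longrightarrow> nontangential x \<noteq> bot"
proof
  assume "cmod x = 1" and "nontangential x = bot"
  then have "filterlim (\<lambda>t. of_real t * x) bot (at_left (1::real))" using radius_nontangential by metis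
  then show False by (simp add: filterlim_def bot_unique filtermap_bot_iff trivial_limit_at_left_real)
qed

definition sector_infinity :: "real \<Rightarrow> complex filter" where
  "sector_infinity M = inf at_infinity (principal {w. Re w > 0 \<and> cmod w \<le> M * Re w})"

lemma eventually_sector_infinity:
  "eventually P (sector_infinity M) \<longleftrightarrow> (\<exists>B. \<forall>w. Re w > 0 \<and> cmod w \<le> M * Re w \<and> B \<le> cmod w \<longrightarrow> P w)"
  unfolding sector_infinity_def eventually_inf_principal eventually_at_infinity by auto

text \<open>With \<open>d = cmod (x - z)\<close>, the bounds \<open>3 / d\<close> for the modulus
  and \<open>(1 - cmod z) / (2 * d^2)\<close> for the real part combine with
  \<open>d < K * (1 - cmod z)\<close> to the aperture \<open>6 * K\<close>.\<close>

lemma jmap_filterlim: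
  assumes x: "cmod x = 1" and R: "R \<ge> 0" and K: "K > 1"
  shows "filterlim (jmap R x) (sector_infinity (6 * K)) (at x within stolz x K)"
    and "\<forall>\<^sub>F z in at x within stolz x K. chart R x (jmap R x z) = z"
proof -
  define \<delta> where "\<delta> = 1 / (2 * R + 4)"
  have \<delta>: "\<delta> > 0" using R by (simp add: \<delta>_def)
  have near: "\<forall>\<^sub>F z in at x within stolz x K. z \<in> stolz x K \<and> z \<noteq> x \<and> dist z x < \<delta>"
    unfolding eventually_at using \<delta> by blast
  have *: "cmod z < 1 \<and> z \<noteq> x \<and> cmod (x - z) < K * (1 - cmod z) \<and> cmod (x - z) * (2 * R + 4) \<le> 1"
    if "z \<in> stolz x K \<and> z \<noteq> x \<and> dist z x < \<delta>" for z
  proof -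
    have "cmod (x - z) * (2 * R + 4) \<le> \<delta> * (2 * R + 4)"
      using that R by (intro mult_right_mono) (auto simp: dist_norm norm_minus_commute)
    then show ?thesis using that R by (auto simp: stolz_def \<delta>_def)
  qed
  show "\<forall>\<^sub>F z in at x within stolz x K. chart R x (jmap R x z) = z"
    using near by eventually_elim (use * jmap_bounds(2)[OF x _ R] in blast)
  show "filterlim (jmap R x) (sector_infinity (6 * K)) (at x within stolz x K)"
    unfolding sector_infinity_def filterlim_inf filterlim_principal
  proof
    have "((\<lambda>z. cmod (x - z)) \<longlongrightarrow> cmod (x - x)) (at x within stolz x K)" by (intro tendsto_intros)
    then have "((\<lambda>z. 2 * cmod (x - z)) \<longlongrightarrow> 0) (at x within stolz x K)"
      by (intro tendsto_mult_right_zero) simp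
    moreover have "\<forall>\<^sub>F z in at x within stolz x K. 2 * cmod (x - z) > 0"
      using near by eventually_elim auto
    ultimately have "filterlim (\<lambda>z. inverse (2 * cmod (x - z))) at_top (at x within stolz x K)"
      by (rule filterlim_inverse_at_top)
    then have "filterlim (\<lambda>z. cmod (jmap R x z)) at_top (at x within stolz x K)"
    proof (rule filterlim_at_top_mono)
      show "\<forall>\<^sub>F z in at x within stolz x K. inverse (2 * cmod (x - z)) \<le> cmod (jmap R x z)"
        using near by eventually_elim (use * jmap_bounds(4)[OF x _ R] in \<open>simp add: inverse_eq_divide\<close>)
    qed
    then show "filterlim (jmap R x) at_infinity (at x within stolz x K)"
      by (rule filterlim_norm_at_top_imp_at_infinity)
    show "\<forall>\<^sub>F z in at x within stolz x K. jmap R x z \<in> {w. 0 < Re w \<and> cmod w \<le> 6 * K * Re w}"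
      using near
    proof eventually_elim
      case (elim z)
      note z = *[OF elim]
      define d where "d = cmod (x - z)"
      have "x \<noteq> z" using z by blast
      then have d: "d > 0" by (simp add: d_def)
      have "3 / d = 6 * (d / (2 * d^2))" using d by (simp add: power2_eq_square)
      also have "\<dots> \<le> 6 * (K * (1 - cmod z) / (2 * d^2))"
        using z d by (intro mult_left_mono divide_right_mono) (auto simp: d_def)
      also have "\<dots> = 6 * K * ((1 - cmod z) / (2 * d^2))" by simp
      also have "\<dots> \<le> 6 * K * Re (jmap R x z)"
        using jmap_bounds(5)[OF x _ R, of z] z K unfolding d_def by (intro mult_left_mono) auto
      finally have "cmod (jmap R x z) \<le> 6 * K * Re (jmap R x z)"
        using jmap_bounds(3)[OF x _ R, of z] z unfolding d_def by linarith
      then show ?case using jmap_bounds(1)[OF x _ R, of z] z by simp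
    qed
  qed
qed

text \<open>\<open>jinv R w - w\<close> is \<open>R^2 / jinv R w\<close>, of modulus at most
  \<open>R\<close>; the derivative then follows from the identity \<open>jinv_deriv\<close>, without
  any estimate of its own.\<close>

lemma jinv_limits:
  assumes R: "R \<ge> 0"
  shows "((\<lambda>w. jinv R w / w) \<longlongrightarrow> 1) (sector_infinity M)"
    and "((\<lambda>w. deriv (jinv R) w) \<longlongrightarrow> 1) (sector_infinity M)"
proof -
  have inf: "filterlim (\<lambda>w. w) at_infinity (sector_infinity M)"
    unfolding sector_infinity_def by (rule filterlim_mono[OF filterlim_ident]) auto
  have pos: "\<forall>\<^sub>F w in sector_infinity M. Re w > 0" unfolding eventually_sector_infinity by auto
  have inv0: "((\<lambda>w. inverse w) \<longlongrightarrow> 0) (sector_infinity M)"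
    by (rule filterlim_compose[OF tendsto_inverse_0 inf])
  have close: "cmod (jinv R w - w) \<le> R" if "Re w > 0" for w
  proof -
    have "jinv R w - w = of_real (R^2) / jinv R w" using jinv_eq[OF that, of R] by (simp add: algebra_simps)
    then have "cmod (jinv R w - w) = R^2 / cmod (jinv R w)" by (simp add: norm_divide norm_power)
    moreover have "R * R \<le> R * cmod (jinv R w)" using cmod_jinv[OF that, of R] R by (intro mult_left_mono) auto
    ultimately show ?thesis using cmod_jinv[OF that, of R] R by (simp add: power2_eq_square divide_le_eq)
  qed
  have "((\<lambda>w. jinv R w / w - 1) \<longlongrightarrow> 0) (sector_infinity M)"
  proof (rule Lim_null_comparison)
    show "\<forall>\<^sub>F w in sector_infinity M. cmod (jinv R w / w - 1) \<le> R * cmod (inverse w)"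
      using pos
    proof eventually_elim
      case (elim w)
      then have "w \<noteq> 0" by auto
      then have "jinv R w / w - 1 = (jinv R w - w) * inverse w" by (simp add: field_simps)
      then show ?case using close[OF elim] by (simp add: norm_mult mult_right_mono)
    qed
    show "((\<lambda>w. R * cmod (inverse w)) \<longlongrightarrow> 0) (sector_infinity M)"
      using tendsto_mult_right_zero[OF tendsto_norm_zero[OF inv0]] by simp
  qed
  then show l1: "((\<lambda>w. jinv R w / w) \<longlongrightarrow> 1) (sector_infinity M)" by (rule LIM_zero_cancel)
  have lim: "((\<lambda>w. inverse (jinv R w / w) * inverse w) \<longlongrightarrow> inverse 1 * 0) (sector_infinity M)"
    by (rule tendsto_mult[OF tendsto_inverse[OF l1] inv0]) simp
  have "((\<lambda>w. inverse (1 + of_real (R^2) * (inverse (jinv R w / w) * inverse w)^2)) \<longlongrightarrow>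
      inverse (1 + of_real (R^2) * (inverse 1 * 0)^2)) (sector_infinity M)"
    by (intro tendsto_inverse tendsto_add tendsto_const tendsto_mult[of "\<lambda>_. of_real (R^2)"] tendsto_power lim) simp
  moreover have "\<forall>\<^sub>F w in sector_infinity M.
      inverse (1 + of_real (R^2) * (inverse (jinv R w / w) * inverse w)^2) = deriv (jinv R) w"
    using pos
  proof eventually_elim
    case (elim w)
    then have "w \<noteq> 0" by auto
    then have "inverse (jinv R w / w) * inverse w = inverse (jinv R w)" by (simp add: inverse_eq_divide)
    then have "1 + of_real (R^2) * (inverse (jinv R w / w) * inverse w)^2 = 1 + of_real (R^2) / jinv R w ^ 2"
      by (simp only: divide_inverse power_inverse)
    then show ?case using jinv_deriv[OF elim, of R] by (metis inverse_unique mult.commute)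
  qed
  ultimately show "((\<lambda>w. deriv (jinv R) w) \<longlongrightarrow> 1) (sector_infinity M)"
    by (auto elim: Lim_transform_eventually)
qed

text \<open>With \<open>p = 1 / csqrt (F - b)\<close> one has \<open>F' = - 2 * p' / p^3\<close>.
  Dividing the derivative of the chart by this expresses \<open>G\<close> through \<open>p\<close>,
  and the Julia-Caratheodory limits of \<open>p / w\<close> and \<open>p'\<close> finish the
  proof.\<close>

lemma regular_pole_in_chart:
  assumes x: "cmod x = 1" and R: "R \<ge> 0" and F: "F holomorphic_on halfplane"
    and slit: "\<And>w. Re w > 0 \<Longrightarrow> F w - b \<notin> \<real>\<^sub>\<le>\<^sub>0" and c: "c > 0"
    and bound: "\<And>w. Re w > 0 \<Longrightarrow> c * Re w * cmod (csqrt (F w - b)) ^ 2 \<le> Re (csqrt (F w - b))"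
    and rel: "\<And>w. Re w > 0 \<Longrightarrow> deriv F w * G (chart R x w) = deriv (chart R x) w"
  shows "regular_pole G x"
proof -
  define p where "p w = inverse (csqrt (F w - b))" for w
  have Q: "Re (csqrt (F w - b)) > 0" if "Re w > 0" for w using Re_csqrt_pos[OF slit[OF that]] .
  have Qnz: "csqrt (F w - b) \<noteq> 0" if "Re w > 0" for w using Q[OF that] by (metis less_irrefl zero_complex.sel(1))
  have holp: "p holomorphic_on halfplane"
    unfolding p_def using slit Qnz by (intro holomorphic_intros F) auto
  have pc: "c * Re w \<le> Re (p w)" if "Re w > 0" for w
  proof -
    have "Re (p w) = Re (csqrt (F w - b)) / cmod (csqrt (F w - b)) ^ 2"
      unfolding p_def cmod_power2 by (simp del: csqrt.sel)
    moreover have "cmod (csqrt (F w - b)) ^ 2 > 0" using Qnz[OF that] by (simp del: csqrt.sel)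
    ultimately show ?thesis using bound[OF that] by (simp add: pos_le_divide_eq del: csqrt.sel)
  qed
  have pnz: "p w \<noteq> 0" if "Re w > 0" for w using Qnz[OF that] by (simp add: p_def)
  obtain C where C: "C > 0"
    "\<And>M e. e > 0 \<Longrightarrow> \<exists>B. \<forall>z. Re z > 0 \<and> cmod z \<le> M * Re z \<and> B \<le> cmod z \<longrightarrow>
        cmod (p z / z - of_real C) \<le> e \<and> cmod (deriv p z - of_real C) \<le> e"
    using julia_caratheodory[OF holp c pc] by metis
  have lims: "((\<lambda>w. p w / w) \<longlongrightarrow> of_real C) (sector_infinity M)"
    "((\<lambda>w. deriv p w) \<longlongrightarrow> of_real C) (sector_infinity M)" for M
  proof -
    have ev: "\<forall>\<^sub>F w in sector_infinity M. dist (p w / w) (of_real C) < e \<and> dist (deriv p w) (of_real C) < e"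
      if e: "e > 0" for e
      using C(2)[of "e / 2" M] e unfolding eventually_sector_infinity dist_norm
      by (smt (verit) field_sum_of_halves)
    show "((\<lambda>w. p w / w) \<longlongrightarrow> of_real C) (sector_infinity M)"
      "((\<lambda>w. deriv p w) \<longlongrightarrow> of_real C) (sector_infinity M)"
      by (rule tendstoI, rule eventually_mono[OF ev], assumption, blast)+
  qed
  \<comment> \<open>Numerator and denominator of the cube are divided by \<open>w\<close>, so that
    each factor converges; the limit is \<open>2 * C^3 / C\<close>.\<close>
  define H where "H w = 2 * cmod (deriv (jinv R) w) * (cmod (p w / w) / cmod (jinv R w / w + inverse w)) ^ 3
      / cmod (deriv p w)" for w
  have formula: "cmod (G (chart R x w) * (x - chart R x w)) = H w" if w: "Re w > 0" for w
  proof -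
    have wnz: "w \<noteq> 0" using w by auto
    have dp: "(p has_field_derivative deriv p w) (at w)"
      using holp w by (intro holomorphic_derivI[of _ halfplane]) auto
    have "((\<lambda>w. b + inverse (p w) ^ 2) has_field_derivative - 2 * deriv p w / p w ^ 3) (at w)"
      by (rule derivative_eq_intros dp refl pnz[OF w] | simp add: power2_eq_square power3_eq_cube field_simps pnz[OF w])+
    moreover have "b + inverse (p v) ^ 2 = F v" for v by (simp add: p_def)
    ultimately have dF: "deriv F w = - 2 * deriv p w / p w ^ 3" by (simp add: DERIV_imp_deriv)
    let ?J = "jinv R w" and ?D = "deriv (jinv R) w"
    have J1: "?J + 1 \<noteq> 0" using jinv_plus_one[OF w] .
    have "cmod (deriv F w * G (chart R x w)) * cmod (x - chart R x w) = cmod (2 * x * ?D / (?J + 1)^2) * cmod (2 * x / (?J + 1))"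
      unfolding rel[OF w] chart_deriv[OF w] chart_diff[OF w] ..
    then have "(2 * cmod (deriv p w) / cmod (p w) ^ 3) * cmod (G (chart R x w) * (x - chart R x w))
        = 4 * cmod ?D / cmod (?J + 1) ^ 3"
      using x unfolding dF by (simp add: norm_mult norm_divide norm_power power2_eq_square power3_eq_cube mult.assoc)
    moreover have "deriv p w \<noteq> 0"
    proof
      assume "deriv p w = 0"
      then have "deriv (chart R x) w = 0" using rel[OF w] dF by simp
      then have "?D = 0" unfolding chart_deriv[OF w] using J1 x by auto
      then show False using jinv_deriv[OF w, of R] by simp
    qed
    ultimately have "cmod (G (chart R x w) * (x - chart R x w))
        = 4 * cmod ?D / cmod (?J + 1) ^ 3 * (cmod (p w) ^ 3 / (2 * cmod (deriv p w)))"
      using pnz[OF w] J1 by (simp add: field_simps)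
    also have "\<dots> = 2 * cmod ?D * (cmod (p w) / cmod (?J + 1)) ^ 3 / cmod (deriv p w)"
      by (simp add: power_divide mult_ac)
    also have "cmod (p w) / cmod (?J + 1) = cmod (p w / w) / cmod (?J / w + inverse w)"
    proof -
      have "?J / w + inverse w = (?J + 1) / w" using wnz by (simp add: field_simps)
      then show ?thesis using wnz by (simp add: norm_divide)
    qed
    finally show ?thesis by (simp add: H_def)
  qed
  have limH: "(H \<longlongrightarrow> 2 * C^2) (sector_infinity M)" for M
  proof -
    have inf: "filterlim (\<lambda>w. w) at_infinity (sector_infinity M)"
      unfolding sector_infinity_def by (rule filterlim_mono[OF filterlim_ident]) auto
    have inv0: "((\<lambda>w. inverse w) \<longlongrightarrow> 0) (sector_infinity M)"
      by (rule filterlim_compose[OF tendsto_inverse_0 inf])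
    have "(H \<longlongrightarrow> 2 * cmod 1 * (cmod (of_real C) / cmod (1 + 0)) ^ 3 / cmod (of_real C)) (sector_infinity M)"
      unfolding H_def by (intro tendsto_intros lims jinv_limits R inv0) (use C(1) in auto)
    then show ?thesis using C(1) by (simp add: power3_eq_cube power2_eq_square)
  qed
  have "((\<lambda>z. cmod (G z * (x - z))) \<longlongrightarrow> 2 * C^2) (nontangential x)"
  proof (rule nontangential_tendsto)
    fix K :: real assume K: "K > 1"
    have "((\<lambda>z. H (jmap R x z)) \<longlongrightarrow> 2 * C^2) (at x within stolz x K)"
      by (rule filterlim_compose[OF limH jmap_filterlim(1)[OF x R K]])
    moreover have "\<forall>\<^sub>F w in sector_infinity (6 * K). Re w > 0" unfolding eventually_sector_infinity by auto
    then have "\<forall>\<^sub>F z in at x within stolz x K. Re (jmap R x z) > 0"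
      using jmap_filterlim(1)[OF x R K] by (rule eventually_compose_filterlim)
    then have "\<forall>\<^sub>F z in at x within stolz x K. H (jmap R x z) = cmod (G z * (x - z))"
      using jmap_filterlim(2)[OF x R K] by eventually_elim (metis formula)
    ultimately show "((\<lambda>z. cmod (G z * (x - z))) \<longlongrightarrow> 2 * C^2) (at x within stolz x K)"
      by (rule Lim_transform_eventually)
  qed
  then have "Liminf (nontangential x) (\<lambda>z. ereal (cmod (G z * (x - z)))) = ereal (2 * C^2)"
    using nontangential_neq_bot[OF x] by (intro lim_imp_Liminf) auto
  then show ?thesis unfolding regular_pole_def using C(1) by simp
qed

section \<open>Koenigs functions\<close>

text \<open>Translates Julia's condition from the disc to the half-plane. \<open>A\<close> collects
  the candidates for the value of \<open>F\<close> at \<open>x\<close>, and \<open>a n\<close> is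
  the one that \<open>F\<close> is near at the \<open>n\<close>-th point.\<close>

lemma regular_pole_of_sequence:
  fixes a z :: "nat \<Rightarrow> complex"
  assumes x: "cmod x = 1" and R: "R \<ge> 0" and F: "F holomorphic_on halfplane"
    and slit: "\<And>b w. b \<in> A \<Longrightarrow> Re w > 0 \<Longrightarrow> F w - b \<notin> \<real>\<^sub>\<le>\<^sub>0"
    and A: "\<And>B. finite (A \<inter> cball 0 B)"
    and rel: "\<And>w. Re w > 0 \<Longrightarrow> deriv F w * G (chart R x w) = deriv (chart R x) w"
    and z: "\<And>n. z n \<in> ball 0 1" "z \<longlonglongrightarrow> x" and c: "c > 0"
    and ev: "\<forall>\<^sub>F n in sequentially. a n \<in> A \<and>
        c * sqrt (cmod (F (jmap R x (z n)) - a n)) \<le> 1 - cmod (z n)"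
  shows "regular_pole G x"
proof -
  have "((\<lambda>n. cmod (x - z n) * (2 * R + 4)) \<longlonglongrightarrow> cmod (x - x) * (2 * R + 4))"
    by (intro tendsto_intros z(2))
  then have "\<forall>\<^sub>F n in sequentially. cmod (x - z n) * (2 * R + 4) < 1"
    by (rule order_tendstoD) simp
  then have "\<forall>\<^sub>F n in sequentially. cmod (x - z n) * (2 * R + 4) < 1 \<and> a n \<in> A \<and>
        c * sqrt (cmod (F (jmap R x (z n)) - a n)) \<le> 1 - cmod (z n)"
    using ev by eventually_elim blast
  then obtain m where m: "\<And>n. n \<ge> m \<Longrightarrow> cmod (x - z n) * (2 * R + 4) < 1 \<and> a n \<in> A \<and>
        c * sqrt (cmod (F (jmap R x (z n)) - a n)) \<le> 1 - cmod (z n)"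
    unfolding eventually_sequentially by blast
  define y where "y n = z (n + m)" for n
  define e where "e n = jmap R x (y n)" for n
  have ylim: "y \<longlonglongrightarrow> x" unfolding y_def using z(2) by (rule LIMSEQ_ignore_initial_segment)
  have y: "cmod (y n) < 1" "cmod (x - y n) * (2 * R + 4) \<le> 1" "a (n + m) \<in> A"
    "c * sqrt (cmod (F (e n) - a (n + m))) \<le> 1 - cmod (y n)" for n
    using m[of "n + m"] z(1)[of "n + m"] by (auto simp: y_def e_def)
  note jb = jmap_bounds[OF x y(1) R y(2), folded e_def]
  have xy: "cmod (x - y n) > 0" for n using x y(1)[of n] by auto
  \<comment> \<open>The 18 is \<open>9 * 2\<close>: \<open>cmod (e n) ^ 2\<close> is at most
    \<open>9 / ?d^2\<close>, and \<open>Re (e n)\<close> is at least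
    \<open>(1 - cmod (y n)) / (2 * ?d^2)\<close>.\<close>
  have lower: "c / 18 * sqrt (cmod (F (e n) - a (n + m))) * cmod (e n) ^ 2 \<le> Re (e n)" for n
  proof -
    let ?d = "cmod (x - y n)"
    have "cmod (e n) ^ 2 \<le> (3 / ?d) ^ 2" using jb(3) by (intro power_mono) auto
    then have "c * sqrt (cmod (F (e n) - a (n + m))) * cmod (e n) ^ 2 \<le> (1 - cmod (y n)) * (3 / ?d) ^ 2"
      using y(1)[of n] y(4)[of n] by (intro mult_mono) auto
    also have "\<dots> = 18 * ((1 - cmod (y n)) / (2 * ?d^2))" using xy[of n] by (simp add: field_simps)
    also have "\<dots> \<le> 18 * Re (e n)" using jb(5)[of n] by linarith
    finally show ?thesis by simp
  qed
  have top: "filterlim (\<lambda>n. cmod (e n)) at_top sequentially"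
  proof (rule filterlim_at_top_mono)
    have "((\<lambda>n. cmod (x - y n)) \<longlonglongrightarrow> cmod (x - x))" by (intro tendsto_intros ylim)
    then have "((\<lambda>n. 2 * cmod (x - y n)) \<longlonglongrightarrow> 0)" by (intro tendsto_mult_right_zero) simp
    then show "filterlim (\<lambda>n. inverse (2 * cmod (x - y n))) at_top sequentially"
      by (rule filterlim_inverse_at_top) (use xy in \<open>auto intro!: always_eventually\<close>)
    show "\<forall>\<^sub>F n in sequentially. inverse (2 * cmod (x - y n)) \<le> cmod (e n)"
      using jb(4) by (intro always_eventually) (simp add: inverse_eq_divide)
  qed
  have zero: "(\<lambda>n. F (e n) - a (n + m)) \<longlonglongrightarrow> 0"
  proof (rule Lim_null_comparison)
    have "(\<lambda>n. ((1 - cmod (y n)) / c) ^ 2) \<longlonglongrightarrow> ((1 - cmod x) / c) ^ 2" by (intro tendsto_intros ylim) (use c in auto)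
    then show "(\<lambda>n. ((1 - cmod (y n)) / c) ^ 2) \<longlonglongrightarrow> 0" using x by simp
    show "\<forall>\<^sub>F n in sequentially. cmod (F (e n) - a (n + m)) \<le> ((1 - cmod (y n)) / c) ^ 2"
    proof (intro always_eventually allI)
      fix n
      have "sqrt (cmod (F (e n) - a (n + m))) \<le> (1 - cmod (y n)) / c"
        using y(4)[of n] c by (simp add: pos_le_divide_eq mult.commute)
      then show "cmod (F (e n) - a (n + m)) \<le> ((1 - cmod (y n)) / c) ^ 2" by (rule sqrt_le_D)
    qed
  qed
  obtain b where b: "b \<in> A"
    "\<And>w. Re w > 0 \<Longrightarrow> c / 18 * Re w * cmod (csqrt (F w - b)) ^ 2 \<le> Re (csqrt (F w - b))"
    by (rule julia_branches[OF F slit A y(3) jb(1) lower top zero]) (use c in auto)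
  show ?thesis
    by (rule regular_pole_in_chart[OF x R F slit[OF b(1)] _ b(2) rel]) (use c in auto)
qed

text \<open>Differentiates the functional equation at time 0, one-sidedly because the semigroup has
  no negative times.\<close>

lemma koenigs_deriv:
  assumes gen: "is_generator \<phi> G" and z: "z \<in> ball 0 1" and id: "\<phi> 0 z = z"
    and h: "h holomorphic_on ball 0 1"
    and eq: "\<And>t. t \<ge> 0 \<Longrightarrow> h (\<phi> t z) = u t"
    and u: "(u has_vector_derivative u') (at 0 within {0..})"
  shows "deriv h z * G z = u'"
proof -
  have "((\<lambda>s. \<phi> s z) has_vector_derivative G (\<phi> 0 z)) (at 0 within {0..})"
    using gen z unfolding is_generator_def by (metis order_refl)
  then have v: "((\<lambda>s. \<phi> s z) has_vector_derivative G z) (at 0 within {0..})" by (simp add: id)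
  have "(h has_field_derivative deriv h z) (at z)"
    using h z by (intro holomorphic_derivI[of _ "ball 0 1"]) auto
  then have "(h has_field_derivative deriv h z) (at (\<phi> 0 z) within (\<lambda>s. \<phi> s z) ` {0..})"
    unfolding id by (rule has_field_derivative_at_within)
  from field_vector_diff_chain_within[OF v this]
  have "((h \<circ> (\<lambda>s. \<phi> s z)) has_vector_derivative G z * deriv h z) (at 0 within {0..})" .
  then have "(u has_vector_derivative G z * deriv h z) (at 0 within {0..})"
    by (rule has_vector_derivative_transform[rotated 2]) (use eq in auto)
  moreover have "at (0::real) within {0..} \<noteq> bot" by (simp add: at_within_Ici_at_right)
  ultimately show ?thesis using u vector_derivative_unique_within by (metis mult.commute)
qed

text \<open>Otherwise continuity of the inverse at \<open>w0\<close> would make the radius converge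
  to an interior point.\<close>

lemma not_in_image_of_radial_limit:
  fixes h :: "complex \<Rightarrow> complex"
  assumes h: "h holomorphic_on ball 0 1" "inj_on h (ball 0 1)" and x: "cmod x = 1"
    and lim: "((\<lambda>t. h (of_real t * x)) \<longlongrightarrow> w0) (at_left 1)"
  shows "w0 \<notin> h ` ball 0 1"
proof
  assume w0: "w0 \<in> h ` ball 0 1"
  obtain k where k: "k holomorphic_on h ` ball 0 1" "\<And>z. z \<in> ball 0 1 \<Longrightarrow> k (h z) = z"
    using holomorphic_has_inverse[OF h(1) open_ball h(2)] by metis
  have "isCont k w0"
    using k(1) w0 open_mapping_thm3[OF h(1) open_ball h(2)]
    by (metis continuous_on_eq_continuous_at holomorphic_on_imp_continuous_on)
  then have "((\<lambda>t. k (h (of_real t * x))) \<longlongrightarrow> k w0) (at_left 1)"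
    using lim by (rule isCont_tendsto_compose)
  moreover have "\<forall>\<^sub>F t in at_left (1::real). t \<in> {0<..<1}"
    by (intro eventually_at_leftI[of 0]) auto
  then have "\<forall>\<^sub>F t in at_left 1. k (h (of_real t * x)) = of_real t * x"
    by eventually_elim (use k(2) x in \<open>simp add: norm_mult\<close>)
  ultimately have "((\<lambda>t. of_real t * x) \<longlongrightarrow> k w0) (at_left (1::real))"
    by (rule Lim_transform_eventually)
  moreover have "((\<lambda>t. of_real t * x) \<longlongrightarrow> of_real 1 * x) (at_left (1::real))" by (intro tendsto_intros)
  ultimately have "k w0 = of_real 1 * x" using tendsto_unique trivial_limit_at_left_real by blast
  moreover have "k w0 \<in> ball 0 1" using w0 k(2) by auto
  ultimately show False using x by simp
qed

lemma int_multiples_finite: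
  fixes v :: complex
  assumes "v \<noteq> 0"
  shows "finite (range (\<lambda>m. of_int m * v) \<inter> cball 0 B)"
proof (rule finite_subset)
  let ?N = "\<lceil>B / cmod v\<rceil>"
  show "range (\<lambda>m. of_int m * v) \<inter> cball 0 B \<subseteq> (\<lambda>m. of_int m * v) ` {- ?N..?N}"
  proof
    fix y assume "y \<in> range (\<lambda>m. of_int m * v) \<inter> cball 0 B"
    then obtain m :: int where m: "y = of_int m * v" "cmod (of_int m * v) \<le> B" by auto
    then have "\<bar>of_int m\<bar> \<le> B / cmod v" using assms by (simp add: norm_mult pos_le_divide_eq)
    then have "\<bar>m\<bar> \<le> ?N" by linarith
    then show "y \<in> (\<lambda>m. of_int m * v) ` {- ?N..?N}" unfolding m(1) by (intro imageI) auto
  qed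
qed simp

theorem theorem6p5:
  fixes \<phi> :: "real \<Rightarrow> complex \<Rightarrow> complex" and G h :: "complex \<Rightarrow> complex"
    and \<tau> x w0 :: complex and \<Omega>0 :: "complex set" and r :: real
  assumes "one_param_semigroup \<phi>"
    and "is_generator \<phi> G"
    and "denjoy_wolff_point \<phi> \<tau>"
    and "koenigs_function \<phi> G \<tau> h"
    and "cmod x = 1"
    and "angular_limit h x w0"
    and "jordan_domain \<Omega>0" and "\<Omega>0 \<subseteq> h ` ball 0 1"
    and "w0 \<in> frontier \<Omega>0"
    and "0 < r" and "r < 1"
    and "(\<lambda>s. h (of_real s * x)) ` {r..<1} \<subseteq> \<Omega>0"
    and "dini_corner \<Omega>0 w0 (2 * pi)"
  shows "regular_pole G x"
proof -
  note x = \<open>cmod x = 1\<close> and gen = \<open>is_generator \<phi> G\<close>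
  have h: "h holomorphic_on ball 0 1" "inj_on h (ball 0 1)"
    using assms(4) by (auto simp: koenigs_function_def)
  have \<phi>0: "\<phi> 0 z = z" if "z \<in> ball 0 1" for z
    using assms(1) that by (auto simp: one_param_semigroup_def)
  have \<phi>ball: "\<phi> t z \<in> ball 0 1" if "t \<ge> 0" "z \<in> ball 0 1" for t z
    using assms(1) that unfolding one_param_semigroup_def by blast
  have lim: "((\<lambda>t. h (of_real t * x)) \<longlongrightarrow> w0) (at_left 1)"
    using assms(6) radius_nontangential[OF x] unfolding angular_limit_def by (rule filterlim_compose)
  have w0: "w0 \<notin> h ` ball 0 1" by (rule not_in_image_of_radial_limit[OF h x lim])
  obtain c and z :: "nat \<Rightarrow> complex" where c: "c > 0" and z: "\<And>n. z n \<in> ball 0 1" "z \<longlonglongrightarrow> x"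
    and hz: "(\<lambda>n. h (z n)) \<longlonglongrightarrow> w0" "\<And>n. c * sqrt (cmod (h (z n) - w0)) \<le> 1 - cmod (z n)"
    by (rule corner_approach[OF h w0 x lim assms(7,8,10,11,12,13)]) blast
  have near: "\<forall>\<^sub>F n in sequentially. chart R x (jmap R x (z n)) = z n \<and> Re (jmap R x (z n)) > 0"
    if R: "R \<ge> 0" for R
  proof -
    have "((\<lambda>n. cmod (x - z n) * (2 * R + 4)) \<longlonglongrightarrow> cmod (x - x) * (2 * R + 4))"
      by (intro tendsto_intros z(2))
    then have "\<forall>\<^sub>F n in sequentially. cmod (x - z n) * (2 * R + 4) < 1"
      by (rule order_tendstoD) simp
    then show ?thesis
      by eventually_elim (use jmap_bounds(1,2)[OF x _ R] z(1) in \<open>simp add: less_imp_le\<close>)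
  qed
  have chart_d: "(chart R x has_field_derivative deriv (chart R x) w) (at w)" if "Re w > 0" for R w
    using chart_holomorphic that by (intro holomorphic_derivI[of _ halfplane]) auto
  have h_d: "(h has_field_derivative deriv h (chart R x w)) (at (chart R x w))" if "Re w > 0" for R w
    using h(1) chart_in_ball[OF x that] by (intro holomorphic_derivI[of _ "ball 0 1"]) auto
  have holhc: "(\<lambda>w. h (chart R x w)) holomorphic_on halfplane" for R
    using holomorphic_on_compose_gen[OF chart_holomorphic h(1)] chart_in_ball[OF x] by (force simp: o_def)
  show ?thesis
  proof (cases "\<tau> \<in> ball 0 1")
    case False
    then have shift: "h (\<phi> t z) = h z + of_real t" if "t \<ge> 0" "z \<in> ball 0 1" for t z
      using assms(4) that by (auto simp: koenigs_function_def)
    have hG: "deriv h z * G z = 1" if "z \<in> ball 0 1" for z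
    proof (rule koenigs_deriv[OF gen that \<phi>0[OF that] h(1) shift[OF _ that]])
      show "((\<lambda>t. h z + of_real t) has_vector_derivative 1) (at 0 within {0..})"
        by (auto intro!: derivative_eq_intros simp: has_vector_derivative_def scaleR_conv_of_real)
    qed
    \<comment> \<open>No interior point has to be avoided here, so the chart is the plain Cayley
      one, \<open>R = 0\<close>, and 0 is the only candidate value.\<close>
    define F where "F w = h (chart 0 x w) - w0" for w
    show ?thesis
    proof (rule regular_pole_of_sequence[OF x order_refl, of F "{0}" G z c "\<lambda>_. 0"])
      show "F holomorphic_on halfplane" unfolding F_def by (intro holomorphic_intros holhc)
      \<comment> \<open>A point of the slit would be carried by the semigroup, after time
        \<open>- t\<close>, to a point of the disc with \<open>h\<close>-value
        \<open>w0\<close>.\<close>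
      show "F w - b \<notin> \<real>\<^sub>\<le>\<^sub>0" if bw: "b \<in> {0}" "Re w > 0" for b w
      proof
        assume "F w - b \<in> \<real>\<^sub>\<le>\<^sub>0"
        then obtain t where t: "t \<le> 0" "h (chart 0 x w) - w0 = of_real t"
          using bw(1) by (auto simp: F_def elim: nonpos_Reals_cases)
        have "h (\<phi> (- t) (chart 0 x w)) = w0"
          using shift[of "- t" "chart 0 x w"] t chart_in_ball[OF x bw(2)] by (simp add: algebra_simps)
        then show False using w0 \<phi>ball[of "- t" "chart 0 x w"] t chart_in_ball[OF x bw(2)] by auto
      qed
      show "deriv F w * G (chart 0 x w) = deriv (chart 0 x) w" if "Re w > 0" for w
      proof -
        have "(F has_field_derivative deriv h (chart 0 x w) * deriv (chart 0 x) w) (at w)"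
          unfolding F_def using DERIV_chain2[OF h_d[OF that] chart_d[OF that]]
          by (auto intro!: derivative_eq_intros)
        then have "deriv F w * G (chart 0 x w) = (deriv h (chart 0 x w) * G (chart 0 x w)) * deriv (chart 0 x) w"
          by (simp add: DERIV_imp_deriv)
        then show ?thesis using hG[OF chart_in_ball[OF x that]] by simp
      qed
      show "\<forall>\<^sub>F n in sequentially. 0 \<in> {0} \<and> c * sqrt (cmod (F (jmap 0 x (z n)) - 0)) \<le> 1 - cmod (z n)"
        using near[OF order_refl] by eventually_elim (use hz(2) in \<open>simp add: F_def\<close>)
    qed (use z c in auto)
  next
    case True
    define l where "l = deriv G \<tau>"
    have h\<tau>: "h \<tau> = 0" and scale: "\<And>t z. t \<ge> 0 \<Longrightarrow> z \<in> ball 0 1 \<Longrightarrow> h (\<phi> t z) = exp (l * of_real t) * h z"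
      using assms(4) True by (auto simp: koenigs_function_def l_def)
    have hG: "deriv h z * G z = l * h z" if "z \<in> ball 0 1" for z
    proof (rule koenigs_deriv[OF gen that \<phi>0[OF that] h(1) scale[OF _ that]])
      have "((\<lambda>t. exp (l * t) * h z) has_field_derivative l * h z) (at 0)"
        by (auto intro!: derivative_eq_intros)
      then show "((\<lambda>t. exp (l * of_real t) * h z) has_vector_derivative l * h z) (at 0 within {0..})"
        using has_vector_derivative_real_field[of "\<lambda>t. exp (l * t) * h z" "l * h z" 0] by simp
    qed
    \<comment> \<open>A vanishing multiplier would make \<open>\<phi> 1\<close> the identity by
      injectivity of \<open>h\<close>, against the exclusion of automorphisms.\<close>
    have l0: "l \<noteq> 0"
    proof
      assume "l = 0"
      then have "\<phi> 1 z = z" if "z \<in> ball 0 1" for z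
        using scale[of 1 z] \<phi>ball[of 1 z] that h(2) by (simp add: inj_on_eq_iff)
      then have "bij_betw (\<phi> 1) (ball 0 1) (ball 0 1)"
        by (subst bij_betw_cong[where g = id]) auto
      then show False using assms(1) by (auto simp: one_param_semigroup_def)
    qed
    have w00: "w0 \<noteq> 0" using w0 h\<tau> True by (metis image_eqI)
    \<comment> \<open>The modulus of the Cayley image of \<open>\<tau>\<close>. Chart points have
      \<open>cmod (jinv R w) > R\<close>, so they avoid \<open>\<tau>\<close>, the only zero of
      \<open>h\<close>, and a logarithm of \<open>h / w0\<close> exists.\<close>
    define R where "R = cmod ((x + \<tau>) / (x - \<tau>))"
    have R: "R \<ge> 0" by (simp add: R_def)
    have not\<tau>: "h (chart R x w) \<noteq> 0" if w: "Re w > 0" for w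
    proof
      assume "h (chart R x w) = 0"
      then have "chart R x w = \<tau>" using h\<tau> h(2) True chart_in_ball[OF x w] by (metis inj_onD)
      moreover have "x - \<tau> \<noteq> 0" using True x by auto
      ultimately have "jinv R w = (x + \<tau>) / (x - \<tau>)"
        using chart_diff[OF w, of x R] jinv_plus_one[OF w, of R] by (simp add: field_simps)
      then show False using cmod_jinv[OF w, of R] by (simp add: R_def)
    qed
    have "(\<lambda>w. h (chart R x w) / w0) holomorphic_on halfplane"
      using w00 by (intro holomorphic_intros holhc) auto
    moreover have "contractible halfplane" by (intro convex_imp_contractible convex_halfplane)
    ultimately obtain g where g: "g holomorphic_on halfplane" "\<And>w. w \<in> halfplane \<Longrightarrow> h (chart R x w) / w0 = exp (g w)"
      using contractible_imp_holomorphic_log[of "\<lambda>w. h (chart R x w) / w0" halfplane] not\<tau> w00 by auto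
    have hg: "h (chart R x w) = w0 * exp (g w)" if "Re w > 0" for w
      using g(2)[of w] that w00 by (simp add: field_simps)
    define F where "F w = g w / l" for w
    \<comment> \<open>The period of \<open>log / l\<close>: at points with \<open>h\<close> near
      \<open>w0\<close>, \<open>F\<close> is near some multiple of \<open>v\<close>.\<close>
    define v where "v = of_real (2 * pi) * \<i> / l"
    define A where "A = range (\<lambda>m. of_int m * v)"
    \<comment> \<open>The difference between the chosen branch and the principal one; subtracting it
      leaves \<open>Ln (h (z n) / w0) / l\<close>, which is small when \<open>h (z n)\<close> is
      near \<open>w0\<close>.\<close>
    define a where "a n = F (jmap R x (z n)) - Ln (h (z n) / w0) / l" for n
    \<comment> \<open>The 2 comes from \<open>norm_Ln_le\<close>, valid once
      \<open>h (z n) / w0\<close> is within \<open>1/2\<close> of 1.\<close>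
    define K where "K = 2 / (cmod w0 * cmod l)"
    have K: "K > 0" using w00 l0 by (simp add: K_def)
    show ?thesis
    proof (rule regular_pole_of_sequence[OF x R, of F A G z "c / sqrt K" a])
      show "F holomorphic_on halfplane" unfolding F_def using l0 by (intro holomorphic_intros g) auto
      show "finite (A \<inter> cball 0 B)" for B
        unfolding A_def using l0 by (intro int_multiples_finite) (auto simp: v_def)
      show "F w - b \<notin> \<real>\<^sub>\<le>\<^sub>0" if "b \<in> A" "Re w > 0" for b w
      proof
        assume "F w - b \<in> \<real>\<^sub>\<le>\<^sub>0"
        then obtain t where t: "t \<le> 0" "F w - b = of_real t" by (auto elim: nonpos_Reals_cases)
        obtain m :: int where "b = of_int m * v" using \<open>b \<in> A\<close> by (auto simp: A_def)
        then have "g w = l * of_real t + of_real (of_int (2 * m) * pi) * \<i>"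
          using t(2) l0 by (simp add: F_def v_def field_simps)
        \<comment> \<open>Multiples of the period disappear in the exponential, so one argument
          rules out the slits at all \<open>b\<close> in \<open>A\<close>.\<close>
        then have "exp (g w) = exp (l * of_real t)" unfolding exp_eq by blast
        then have "h (\<phi> (- t) (chart R x w)) = w0"
          using scale[of "- t" "chart R x w"] t hg[OF that(2)] chart_in_ball[OF x that(2)]
          by (simp add: exp_minus)
        then show False using w0 \<phi>ball[of "- t" "chart R x w"] t chart_in_ball[OF x that(2)] by auto
      qed
      show "deriv F w * G (chart R x w) = deriv (chart R x) w" if w: "Re w > 0" for w
      proof -
        have gd: "(g has_field_derivative deriv g w) (at w)"
          using g(1) w by (intro holomorphic_derivI[of _ halfplane]) auto
        have "((\<lambda>w. h (chart R x w)) has_field_derivative w0 * (exp (g w) * deriv g w)) (at w)"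
        proof (rule has_field_derivative_transform_within_open[OF _ open_halfplane])
          show "((\<lambda>w. w0 * exp (g w)) has_field_derivative w0 * (exp (g w) * deriv g w)) (at w)"
            by (auto intro!: derivative_eq_intros gd)
        qed (use w hg in auto)
        then have "deriv h (chart R x w) * deriv (chart R x) w = h (chart R x w) * deriv g w"
          using DERIV_unique[OF DERIV_chain2[OF h_d[OF w] chart_d[OF w]]] hg[OF w] by simp
        then have "h (chart R x w) * (deriv g w * G (chart R x w)) =
            (deriv h (chart R x w) * G (chart R x w)) * deriv (chart R x) w"
          by (simp add: mult_ac)
        also have "\<dots> = h (chart R x w) * (l * deriv (chart R x) w)"
          using hG[OF chart_in_ball[OF x w]] by (simp add: mult_ac)
        finally have "deriv g w * G (chart R x w) = l * deriv (chart R x) w" using not\<tau>[OF w] by simp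
        moreover have "deriv F w = deriv g w / l"
          unfolding F_def by (intro DERIV_imp_deriv DERIV_cdivide gd)
        ultimately show ?thesis using l0 by simp
      qed
      have "(\<lambda>n. h (z n) / w0 - 1) \<longlonglongrightarrow> w0 / w0 - 1" using w00 by (intro tendsto_intros hz)
      then have "(\<lambda>n. cmod (h (z n) / w0 - 1)) \<longlonglongrightarrow> 0" using w00 by (simp add: tendsto_norm_zero)
      then have "\<forall>\<^sub>F n in sequentially. cmod (h (z n) / w0 - 1) < 1/2"
        by (rule order_tendstoD) simp
      then show "\<forall>\<^sub>F n in sequentially. a n \<in> A \<and>
          c / sqrt K * sqrt (cmod (F (jmap R x (z n)) - a n)) \<le> 1 - cmod (z n)"
        using near[OF R]
      proof eventually_elim
        case (elim n)
        let ?e = "jmap R x (z n)"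
        have hn: "h (z n) / w0 = exp (g ?e)" using hg[of ?e] elim w00 by simp
        then have "exp (g ?e) = exp (Ln (h (z n) / w0))" by (simp add: exp_Ln)
        then obtain m :: int where "g ?e = Ln (h (z n) / w0) + of_real (of_int (2 * m) * pi) * \<i>"
          unfolding exp_eq by blast
        then have "a n = of_int m * v" using l0 by (simp add: a_def F_def v_def field_simps)
        then have aA: "a n \<in> A" by (auto simp: A_def)
        have "cmod (Ln (1 + (h (z n) / w0 - 1))) \<le> 2 * cmod (h (z n) / w0 - 1)"
          using elim by (intro norm_Ln_le) simp
        also have "h (z n) / w0 - 1 = (h (z n) - w0) / w0" using w00 by (simp add: field_simps)
        finally have "cmod (F ?e - a n) \<le> K * cmod (h (z n) - w0)"
          using l0 w00 by (simp add: a_def K_def norm_divide field_simps)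
        then have "sqrt (cmod (F ?e - a n)) \<le> sqrt K * sqrt (cmod (h (z n) - w0))"
          unfolding real_sqrt_mult[symmetric] by (rule real_sqrt_le_mono)
        then have "c / sqrt K * sqrt (cmod (F ?e - a n)) \<le> c / sqrt K * (sqrt K * sqrt (cmod (h (z n) - w0)))"
          using c K by (intro mult_left_mono) auto
        also have "\<dots> \<le> 1 - cmod (z n)" using hz(2)[of n] K by simp
        finally show ?case using aA by blast
      qed
    qed (use z c K in auto)
  qed
qed

end
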